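(* Assume $m,n\ge r$. For any $S_{q,F}(m|n,r)$-supermodule $V$, there is an $H_{q^2,F}(r)$-module isomorphism $$(\mathfrak f_\omega V)^\sharp\cong(\mathfrak f_{\omega'}V)^\tau.$$
   Context: Let $m,n\ge r\ge1$ be integers; $\bar i=\bar 0$ for $1\le i\le m$ and $\bar i=\bar 1$ for $m<i\le m+n$. Let $\epsilon_1,\dots,\epsilon_{m+n}$ be the standard basis of $\mathbb Z^{m+n}$, $(\epsilon_i,\epsilon_j)=(-1)^{\bar i}\delta_{ij}$, $\alpha_i=\epsilon_i-\epsilon_{i+1}$. Let $\upsilon$ be an indeterminate, $\upsilon_a=\upsilon^{(-1)^{\bar a}}$, $\mathcal Z=\mathbb Z[\upsilon,\upsilon^{-1}]$, and $[X,Y]=XY-(-1)^{\bar X\bar Y}YX$ for homogeneous $X,Y$. $U_\upsilon(\mathfrak{gl}_{m|n})$ is the $\mathbb Q(\upsilon)$-superalgebra generated by $E_a,F_a$ ($1\le a<m+n$), $K_j^{\pm1}$ ($1\le j\le m+n$), with $E_m,F_m$ odd and the other generators even, subject to (whenever the indices make sense): $K_aK_b=K_bK_a$, $K_aK_a^{-1}=K_a^{-1}K_a=1$; $K_aE_b=\upsilon^{(\epsilon_a,\alpha_b)}E_bK_a$, $K_aF_b=\upsilon^{-(\epsilon_a,\alpha_b)}F_bK_a$; $[E_a,F_b]=\delta_{a,b}\frac{K_aK_{a+1}^{-1}-K_a^{-1}K_{a+1}}{\upsilon_a-\upsilon_a^{-1}}$; $E_aE_b=E_bE_a$, $F_aF_b=F_bF_a$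 if $|a-b|>1$; for $a\ne m$, $|a-b|=1$: $E_a^2E_b-(\upsilon_a+\upsilon_a^{-1})E_aE_bE_a+E_bE_a^2=0$ and the same with $F$ in place of $E$; $E_m^2=F_m^2=[E_m,E_{m-1,m+2}]=[F_m,E_{m+2,m-1}]=0$, where $E_{m-1,m+2}=E_{m-1}E_mE_{m+1}-\upsilon E_{m-1}E_{m+1}E_m-\upsilon^{-1}E_mE_{m+1}E_{m-1}+E_{m+1}E_mE_{m-1}$ and $E_{m+2,m-1}=F_{m+1}F_mF_{m-1}-\upsilon^{-1}F_mF_{m+1}F_{m-1}-\upsilon F_{m-1}F_{m+1}F_m+F_{m-1}F_mF_{m+1}$. Put $[M]!=\prod_{i=1}^M\frac{\upsilon^i-\upsilon^{-i}}{\upsilon-\upsilon^{-1}}$, $X^{(M)}=X^M/[M]!$, ${K_i\brack t}=\prod_{s=1}^t\frac{K_i\upsilon_i^{-s+1}-K_i^{-1}\upsilon_i^{s-1}}{\upsilon_i^s-\upsilon_i^{-s}}$. $U_{\upsilon,\mathcal Z}$ is the $\mathcal Z$-subsuperalgebra generated by all $E_i^{(M)},F_i^{(M)},K_j^{\pm1},{K_j\brack t}$ ($t,M\in\mathbb N$), and $U_{q,F}(m|n)=U_{\upsilon,\mathcal Z}\otimes_{\mathcal Z}F$ via $\upsilon\mapsto q$. Here $F$ is a field of characteristic $\ne2$ and $q\in F$ is nonzero; either $q$ is a primitive $l'$-th root of unity with $l'\ge3$, or $q$ is not a root of unity. $q$-Schur superalgebra: let $I_r$ be the ideal of $U_\upsilon(\mathfrak{gl}_{m|n})$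 generated by $K_1\cdots K_mK_{m+1}^{-1}\cdots K_{m+n}^{-1}-\upsilon^r$ and $(K_a-1)(K_a-\upsilon_a)\cdots(K_a-\upsilon_a^r)$, $1\le a\le m+n$. By a theorem of El Turkey and Kujawa, $S_\upsilon(m|n,r)=U_\upsilon(\mathfrak{gl}_{m|n})/I_r$; let $\eta_r$ be the quotient map, $S_{\upsilon,\mathcal Z}(m|n,r)=\eta_r(U_{\upsilon,\mathcal Z})$ (which is $\mathcal Z$-free), $S_{q,F}(m|n,r)=S_{\upsilon,\mathcal Z}(m|n,r)\otimes_{\mathcal Z}F$, $\eta_{r,F}=\eta_r\otimes1$. $\mathtt e_i,\mathtt f_i$ denote the images of $E_i,F_i$ in $S_{q,F}(m|n,r)$, and $1_\lambda=\eta_{r,F}\big(\prod_a{K_a\brack\lambda_a}\big)$, an idempotent, for $\lambda\in\mathbb N^{m+n}$ with $\sum_i\lambda_i=r$. Let $\omega=(1^r,0^{m-r}|0^n)$, $\omega'=(0^m|0^{n-r},1^r)$. For $\chi\in\{\omega,\omega'\}$, the Schur functor $\mathfrak f_\chi$ sends an $S_{q,F}(m|n,r)$-supermodule $V$ to the $1_\chi S_{q,F}(m|n,r)1_\chi$-module $1_\chi V$. For $1\le i\le r-1$ put $t_i=q1_\omega\mathtt e_i\mathtt f_i1_\omega-1_\omega$ and $t_{m+n-r+i}=q1_{\omega'}\mathtt e_{m+n-r+i}\mathtt f_{m+n-r+i}1_{\omega'}-1_{\omega'}$. $H_{q^2,F}(r)$ is the $F$-algebra with generators $T_1,\dots,T_{r-1}$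 and relations $T_iT_j=T_jT_i$ ($|i-j|>1$), $T_iT_jT_i=T_jT_iT_j$ ($|i-j|=1$), $T_i^2=(q^2-1)T_i+q^2$. It is identified with $1_\omega S_{q,F}(m|n,r)1_\omega$ via $T_i\leftrightarrow t_i$. The map $\tau:1_\omega S_{q,F}(m|n,r)1_\omega\to1_{\omega'}S_{q,F}(m|n,r)1_{\omega'}$, $t_i\mapsto t_{m+n-r+i}$, is an algebra isomorphism; for a $1_{\omega'}S_{q,F}(m|n,r)1_{\omega'}$-module $W$, $W^\tau$ is the $H_{q^2,F}(r)$-module $W$ with action $h\cdot w=\tau(h)w$. $(-)^\sharp$ is the automorphism $T_i\mapsto(q^2-1)-T_i$ of $H_{q^2,F}(r)$, and for an $H_{q^2,F}(r)$-module $W$, $W^\sharp$ is $W$ with action $h\cdot w=h^\sharp w$. Supermodules are finite dimensional. *)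

theory Defs
  imports
    "HOL-Library.Poly_Mapping"
    "HOL-Computational_Algebra.Polynomial"
    "HOL-Computational_Algebra.Fraction_Field"
    "HOL-Algebra.QuotRing"
    "HOL-Algebra.Module"
begin

section \<open>Associative algebras\<close>

text \<open>An associative (not necessarily commutative) algebra over a field, or commutative ring, given
  by a type \<open>'k\<close> is a record of type \<open>('k, 'a) module\<close> from HOL-Algebra: a ring with scalar
  multiplication.\<close>

definition conv :: "('w \<Rightarrow> 'w \<Rightarrow> 'w) \<Rightarrow> ('w \<Rightarrow>\<^sub>0 'k) \<Rightarrow> ('w \<Rightarrow>\<^sub>0 'k) \<Rightarrow> ('w \<Rightarrow>\<^sub>0 'k::comm_ring_1)" where
  "conv op f g = (\<Sum>x\<in>Poly_Mapping.keys f. \<Sum>y\<in>Poly_Mapping.keys g.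
      Poly_Mapping.single (op x y) (Poly_Mapping.lookup f x * Poly_Mapping.lookup g y))"

definition monoid_alg :: "('w, 'x) monoid_scheme \<Rightarrow> ('k::comm_ring_1, 'w \<Rightarrow>\<^sub>0 'k) module" where
  "monoid_alg M = \<lparr>carrier = {f. Poly_Mapping.keys f \<subseteq> carrier M}, mult = conv (mult M),
     one = Poly_Mapping.single \<one>\<^bsub>M\<^esub> 1, zero = 0, add = (+),
     smult = (\<lambda>c. Poly_Mapping.map (\<lambda>x. c * x))\<rparr>"

definition free_monoid :: "'g set \<Rightarrow> 'g list monoid" where
  "free_monoid G = \<lparr>carrier = lists G, mult = (@), one = []\<rparr>"

abbreviation free_alg :: "'g set \<Rightarrow> ('k::comm_ring_1, 'g list \<Rightarrow>\<^sub>0 'k) module" where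
  "free_alg G \<equiv> monoid_alg (free_monoid G)"

abbreviation free_mult :: "('g list \<Rightarrow>\<^sub>0 'k) \<Rightarrow> ('g list \<Rightarrow>\<^sub>0 'k) \<Rightarrow> ('g list \<Rightarrow>\<^sub>0 'k::comm_ring_1)"
    (infixl "\<star>" 70) where
  "f \<star> g \<equiv> conv (@) f g"

abbreviation fgen :: "'g \<Rightarrow> ('g list \<Rightarrow>\<^sub>0 'k::comm_ring_1)" where
  "fgen g \<equiv> Poly_Mapping.single [g] 1"

abbreviation fconst :: "'k \<Rightarrow> ('g list \<Rightarrow>\<^sub>0 'k::comm_ring_1)" where
  "fconst c \<equiv> Poly_Mapping.single [] c"

definition quot_alg :: "('k, 'a) module \<Rightarrow> 'a set \<Rightarrow> ('k, 'a set) module" where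
  "quot_alg A I = ring.extend (A Quot I)
     (module.fields (\<lambda>c X. \<Union>x\<in>X. I +>\<^bsub>A\<^esub> (c \<odot>\<^bsub>A\<^esub> x)))"

definition alg_hom :: "('k, 'a) module \<Rightarrow> ('k, 'b) module \<Rightarrow> ('a \<Rightarrow> 'b) set" where
  "alg_hom A B = {\<phi> \<in> ring_hom A B. \<forall>c. \<forall>x\<in>carrier A. \<phi> (c \<odot>\<^bsub>A\<^esub> x) = c \<odot>\<^bsub>B\<^esub> \<phi> x}"

definition corner :: "('k, 'a) module \<Rightarrow> 'a \<Rightarrow> ('k, 'a) module" where
  "corner A e = A\<lparr>carrier := {e \<otimes>\<^bsub>A\<^esub> a \<otimes>\<^bsub>A\<^esub> e | a. a \<in> carrier A}, one := e\<rparr>"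

definition lprod :: "('k, 'a) module \<Rightarrow> 'a list \<Rightarrow> 'a" where
  "lprod A xs = foldr (mult A) xs \<one>\<^bsub>A\<^esub>"


section \<open>The ground rings\<close>

type_synonym qv = "rat poly fract"

definition vv :: qv where "vv = Fract [:0, 1:] 1"

text \<open>Elements of $\mathcal Z = \mathbb Z[\upsilon,\upsilon^{-1}]$ are written $p(\upsilon)\upsilon^{-k}$
  with $p$ an integer polynomial; \<open>laurent x p k\<close> is the value of this element at
  $\upsilon = x$.\<close>

definition laurent :: "'k::field \<Rightarrow> int poly \<Rightarrow> nat \<Rightarrow> 'k" where
  "laurent x p k = poly (map_poly of_int p) x / x ^ k"

inductive_set zsubalg :: "(qv, 'a) module \<Rightarrow> 'a set \<Rightarrow> 'a set" for A G where
  gen: "x \<in> G \<Longrightarrow> x \<in> zsubalg A G"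
| one: "\<one>\<^bsub>A\<^esub> \<in> zsubalg A G"
| add: "x \<in> zsubalg A G \<Longrightarrow> y \<in> zsubalg A G \<Longrightarrow> x \<oplus>\<^bsub>A\<^esub> y \<in> zsubalg A G"
| mult: "x \<in> zsubalg A G \<Longrightarrow> y \<in> zsubalg A G \<Longrightarrow> x \<otimes>\<^bsub>A\<^esub> y \<in> zsubalg A G"
| scal: "x \<in> zsubalg A G \<Longrightarrow> laurent vv p k \<odot>\<^bsub>A\<^esub> x \<in> zsubalg A G"

text \<open>For a $\mathcal Z$-algebra $B$ (a $\mathcal Z$-subalgebra of a $\mathbb Q(\upsilon)$-algebra) the
  tensor product $B \otimes_{\mathcal Z} F$ along $\upsilon \mapsto q$ is the free abelian group on
  pairs $(b,c) \in B \times F$, with $(b,c)(b',c') = (bb',cc')$, modulo the bilinearity and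
  $\mathcal Z$-balancing relations.\<close>

definition mult_monoid :: "'f::field monoid" where
  "mult_monoid = \<lparr>carrier = UNIV, mult = (*), one = 1\<rparr>"

definition pair_ring :: "(qv, 'b) module \<Rightarrow> (int, ('b \<times> 'f::field) \<Rightarrow>\<^sub>0 int) module" where
  "pair_ring B = monoid_alg (B \<times>\<times> mult_monoid)"

inductive_set tensor_rels :: "'f::field \<Rightarrow> (qv, 'b) module \<Rightarrow> (('b \<times> 'f) \<Rightarrow>\<^sub>0 int) set"
  for q B where
  add_l: "b \<in> carrier B \<Longrightarrow> b' \<in> carrier B \<Longrightarrow>
    Poly_Mapping.single (b \<oplus>\<^bsub>B\<^esub> b', c) 1 - Poly_Mapping.single (b, c) 1 - Poly_Mapping.single (b', c) 1
      \<in> tensor_rels q B"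
| add_r: "b \<in> carrier B \<Longrightarrow>
    Poly_Mapping.single (b, c + c') 1 - Poly_Mapping.single (b, c) 1 - Poly_Mapping.single (b, c') 1
      \<in> tensor_rels q B"
| balance: "b \<in> carrier B \<Longrightarrow>
    Poly_Mapping.single (laurent vv p k \<odot>\<^bsub>B\<^esub> b, c) 1 - Poly_Mapping.single (b, laurent q p k * c) 1
      \<in> tensor_rels q B"

definition tensor_ideal :: "'f::field \<Rightarrow> (qv, 'b) module \<Rightarrow> (('b \<times> 'f) \<Rightarrow>\<^sub>0 int) set" where
  "tensor_ideal q B = genideal (pair_ring B) (tensor_rels q B)"

definition tens :: "'f::field \<Rightarrow> (qv, 'b) module \<Rightarrow> 'b \<Rightarrow> 'f \<Rightarrow> (('b \<times> 'f) \<Rightarrow>\<^sub>0 int) set" where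
  "tens q B b c = tensor_ideal q B +>\<^bsub>pair_ring B\<^esub> Poly_Mapping.single (b, c) 1"

definition base_change :: "'f::field \<Rightarrow> (qv, 'b) module \<Rightarrow> ('f, (('b \<times> 'f) \<Rightarrow>\<^sub>0 int) set) module" where
  "base_change q B = (let Q = pair_ring B Quot tensor_ideal q B in
     ring.extend Q (module.fields (\<lambda>c X. tens q B \<one>\<^bsub>B\<^esub> c \<otimes>\<^bsub>Q\<^esub> X)))"

text \<open>The image of $P \otimes_{\mathcal Z} F$ in $B \otimes_{\mathcal Z} F$.\<close>

definition base_change_part ::
    "'f::field \<Rightarrow> (qv, 'b) module \<Rightarrow> 'b set \<Rightarrow> (('b \<times> 'f) \<Rightarrow>\<^sub>0 int) set set" where
  "base_change_part q B P =
     {tensor_ideal q B +>\<^bsub>pair_ring B\<^esub> f | f. Poly_Mapping.keys f \<subseteq> P \<times> UNIV}"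


section \<open>The quantum general linear superalgebra\<close>

datatype qgen = Eg nat | Fg nat | Kg nat | Kinvg nat

definition qgens :: "nat \<Rightarrow> nat \<Rightarrow> qgen set" where
  "qgens m n = Eg ` {1..<m+n} \<union> Fg ` {1..<m+n} \<union> Kg ` {1..m+n} \<union> Kinvg ` {1..m+n}"

type_synonym qfree = "qgen list \<Rightarrow>\<^sub>0 qv"

abbreviation fE :: "nat \<Rightarrow> qfree" where "fE a \<equiv> fgen (Eg a)"
abbreviation fF :: "nat \<Rightarrow> qfree" where "fF a \<equiv> fgen (Fg a)"
abbreviation fK :: "nat \<Rightarrow> qfree" where "fK a \<equiv> fgen (Kg a)"
abbreviation fKinv :: "nat \<Rightarrow> qfree" where "fKinv a \<equiv> fgen (Kinvg a)"

definition sg :: "nat \<Rightarrow> nat \<Rightarrow> int" where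
  "sg m a = (if a \<le> m then 1 else -1)"

definition vsub :: "nat \<Rightarrow> nat \<Rightarrow> qv" where
  "vsub m a = vv powi sg m a"

definition eps_form :: "nat \<Rightarrow> nat \<Rightarrow> nat \<Rightarrow> int" where
  "eps_form m a b = (if a = b then sg m a else 0)"

text \<open>$(\epsilon_a, \alpha_b)$\<close>
definition eps_alpha :: "nat \<Rightarrow> nat \<Rightarrow> nat \<Rightarrow> int" where
  "eps_alpha m a b = eps_form m a b - eps_form m a (b + 1)"

text \<open>The superbracket $[X,Y]$ of homogeneous elements; the flags say whether \<open>X\<close>, \<open>Y\<close> are odd.\<close>
definition sbracket :: "bool \<Rightarrow> bool \<Rightarrow> qfree \<Rightarrow> qfree \<Rightarrow> qfree" where
  "sbracket p p' X Y = (if p \<and> p' then X \<star> Y + Y \<star> X else X \<star> Y - Y \<star> X)"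

text \<open>$E_{m-1,m+2}$ and $E_{m+2,m-1}$\<close>
definition Eodd :: "nat \<Rightarrow> qfree" where
  "Eodd m = fE (m-1) \<star> fE m \<star> fE (m+1)
     - fconst vv \<star> fE (m-1) \<star> fE (m+1) \<star> fE m
     - fconst (inverse vv) \<star> fE m \<star> fE (m+1) \<star> fE (m-1)
     + fE (m+1) \<star> fE m \<star> fE (m-1)"

definition Fodd :: "nat \<Rightarrow> qfree" where
  "Fodd m = fF (m+1) \<star> fF m \<star> fF (m-1)
     - fconst (inverse vv) \<star> fF m \<star> fF (m+1) \<star> fF (m-1)
     - fconst vv \<star> fF (m-1) \<star> fF (m+1) \<star> fF m
     + fF (m-1) \<star> fF m \<star> fF (m+1)"

text \<open>Each element is (left-hand side) \<open>-\<close> (right-hand side) of a defining relation.\<close>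
inductive_set qrels :: "nat \<Rightarrow> nat \<Rightarrow> qfree set" for m n where
  KK: "a \<in> {1..m+n} \<Longrightarrow> b \<in> {1..m+n} \<Longrightarrow> fK a \<star> fK b - fK b \<star> fK a \<in> qrels m n"
| KKinv: "a \<in> {1..m+n} \<Longrightarrow> fK a \<star> fKinv a - fconst 1 \<in> qrels m n"
| KinvK: "a \<in> {1..m+n} \<Longrightarrow> fKinv a \<star> fK a - fconst 1 \<in> qrels m n"
| KE: "a \<in> {1..m+n} \<Longrightarrow> b \<in> {1..<m+n} \<Longrightarrow>
    fK a \<star> fE b - fconst (vv powi eps_alpha m a b) \<star> fE b \<star> fK a \<in> qrels m n"
| KF: "a \<in> {1..m+n} \<Longrightarrow> b \<in> {1..<m+n} \<Longrightarrow>
    fK a \<star> fF b - fconst (vv powi (- eps_alpha m a b)) \<star> fF b \<star> fK a \<in> qrels m n"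
| EF: "a \<in> {1..<m+n} \<Longrightarrow> b \<in> {1..<m+n} \<Longrightarrow>
    sbracket (a = m) (b = m) (fE a) (fF b)
      - (if a = b
         then fconst (1 / (vsub m a - inverse (vsub m a)))
                \<star> (fK a \<star> fKinv (a+1) - fKinv a \<star> fK (a+1))
         else 0) \<in> qrels m n"
| EE: "a \<in> {1..<m+n} \<Longrightarrow> b \<in> {1..<m+n} \<Longrightarrow> \<bar>int a - int b\<bar> > 1 \<Longrightarrow>
    fE a \<star> fE b - fE b \<star> fE a \<in> qrels m n"
| FF: "a \<in> {1..<m+n} \<Longrightarrow> b \<in> {1..<m+n} \<Longrightarrow> \<bar>int a - int b\<bar> > 1 \<Longrightarrow>
    fF a \<star> fF b - fF b \<star> fF a \<in> qrels m n"
| SerreE: "a \<in> {1..<m+n} \<Longrightarrow> b \<in> {1..<m+n} \<Longrightarrow> a \<noteq> m \<Longrightarrow> \<bar>int a - int b\<bar> = 1 \<Longrightarrow>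
    fE a \<star> fE a \<star> fE b - fconst (vsub m a + inverse (vsub m a)) \<star> fE a \<star> fE b \<star> fE a
      + fE b \<star> fE a \<star> fE a \<in> qrels m n"
| SerreF: "a \<in> {1..<m+n} \<Longrightarrow> b \<in> {1..<m+n} \<Longrightarrow> a \<noteq> m \<Longrightarrow> \<bar>int a - int b\<bar> = 1 \<Longrightarrow>
    fF a \<star> fF a \<star> fF b - fconst (vsub m a + inverse (vsub m a)) \<star> fF a \<star> fF b \<star> fF a
      + fF b \<star> fF a \<star> fF a \<in> qrels m n"
| Em2: "m \<in> {1..<m+n} \<Longrightarrow> fE m \<star> fE m \<in> qrels m n"
| Fm2: "m \<in> {1..<m+n} \<Longrightarrow> fF m \<star> fF m \<in> qrels m n"
| superE: "2 \<le> m \<Longrightarrow> 2 \<le> n \<Longrightarrow> sbracket True True (fE m) (Eodd m) \<in> qrels m n"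
| superF: "2 \<le> m \<Longrightarrow> 2 \<le> n \<Longrightarrow> sbracket True True (fF m) (Fodd m) \<in> qrels m n"

type_synonym uel = "qfree set"

definition Uideal :: "nat \<Rightarrow> nat \<Rightarrow> qfree set" where
  "Uideal m n = genideal (free_alg (qgens m n)) (qrels m n)"

definition Ualg :: "nat \<Rightarrow> nat \<Rightarrow> (qv, uel) module" where
  "Ualg m n = quot_alg (free_alg (qgens m n)) (Uideal m n)"

definition ucls :: "nat \<Rightarrow> nat \<Rightarrow> qfree \<Rightarrow> uel" where
  "ucls m n f = Uideal m n +>\<^bsub>(free_alg (qgens m n) :: (qv, qfree) module)\<^esub> f"

abbreviation uE :: "nat \<Rightarrow> nat \<Rightarrow> nat \<Rightarrow> uel" where "uE m n a \<equiv> ucls m n (fE a)"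
abbreviation uF :: "nat \<Rightarrow> nat \<Rightarrow> nat \<Rightarrow> uel" where "uF m n a \<equiv> ucls m n (fF a)"
abbreviation uK :: "nat \<Rightarrow> nat \<Rightarrow> nat \<Rightarrow> uel" where "uK m n a \<equiv> ucls m n (fK a)"
abbreviation uKinv :: "nat \<Rightarrow> nat \<Rightarrow> nat \<Rightarrow> uel" where "uKinv m n a \<equiv> ucls m n (fKinv a)"

text \<open>Homogeneous components: \<open>True\<close> is the odd part, \<open>False\<close> the even part.\<close>

definition odd_word :: "nat \<Rightarrow> qgen list \<Rightarrow> bool" where
  "odd_word m w \<longleftrightarrow> odd (length (filter (\<lambda>g. g = Eg m \<or> g = Fg m) w))"

definition Upart :: "nat \<Rightarrow> nat \<Rightarrow> bool \<Rightarrow> uel set" where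
  "Upart m n p = {ucls m n f | f.
     Poly_Mapping.keys f \<subseteq> {w \<in> lists (qgens m n). odd_word m w = p}}"

definition qfact :: "nat \<Rightarrow> qv" where
  "qfact M = (\<Prod>i=1..M. (vv ^ i - inverse vv ^ i) / (vv - inverse vv))"

definition divpow :: "(qv, 'a) module \<Rightarrow> 'a \<Rightarrow> nat \<Rightarrow> 'a" where
  "divpow A x M = inverse (qfact M) \<odot>\<^bsub>A\<^esub> (x [^]\<^bsub>A\<^esub> M)"

definition Kbinom :: "nat \<Rightarrow> nat \<Rightarrow> nat \<Rightarrow> nat \<Rightarrow> uel" where
  "Kbinom m n i t = (let U = Ualg m n; v = vsub m i in
     lprod U (map (\<lambda>s. (1 / (v ^ s - inverse v ^ s)) \<odot>\<^bsub>U\<^esub>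
         ((v powi (1 - int s)) \<odot>\<^bsub>U\<^esub> uK m n i
           \<ominus>\<^bsub>U\<^esub> (v powi (int s - 1)) \<odot>\<^bsub>U\<^esub> uKinv m n i)) [1..<t+1]))"

definition UZ :: "nat \<Rightarrow> nat \<Rightarrow> uel set" where
  "UZ m n = zsubalg (Ualg m n)
     ({divpow (Ualg m n) (uE m n i) M | i M. i \<in> {1..<m+n}}
      \<union> {divpow (Ualg m n) (uF m n i) M | i M. i \<in> {1..<m+n}}
      \<union> uK m n ` {1..m+n} \<union> uKinv m n ` {1..m+n}
      \<union> {Kbinom m n j t | j t. j \<in> {1..m+n}})"


section \<open>The q-Schur superalgebra\<close>

inductive_set Srels :: "nat \<Rightarrow> nat \<Rightarrow> nat \<Rightarrow> uel set" for m n r where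
  total: "lprod (Ualg m n) (map (uK m n) [1..<m+1] @ map (uKinv m n) [m+1..<m+n+1])
      \<ominus>\<^bsub>Ualg m n\<^esub> (vv ^ r) \<odot>\<^bsub>Ualg m n\<^esub> \<one>\<^bsub>Ualg m n\<^esub> \<in> Srels m n r"
| each: "a \<in> {1..m+n} \<Longrightarrow>
    lprod (Ualg m n) (map (\<lambda>s. uK m n a \<ominus>\<^bsub>Ualg m n\<^esub> (vsub m a ^ s) \<odot>\<^bsub>Ualg m n\<^esub> \<one>\<^bsub>Ualg m n\<^esub>) [0..<r+1])
      \<in> Srels m n r"

type_synonym sel = "uel set"
type_synonym 'f sfel = "((sel \<times> 'f) \<Rightarrow>\<^sub>0 int) set"

definition Sideal :: "nat \<Rightarrow> nat \<Rightarrow> nat \<Rightarrow> uel set" where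
  "Sideal m n r = genideal (Ualg m n) (Srels m n r)"

definition Salg :: "nat \<Rightarrow> nat \<Rightarrow> nat \<Rightarrow> (qv, sel) module" where
  "Salg m n r = quot_alg (Ualg m n) (Sideal m n r)"

definition eta :: "nat \<Rightarrow> nat \<Rightarrow> nat \<Rightarrow> uel \<Rightarrow> sel" where
  "eta m n r x = Sideal m n r +>\<^bsub>Ualg m n\<^esub> x"

definition SZ :: "nat \<Rightarrow> nat \<Rightarrow> nat \<Rightarrow> (qv, sel) module" where
  "SZ m n r = (Salg m n r)\<lparr>carrier := eta m n r ` UZ m n\<rparr>"

definition SF :: "'f::field \<Rightarrow> nat \<Rightarrow> nat \<Rightarrow> nat \<Rightarrow> ('f, 'f sfel) module" where
  "SF q m n r = base_change q (SZ m n r)"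

definition SFpart :: "'f::field \<Rightarrow> nat \<Rightarrow> nat \<Rightarrow> nat \<Rightarrow> bool \<Rightarrow> 'f sfel set" where
  "SFpart q m n r p = base_change_part q (SZ m n r)
     (carrier (SZ m n r) \<inter> eta m n r ` Upart m n p)"

text \<open>The value of $\eta_{r,F}$ at $u \otimes 1$ for $u \in U_{\upsilon,\mathcal Z}$.\<close>
definition etaF :: "'f::field \<Rightarrow> nat \<Rightarrow> nat \<Rightarrow> nat \<Rightarrow> uel \<Rightarrow> 'f sfel" where
  "etaF q m n r u = tens q (SZ m n r) (eta m n r u) 1"

definition idem :: "'f::field \<Rightarrow> nat \<Rightarrow> nat \<Rightarrow> nat \<Rightarrow> (nat \<Rightarrow> nat) \<Rightarrow> 'f sfel" where
  "idem q m n r l = etaF q m n r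
     (lprod (Ualg m n) (map (\<lambda>a. Kbinom m n a (l a)) [1..<m+n+1]))"

definition omega :: "nat \<Rightarrow> nat \<Rightarrow> nat" where
  "omega r i = (if 1 \<le> i \<and> i \<le> r then 1 else 0)"

definition omega' :: "nat \<Rightarrow> nat \<Rightarrow> nat \<Rightarrow> nat \<Rightarrow> nat" where
  "omega' m n r i = (if m + n - r < i \<and> i \<le> m + n then 1 else 0)"

text \<open>$q 1_\lambda \mathtt e_j \mathtt f_j 1_\lambda - 1_\lambda$\<close>
definition telt :: "'f::field \<Rightarrow> nat \<Rightarrow> nat \<Rightarrow> nat \<Rightarrow> (nat \<Rightarrow> nat) \<Rightarrow> nat \<Rightarrow> 'f sfel" where
  "telt q m n r l j = (let S = SF q m n r; e = idem q m n r l in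
     q \<odot>\<^bsub>S\<^esub> (e \<otimes>\<^bsub>S\<^esub> etaF q m n r (uE m n j) \<otimes>\<^bsub>S\<^esub> etaF q m n r (uF m n j) \<otimes>\<^bsub>S\<^esub> e) \<ominus>\<^bsub>S\<^esub> e)"


section \<open>The Hecke algebra\<close>

inductive_set hecke_rels :: "'f::field \<Rightarrow> nat \<Rightarrow> (nat list \<Rightarrow>\<^sub>0 'f) set" for Q r where
  comm: "i \<in> {1..<r} \<Longrightarrow> j \<in> {1..<r} \<Longrightarrow> \<bar>int i - int j\<bar> > 1 \<Longrightarrow>
    fgen i \<star> fgen j - fgen j \<star> fgen i \<in> hecke_rels Q r"
| braid: "i \<in> {1..<r} \<Longrightarrow> j \<in> {1..<r} \<Longrightarrow> \<bar>int i - int j\<bar> = 1 \<Longrightarrow>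
    fgen i \<star> fgen j \<star> fgen i - fgen j \<star> fgen i \<star> fgen j \<in> hecke_rels Q r"
| quad: "i \<in> {1..<r} \<Longrightarrow>
    fgen i \<star> fgen i - (fconst (Q - 1) \<star> fgen i + fconst Q) \<in> hecke_rels Q r"

type_synonym 'f hel = "(nat list \<Rightarrow>\<^sub>0 'f) set"

definition hecke_ideal :: "'f::field \<Rightarrow> nat \<Rightarrow> (nat list \<Rightarrow>\<^sub>0 'f) set" where
  "hecke_ideal Q r = genideal (free_alg {1..<r} :: ('f, nat list \<Rightarrow>\<^sub>0 'f) module) (hecke_rels Q r)"

definition hecke :: "'f::field \<Rightarrow> nat \<Rightarrow> ('f, 'f hel) module" where
  "hecke Q r = quot_alg (free_alg {1..<r}) (hecke_ideal Q r)"

definition heckeT :: "'f::field \<Rightarrow> nat \<Rightarrow> nat \<Rightarrow> 'f hel" where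
  "heckeT Q r i =
     hecke_ideal Q r +>\<^bsub>(free_alg {1..<r} :: ('f, nat list \<Rightarrow>\<^sub>0 'f) module)\<^esub> fgen i"

text \<open>The algebra homomorphism from the Hecke algebra to \<open>B\<close> with $T_i \mapsto$ \<open>t i\<close>.\<close>
definition hecke_hom ::
    "'f::field \<Rightarrow> nat \<Rightarrow> ('f, 'b) module \<Rightarrow> (nat \<Rightarrow> 'b) \<Rightarrow> 'f hel \<Rightarrow> 'b" where
  "hecke_hom Q r B t = (THE \<phi>. \<phi> \<in> alg_hom (hecke Q r) B
      \<and> \<phi> \<in> extensional (carrier (hecke Q r))
      \<and> (\<forall>i\<in>{1..<r}. \<phi> (heckeT Q r i) = t i))"

definition sharp :: "'f::field \<Rightarrow> nat \<Rightarrow> 'f hel \<Rightarrow> 'f hel" where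
  "sharp Q r = (let H = hecke Q r in
     hecke_hom Q r H (\<lambda>i. (Q - 1) \<odot>\<^bsub>H\<^esub> \<one>\<^bsub>H\<^esub> \<ominus>\<^bsub>H\<^esub> heckeT Q r i))"

text \<open>$T_i \mapsto t_i$, identifying the Hecke algebra with $1_\omega S_{q,F}(m|n,r) 1_\omega$.\<close>
definition hecke_omega :: "'f::field \<Rightarrow> nat \<Rightarrow> nat \<Rightarrow> nat \<Rightarrow> 'f hel \<Rightarrow> 'f sfel" where
  "hecke_omega q m n r = hecke_hom (q^2) r
     (corner (SF q m n r) (idem q m n r (omega r)))
     (\<lambda>i. telt q m n r (omega r) i)"

text \<open>$\tau$ sends $t_i$ to $t_{m+n-r+i}$; with $t_i$ identified with $T_i$ its source is the Hecke
  algebra.\<close>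
definition tau :: "'f::field \<Rightarrow> nat \<Rightarrow> nat \<Rightarrow> nat \<Rightarrow> 'f hel \<Rightarrow> 'f sfel" where
  "tau q m n r = hecke_hom (q^2) r
     (corner (SF q m n r) (idem q m n r (omega' m n r)))
     (\<lambda>i. telt q m n r (omega' m n r) (m + n - r + i))"


section \<open>Modules\<close>

text \<open>The underlying vector space of a module is a subspace \<open>mspace\<close> of the ambient vector space
  \<open>('v, scl)\<close>.\<close>

record ('f, 'a, 'v) lmod =
  mspace :: "'v set"
  scl :: "'f \<Rightarrow> 'v \<Rightarrow> 'v"
  act :: "'a \<Rightarrow> 'v \<Rightarrow> 'v"

record ('f, 'a, 'v) smod = "('f, 'a, 'v) lmod" +
  mpart :: "bool \<Rightarrow> 'v set"

definition left_module ::
    "('f::field, 'a) module \<Rightarrow> ('f, 'a, 'v::ab_group_add, 'z) lmod_scheme \<Rightarrow> bool" where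
  "left_module A M \<longleftrightarrow>
     vector_space (scl M) \<and> module.subspace (scl M) (mspace M) \<and>
     (\<forall>a\<in>carrier A. \<forall>x\<in>mspace M. act M a x \<in> mspace M) \<and>
     (\<forall>a\<in>carrier A. \<forall>x\<in>mspace M. \<forall>y\<in>mspace M. act M a (x + y) = act M a x + act M a y) \<and>
     (\<forall>a\<in>carrier A. \<forall>b\<in>carrier A. \<forall>x\<in>mspace M. act M (a \<oplus>\<^bsub>A\<^esub> b) x = act M a x + act M b x) \<and>
     (\<forall>c. \<forall>a\<in>carrier A. \<forall>x\<in>mspace M. act M (c \<odot>\<^bsub>A\<^esub> a) x = scl M c (act M a x)
                                  \<and> act M a (scl M c x) = scl M c (act M a x)) \<and>
     (\<forall>a\<in>carrier A. \<forall>b\<in>carrier A. \<forall>x\<in>mspace M. act M (a \<otimes>\<^bsub>A\<^esub> b) x = act M a (act M b x)) \<and>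
     (\<forall>x\<in>mspace M. act M \<one>\<^bsub>A\<^esub> x = x)"

text \<open>Finite dimensional supermodules over a superalgebra \<open>A\<close> with homogeneous components
  \<open>P False\<close>, \<open>P True\<close>.\<close>
definition supermodule ::
    "('f::field, 'a) module \<Rightarrow> (bool \<Rightarrow> 'a set) \<Rightarrow> ('f, 'a, 'v::ab_group_add) smod \<Rightarrow> bool" where
  "supermodule A P M \<longleftrightarrow>
     left_module A M \<and>
     (\<exists>B. finite B \<and> module.span (scl M) B = mspace M) \<and>
     (\<forall>p. module.subspace (scl M) (mpart M p)) \<and>
     mpart M False \<inter> mpart M True = {0} \<and>
     mspace M = {x + y | x y. x \<in> mpart M False \<and> y \<in> mpart M True} \<and>
     (\<forall>p p'. \<forall>a\<in>P p. \<forall>x\<in>mpart M p'. act M a x \<in> mpart M (p \<noteq> p'))"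

text \<open>$V \mapsto eV$, as a module over the corner algebra $eAe$.\<close>
definition schur_functor :: "'a \<Rightarrow> ('f, 'a, 'v, 'z) lmod_scheme \<Rightarrow> ('f, 'a, 'v) lmod" where
  "schur_functor e M = \<lparr>mspace = act M e ` mspace M, scl = scl M, act = act M\<rparr>"

definition twist :: "('h \<Rightarrow> 'a) \<Rightarrow> ('f, 'a, 'v) lmod \<Rightarrow> ('f, 'h, 'v) lmod" where
  "twist \<phi> M = \<lparr>mspace = mspace M, scl = scl M, act = (\<lambda>h. act M (\<phi> h))\<rparr>"

definition lmod_isomorphic ::
    "('f, 'a) module \<Rightarrow> ('f, 'a, 'v::ab_group_add) lmod \<Rightarrow> ('f, 'a, 'w::ab_group_add) lmod \<Rightarrow> bool" where
  "lmod_isomorphic A M N \<longleftrightarrow> (\<exists>\<phi>. bij_betw \<phi> (mspace M) (mspace N) \<and>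
     (\<forall>x\<in>mspace M. \<forall>y\<in>mspace M. \<phi> (x + y) = \<phi> x + \<phi> y) \<and>
     (\<forall>c. \<forall>x\<in>mspace M. \<phi> (scl M c x) = scl N c (\<phi> x)) \<and>
     (\<forall>a\<in>carrier A. \<forall>x\<in>mspace M. \<phi> (act M a x) = act N a (\<phi> x)))"

text \<open>The Schur functor at $\omega$, viewed as taking values in modules over the Hecke algebra.\<close>
definition schur_omega ::
    "'f::field \<Rightarrow> nat \<Rightarrow> nat \<Rightarrow> nat \<Rightarrow> ('f, 'f sfel, 'v, 'z) lmod_scheme \<Rightarrow> ('f, 'f hel, 'v) lmod" where
  "schur_omega q m n r V =
     twist (hecke_omega q m n r) (schur_functor (idem q m n r (omega r)) V)"

end

theory Submission
  imports Defs
begin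

text \<open>Write $V_\lambda = 1_\lambda V$ for the weight spaces of a module \<open>V\<close> over the
  \<open>q\<close>-Schur superalgebra. If $\lambda$ has entries $(1,0)$ at the places $a$, $a+1$, then $f_a$
  moves the entry 1 one place to the right, and it is an isomorphism
  $V_\lambda \to V_{\lambda-\alpha_a}$ with inverse $e_a$: the defining relation between $e_a$ and
  $f_a$, whether it is a commutator or (for $a = m$) an anticommutator, gives $e_a f_a = 1$ on
  $V_\lambda$ and $f_a e_a = 1$ on $V_{\lambda-\alpha_a}$ (\<open>EF_10\<close>, \<open>FE_01\<close>). The weight
  $\omega'$ arises from $\omega$ by moving the block of \<open>r\<close> ones $m+n-r$ times one place to
  the right, so a monomial in the $f_a$ maps $V_\omega$ isomorphically onto $V_{\omega'}$
  (\<open>backward_forward\<close>, \<open>forward_backward\<close>).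

  The generator $T_i$ acts on $V_\omega$ as $q e_i f_i - 1$. When the block occupies the places
  $s+1,\dots,s+r$, moving it one place to the right carries $e_a f_a$, where $a = s+i$, to
  $e_{a+1} f_{a+1}$ if $a + 1 \neq m$. If $a + 1 = m$, then $e_m f_m$ and $f_m e_m$ do not agree
  on the new weight space but add up to $q + q^{-1}$, so that $e_a f_a$ is carried to
  $q + q^{-1} - e_m f_m$ (\<open>shift_right\<close>). On the way from $\omega$ to $\omega'$ this happens
  exactly once for each $i$ (\<open>shiftF_intertwines\<close>). Since
  $q(q + q^{-1} - ef) - 1 = (q^2-1) - (q ef - 1)$, the total effect is the automorphism $\sharp$.

  The action of the Hecke algebra on both sides is given by homomorphisms that are determined by
  their values on generators, and these exist only because the corners $1_\chi S 1_\chi$ satisfy the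
  Hecke relations. The braid relation comes down to the statement that
  $A_i A_j A_i - A_i$, with $A_i = e_i f_i$, is symmetric in the neighbours $i$, $j$; for $\{i,j\} = \{a,a+1\}$ and on
  weights with ones at $a$, $a+1$, $a+2$ it is equal to $f_{a+1} e_a f_a e_{a+1}$ (\<open>cubic_rel1\<close>, \<open>cubic_rel2\<close>), by the Serre relation.

  All of this is computed over $\mathbb Q(\upsilon)$, where $[2]$ is invertible and the weight
  of a vector can be read off from the eigenvalues of the $K_a$, with elements of the integral
  form. The resulting identities between elements of the integral form are then carried over to
  \<open>F\<close> by the ring homomorphism $b \mapsto b \otimes 1$. Over $\mathbb Q(\upsilon)$ the
  polynomial relations for the $K_a$ make the algebra a sum of weight spaces
  (\<open>wt_induct\<close>), on which the Gaussian binomials that define $1_\lambda$ take the values 0 and 1,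
  so $1_\lambda$ is the projection onto the weight space of $\lambda$ (\<open>proj_in_wt\<close>,
  \<open>proj_act\<close>).\<close>

section \<open>Monoid algebras\<close>

abbreviation (input) supp :: "('w \<Rightarrow>\<^sub>0 'k::zero) \<Rightarrow> 'w set" where "supp \<equiv> Poly_Mapping.keys"
abbreviation (input) single :: "'w \<Rightarrow> 'k \<Rightarrow> ('w \<Rightarrow>\<^sub>0 'k::zero)" where "single \<equiv> Poly_Mapping.single"
abbreviation (input) lookup :: "('w \<Rightarrow>\<^sub>0 'k::zero) \<Rightarrow> 'w \<Rightarrow> 'k" where "lookup \<equiv> Poly_Mapping.lookup"

lemma conv_superset:
  assumes "finite S" "finite T" "supp f \<subseteq> S" "supp g \<subseteq> T"
  shows "conv op f g = (\<Sum>x\<in>S. \<Sum>y\<in>T.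
    single (op x y) (lookup f x * lookup g y))"
proof -
  have "(\<Sum>y\<in>T. single (op x y) (lookup f x * lookup g y))
      = (\<Sum>y\<in>supp g. single (op x y) (lookup f x * lookup g y))"
    for x
    by (rule sum.mono_neutral_right) (use assms in \<open>auto simp: in_keys_iff\<close>)
  then show ?thesis
    unfolding conv_def by (simp, intro sum.mono_neutral_left) (use assms in \<open>auto simp: in_keys_iff\<close>)
qed

lemma conv_single [simp]:
  "conv op (single x a) (single y b) = single (op x y) (a * b)"
  by (subst conv_superset[of "{x}" "{y}"]) auto

lemma conv_zero [simp]: "conv op 0 g = 0" "conv op f 0 = 0"
  by (auto simp: conv_def)

lemma conv_add_left: "conv op (f + f') g = conv op f g + conv op f' g"
proof -
  let ?S = "supp f \<union> supp f'" and ?T = "supp g"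
  have k: "supp (f + f') \<subseteq> ?S" by (rule keys_add)
  show ?thesis
    using k by (subst (1 2 3) conv_superset[of ?S ?T])
      (auto simp: lookup_add distrib_right single_add sum.distrib)
qed

lemma conv_add_right: "conv op f (g + g') = conv op f g + conv op f g'"
proof -
  let ?S = "supp f" and ?T = "supp g \<union> supp g'"
  have k: "supp (g + g') \<subseteq> ?T" by (rule keys_add)
  show ?thesis
    using k by (subst (1 2 3) conv_superset[of ?S ?T])
      (auto simp: lookup_add distrib_left single_add sum.distrib)
qed

text \<open>Induction over a finitely supported function as a sum of its monomials.\<close>

lemma pm_induct [consumes 1, case_names zero single add]:
  fixes f :: "'w \<Rightarrow>\<^sub>0 'k::ab_group_add"
  assumes "supp f \<subseteq> C" and "P 0"
    and single: "\<And>x a. x \<in> C \<Longrightarrow> P (single x a)"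
    and add: "\<And>f g. supp f \<subseteq> C \<Longrightarrow> supp g \<subseteq> C \<Longrightarrow> P f \<Longrightarrow> P g \<Longrightarrow> P (f + g)"
  shows "P f"
proof -
  have *: "P (\<Sum>x\<in>S. single x (lookup f x))
      \<and> supp (\<Sum>x\<in>S. single x (lookup f x)) \<subseteq> C"
    if "finite S" "S \<subseteq> C" for S
    using that
  proof (induction S rule: finite_induct)
    case empty
    then show ?case using \<open>P 0\<close> by simp
  next
    case (insert x S)
    then have k: "supp (single x (lookup f x)) \<subseteq> C" by simp
    show ?case
      using insert k keys_add[of "single x (lookup f x)"
          "\<Sum>x\<in>S. single x (lookup f x)"]
      by (auto intro!: add single)
  qed
  have "f = (\<Sum>x\<in>supp f. single x (lookup f x))"
    by (rule poly_mapping_eqI) (auto simp: lookup_sum lookup_single when_def in_keys_iff)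
  with *[of "supp f"] assms(1) show ?thesis by simp
qed

lemma monoid_alg_simps [simp]:
  "carrier (monoid_alg M) = {f. supp f \<subseteq> carrier M}"
  "mult (monoid_alg M) = conv (mult M)"
  "one (monoid_alg M) = single \<one>\<^bsub>M\<^esub> 1"
  "zero (monoid_alg M) = 0"
  "add (monoid_alg M) = (+)"
  "smult (monoid_alg M) c f = Poly_Mapping.map (\<lambda>x. c * x) f"
  by (simp_all add: monoid_alg_def)

lemma keys_conv:
  assumes "supp f \<subseteq> carrier M" "supp g \<subseteq> carrier M" "Group.monoid M"
  shows "supp (conv (mult M) f g) \<subseteq> carrier M"
  using assms(1)
proof (induction f rule: pm_induct)
  case (single x a)
  show ?case
    using assms(2)
  proof (induction g rule: pm_induct)
    case (single y b)
    then show ?case using \<open>x \<in> carrier M\<close> assms(3) by (simp add: monoid.m_closed)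
  next
    case (add g g')
    then show ?case
      using keys_add[of "conv (mult M) (single x a) g"
          "conv (mult M) (single x a) g'"] by (auto simp: conv_add_right)
  qed simp
next
  case (add f f')
  then show ?case
    using keys_add[of "conv (mult M) f g" "conv (mult M) f' g"] by (auto simp: conv_add_left)
qed simp

lemma conv_assoc:
  assumes "supp f \<subseteq> carrier M" "supp g \<subseteq> carrier M"
    "supp h \<subseteq> carrier M" "Group.monoid M"
  shows "conv (mult M) (conv (mult M) f g) h = conv (mult M) f (conv (mult M) g h)"
  using assms(1)
proof (induction f rule: pm_induct)
  case (single x a)
  show ?case
    using assms(2)
  proof (induction g rule: pm_induct)
    case (single y b)
    show ?case
      using assms(3)
    proof (induction h rule: pm_induct)
      case (single z c)
      then show ?case
        using \<open>x \<in> _\<close> \<open>y \<in> _\<close> assms(4) by (simp add: monoid.m_assoc mult.assoc)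
    qed (simp_all add: conv_add_right)
  qed (simp_all add: conv_add_right conv_add_left)
qed (simp_all add: conv_add_left)

lemma conv_one_left:
  assumes "supp f \<subseteq> carrier M" "Group.monoid M"
  shows "conv (mult M) (single \<one>\<^bsub>M\<^esub> 1) f = f"
  using assms(1)
  by (induction f rule: pm_induct) (use assms(2) in \<open>auto simp: monoid.l_one conv_add_right\<close>)

lemma conv_one_right:
  assumes "supp f \<subseteq> carrier M" "Group.monoid M"
  shows "conv (mult M) f (single \<one>\<^bsub>M\<^esub> 1) = f"
  using assms(1)
  by (induction f rule: pm_induct) (use assms(2) in \<open>auto simp: monoid.r_one conv_add_left\<close>)

section \<open>Associative algebras\<close>

text \<open>Associative, not necessarily commutative, unital algebras. The scalars form a commutative
  ring given by a type, so only the algebra carries a carrier set.\<close>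

locale assoc_alg = ring A for A :: "('k::comm_ring_1, 'a) module" (structure) +
  assumes smult_closed [simp, intro]: "x \<in> carrier A \<Longrightarrow> c \<odot> x \<in> carrier A"
    and smult_l_distr: "x \<in> carrier A \<Longrightarrow> (c + d) \<odot> x = c \<odot> x \<oplus> d \<odot> x"
    and smult_r_distr: "x \<in> carrier A \<Longrightarrow> y \<in> carrier A \<Longrightarrow> c \<odot> (x \<oplus> y) = c \<odot> x \<oplus> c \<odot> y"
    and smult_assoc: "x \<in> carrier A \<Longrightarrow> (c * d) \<odot> x = c \<odot> (d \<odot> x)"
    and smult_one [simp]: "x \<in> carrier A \<Longrightarrow> 1 \<odot> x = x"
    and smult_mult_l: "x \<in> carrier A \<Longrightarrow> y \<in> carrier A \<Longrightarrow> (c \<odot> x) \<otimes> y = c \<odot> (x \<otimes> y)"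
    and smult_mult_r: "x \<in> carrier A \<Longrightarrow> y \<in> carrier A \<Longrightarrow> x \<otimes> (c \<odot> y) = c \<odot> (x \<otimes> y)"
begin

lemma smult_zero_right [simp]: "c \<odot> \<zero> = \<zero>"
proof -
  have "c \<odot> \<zero> = (c \<odot> \<zero>) \<otimes> \<zero>" using smult_mult_l[of \<zero> \<zero> c] by simp
  then show ?thesis by simp
qed

lemma smult_eq_mult: "x \<in> carrier A \<Longrightarrow> c \<odot> x = (c \<odot> \<one>) \<otimes> x"
  by (simp add: smult_mult_l)

lemma smult_zero_left [simp]: "x \<in> carrier A \<Longrightarrow> 0 \<odot> x = \<zero>"
  using smult_l_distr[of x 0 0] by (metis smult_closed add.r_cancel_one' add_0)

lemma smult_minus_left: "x \<in> carrier A \<Longrightarrow> (- c) \<odot> x = \<ominus> (c \<odot> x)"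
  by (metis add.inv_equality add.left_inverse smult_closed smult_l_distr smult_zero_left)

lemma smult_minus_right: "x \<in> carrier A \<Longrightarrow> c \<odot> (\<ominus> x) = \<ominus> (c \<odot> x)"
  by (metis a_inv_closed add.inv_equality l_neg smult_closed smult_r_distr smult_zero_right)

lemma smult_l_diff: "x \<in> carrier A \<Longrightarrow> (c - d) \<odot> x = c \<odot> x \<ominus> d \<odot> x"
  using smult_l_distr[of x c "- d"] by (simp add: smult_minus_left minus_eq)

lemma smult_r_diff: "x \<in> carrier A \<Longrightarrow> y \<in> carrier A \<Longrightarrow> c \<odot> (x \<ominus> y) = c \<odot> x \<ominus> c \<odot> y"
  by (simp add: minus_eq smult_r_distr smult_minus_right)

lemma diff_zero_iff: "x \<in> carrier A \<Longrightarrow> y \<in> carrier A \<Longrightarrow> x \<ominus> y = \<zero> \<longleftrightarrow> x = y"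
  by (metis a_inv_closed add.inv_equality minus_eq minus_minus r_neg)

lemma lprod_closed: "set xs \<subseteq> carrier A \<Longrightarrow> lprod A xs \<in> carrier A"
  by (induction xs) (auto simp: lprod_def)

lemma lprod_append:
  "set xs \<subseteq> carrier A \<Longrightarrow> set ys \<subseteq> carrier A \<Longrightarrow> lprod A (xs @ ys) = lprod A xs \<otimes> lprod A ys"
proof (induction xs)
  case Nil
  then show ?case using lprod_closed[of ys] by (simp add: lprod_def)
next
  case (Cons x xs)
  then show ?case using lprod_closed[of ys] lprod_closed[of xs] by (simp add: lprod_def m_assoc)
qed

end

lemma lprod_Nil [simp]: "lprod A [] = \<one>\<^bsub>A\<^esub>"
  and lprod_Cons [simp]: "lprod A (x # xs) = x \<otimes>\<^bsub>A\<^esub> lprod A xs"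
  by (simp_all add: lprod_def)

lemma lookup_smult: "lookup (Poly_Mapping.map (\<lambda>x. c * x) f) w = c * lookup f w"
  for c :: "'k::comm_ring_1"
  by (simp add: map.rep_eq when_def)

lemma map_smult_single [simp]:
  "Poly_Mapping.map (\<lambda>x. c * x) (single w a) = single w (c * a)"
  for c :: "'k::comm_ring_1"
  by (rule poly_mapping_eqI) (simp add: lookup_smult lookup_single when_def)

lemma map_smult_zero [simp]: "Poly_Mapping.map (\<lambda>x. c * x) (0 :: 'w \<Rightarrow>\<^sub>0 'k) = 0"
  for c :: "'k::comm_ring_1"
  by (rule poly_mapping_eqI) (simp add: lookup_smult)

lemma map_smult_add:
  "Poly_Mapping.map (\<lambda>x. c * x) (f + g) = Poly_Mapping.map (\<lambda>x. c * x) f + Poly_Mapping.map (\<lambda>x. c * x) g"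
  for c :: "'k::comm_ring_1"
  by (rule poly_mapping_eqI) (simp add: lookup_smult lookup_add distrib_left)

lemma conv_smult_left:
  "conv op (Poly_Mapping.map (\<lambda>x. c * x) f) g = Poly_Mapping.map (\<lambda>x. c * x) (conv op f g)"
  for c :: "'k::comm_ring_1"
proof -
  have "supp f \<subseteq> UNIV" "supp g \<subseteq> UNIV" by auto
  then show ?thesis
  proof (induction f rule: pm_induct)
    case (single x a)
    from single(2) show ?case
      by (induction g rule: pm_induct) (auto simp: conv_add_right map_smult_add mult.assoc)
  qed (auto simp: conv_add_left map_smult_add)
qed

lemma conv_smult_right:
  "conv op f (Poly_Mapping.map (\<lambda>x. c * x) g) = Poly_Mapping.map (\<lambda>x. c * x) (conv op f g)"
  for c :: "'k::comm_ring_1"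
proof -
  have "supp f \<subseteq> UNIV" "supp g \<subseteq> UNIV" by auto
  then show ?thesis
  proof (induction f rule: pm_induct)
    case (single x a)
    from single(2) show ?case
      by (induction g rule: pm_induct) (auto simp: conv_add_right map_smult_add mult.left_commute)
  qed (auto simp: conv_add_left map_smult_add)
qed

lemma monoid_alg_assoc_alg:
  assumes "Group.monoid M"
  shows "assoc_alg (monoid_alg M :: ('k::comm_ring_1, 'w \<Rightarrow>\<^sub>0 'k) module)"
proof (intro assoc_alg.intro ringI abelian_groupI monoidI assoc_alg_axioms.intro; (simp only: monoid_alg_simps mem_Collect_eq)?)
  fix f g h :: "'w \<Rightarrow>\<^sub>0 'k" and c d :: 'k
  assume f: "supp f \<subseteq> carrier M"
  show "0 + f = f" by simp
  show "supp (Poly_Mapping.map (\<lambda>x. c * x) f) \<subseteq> carrier M"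
    using f by (force simp: in_keys_iff lookup_smult)
  show "Poly_Mapping.map (\<lambda>x. (c + d) * x) f
      = Poly_Mapping.map (\<lambda>x. c * x) f + Poly_Mapping.map (\<lambda>x. d * x) f"
    by (rule poly_mapping_eqI) (simp only: lookup_smult lookup_add, rule distrib_right)
  show "Poly_Mapping.map (\<lambda>x. c * d * x) f = Poly_Mapping.map (\<lambda>x. c * x) (Poly_Mapping.map (\<lambda>x. d * x) f)"
    by (rule poly_mapping_eqI) (simp only: lookup_smult, rule mult.assoc)
  show "Poly_Mapping.map (\<lambda>x. 1 * x) f = f"
    by (rule poly_mapping_eqI) (simp add: lookup_smult del: mult_1)
  show "conv (mult M) (single \<one>\<^bsub>M\<^esub> 1) f = f" by (rule conv_one_left[OF f assms])
  show "conv (mult M) f (single \<one>\<^bsub>M\<^esub> 1) = f" by (rule conv_one_right[OF f assms])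
  show "\<exists>y\<in>{f. supp f \<subseteq> carrier M}. y + f = 0"
    by (rule bexI[of _ "- f"]) (use f in \<open>auto simp: in_keys_iff\<close>)
  assume g: "supp g \<subseteq> carrier M"
  show "supp (f + g) \<subseteq> carrier M" using f g keys_add[of f g] by auto
  show "f + g = g + f" by simp
  show "f + g + h = f + (g + h)" by (simp add: add.assoc)
  show "supp (conv (mult M) f g) \<subseteq> carrier M" by (rule keys_conv[OF f g assms])
  show "conv (mult M) (Poly_Mapping.map (\<lambda>x. c * x) f) g = Poly_Mapping.map (\<lambda>x. c * x) (conv (mult M) f g)"
    by (rule conv_smult_left)
  show "conv (mult M) f (Poly_Mapping.map (\<lambda>x. c * x) g) = Poly_Mapping.map (\<lambda>x. c * x) (conv (mult M) f g)"
    by (rule conv_smult_right)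
  show "Poly_Mapping.map (\<lambda>x. c * x) (f + g) = Poly_Mapping.map (\<lambda>x. c * x) f + Poly_Mapping.map (\<lambda>x. c * x) g"
    by (rule map_smult_add)
  show "conv (mult M) (f + g) h = conv (mult M) f h + conv (mult M) g h" by (rule conv_add_left)
  show "conv (mult M) h (f + g) = conv (mult M) h f + conv (mult M) h g" by (rule conv_add_right)
  assume h: "supp h \<subseteq> carrier M"
  show "conv (mult M) (conv (mult M) f g) h = conv (mult M) f (conv (mult M) g h)"
    by (rule conv_assoc[OF f g h assms])
next
  show "supp (single \<one>\<^bsub>M\<^esub> (1::'k)) \<subseteq> carrier M"
    using assms by (auto simp: monoid.one_closed)
qed simp_all

lemma free_monoid_simps [simp]:
  "carrier (free_monoid G) = lists G" "mult (free_monoid G) = (@)" "one (free_monoid G) = []"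
  by (simp_all add: free_monoid_def)

lemma free_monoid_monoid: "Group.monoid (free_monoid G)"
  by (rule monoidI) (auto simp: free_monoid_def)

lemma free_alg_assoc_alg: "assoc_alg (free_alg G)"
  by (rule monoid_alg_assoc_alg[OF free_monoid_monoid])

lemma monoid_alg_minus:
  assumes "Group.monoid M" "supp g \<subseteq> carrier M"
  shows "a_minus (monoid_alg M) f g = f - (g :: 'w \<Rightarrow>\<^sub>0 'k::comm_ring_1)"
proof -
  interpret assoc_alg "monoid_alg M :: ('k, 'w \<Rightarrow>\<^sub>0 'k) module" by (rule monoid_alg_assoc_alg[OF assms(1)])
  have "a_inv (monoid_alg M) g = - g"
    by (rule add.inv_equality) (use assms in \<open>auto simp: in_keys_iff\<close>)
  then show ?thesis by (simp add: a_minus_def)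
qed

section \<open>Homomorphisms and quotients\<close>

lemma alg_homD:
  assumes "\<phi> \<in> alg_hom A B"
  shows "\<And>x. x \<in> carrier A \<Longrightarrow> \<phi> x \<in> carrier B"
    and "\<And>x y. x \<in> carrier A \<Longrightarrow> y \<in> carrier A \<Longrightarrow> \<phi> (x \<otimes>\<^bsub>A\<^esub> y) = \<phi> x \<otimes>\<^bsub>B\<^esub> \<phi> y"
    and "\<And>x y. x \<in> carrier A \<Longrightarrow> y \<in> carrier A \<Longrightarrow> \<phi> (x \<oplus>\<^bsub>A\<^esub> y) = \<phi> x \<oplus>\<^bsub>B\<^esub> \<phi> y"
    and "\<phi> \<one>\<^bsub>A\<^esub> = \<one>\<^bsub>B\<^esub>"
    and "\<And>c x. x \<in> carrier A \<Longrightarrow> \<phi> (c \<odot>\<^bsub>A\<^esub> x) = c \<odot>\<^bsub>B\<^esub> \<phi> x"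
  using assms by (auto simp: alg_hom_def ring_hom_def)

lemma alg_homI:
  assumes "\<And>x. x \<in> carrier A \<Longrightarrow> \<phi> x \<in> carrier B"
    and "\<And>x y. x \<in> carrier A \<Longrightarrow> y \<in> carrier A \<Longrightarrow> \<phi> (x \<otimes>\<^bsub>A\<^esub> y) = \<phi> x \<otimes>\<^bsub>B\<^esub> \<phi> y"
    and "\<And>x y. x \<in> carrier A \<Longrightarrow> y \<in> carrier A \<Longrightarrow> \<phi> (x \<oplus>\<^bsub>A\<^esub> y) = \<phi> x \<oplus>\<^bsub>B\<^esub> \<phi> y"
    and "\<phi> \<one>\<^bsub>A\<^esub> = \<one>\<^bsub>B\<^esub>"
    and "\<And>c x. x \<in> carrier A \<Longrightarrow> \<phi> (c \<odot>\<^bsub>A\<^esub> x) = c \<odot>\<^bsub>B\<^esub> \<phi> x"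
  shows "\<phi> \<in> alg_hom A B"
  unfolding alg_hom_def ring_hom_def using assms by blast

locale alg_homomorphism = A: assoc_alg A + B: assoc_alg B
  for A :: "('k::comm_ring_1, 'a) module" and B :: "('k, 'b) module" +
  fixes \<phi> :: "'a \<Rightarrow> 'b"
  assumes hom: "\<phi> \<in> alg_hom A B"
begin

lemmas hom_simps = alg_homD[OF hom]

lemma ring_hom: "ring_hom_ring A B \<phi>"
  using hom A.ring_axioms B.ring_axioms by (auto simp: alg_hom_def intro: ring_hom_ringI2)

sublocale rh: ring_hom_ring A B \<phi>
  by (rule ring_hom)

lemma hom_minus: "x \<in> carrier A \<Longrightarrow> y \<in> carrier A \<Longrightarrow> \<phi> (x \<ominus>\<^bsub>A\<^esub> y) = \<phi> x \<ominus>\<^bsub>B\<^esub> \<phi> y"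
  by (simp add: a_minus_def)

lemma hom_lprod: "set xs \<subseteq> carrier A \<Longrightarrow> \<phi> (lprod A xs) = lprod B (map \<phi> xs)"
proof (induction xs)
  case (Cons x xs)
  then show ?case using A.lprod_closed[of xs] by (simp add: hom_simps(2))
qed (simp add: hom_simps(4))

lemma kills_genideal:
  assumes "R \<subseteq> carrier A" "\<And>x. x \<in> R \<Longrightarrow> \<phi> x = \<zero>\<^bsub>B\<^esub>" "x \<in> genideal A R"
  shows "\<phi> x = \<zero>\<^bsub>B\<^esub>"
proof -
  have "genideal A R \<subseteq> a_kernel A B \<phi>"
    by (rule A.genideal_minimal[OF rh.kernel_is_ideal]) (use assms(1,2) in \<open>unfold a_kernel_def', blast\<close>)
  with assms(3) show ?thesis unfolding a_kernel_def' by blast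
qed

end

lemma alg_hom_comp:
  "\<phi> \<in> alg_hom A B \<Longrightarrow> \<psi> \<in> alg_hom B C \<Longrightarrow> (\<lambda>x. \<psi> (\<phi> x)) \<in> alg_hom A C"
  by (auto simp: alg_hom_def ring_hom_def Pi_def)

lemma quot_alg_simps:
  "carrier (quot_alg A I) = a_rcosets\<^bsub>A\<^esub> I"
  "mult (quot_alg A I) = rcoset_mult A I"
  "one (quot_alg A I) = I +>\<^bsub>A\<^esub> \<one>\<^bsub>A\<^esub>"
  "zero (quot_alg A I) = I"
  "add (quot_alg A I) = set_add A"
  "smult (quot_alg A I) c X = (\<Union>x\<in>X. I +>\<^bsub>A\<^esub> (c \<odot>\<^bsub>A\<^esub> x))"
  by (simp_all add: quot_alg_def ring.extend_def module.fields_def FactRing_def)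

text \<open>The ring axioms do not see the remaining fields of a record.\<close>

lemma ring_transfer:
  fixes A :: "('a, 'x) ring_scheme" and B :: "('a, 'y) ring_scheme"
  assumes "ring A" "carrier B = carrier A" "mult B = mult A" "one B = one A" "zero B = zero A"
    "add B = add A"
  shows "ring B"
proof -
  interpret A: ring A by fact
  show ?thesis
  proof (intro ringI abelian_groupI monoidI; unfold assms(2-))
    show "x \<oplus>\<^bsub>A\<^esub> y = y \<oplus>\<^bsub>A\<^esub> x" if "x \<in> carrier A" "y \<in> carrier A" for x y
      using that by (rule A.a_comm)
    show "\<exists>y\<in>carrier A. y \<oplus>\<^bsub>A\<^esub> x = \<zero>\<^bsub>A\<^esub>" if "x \<in> carrier A" for x
      using that A.l_neg by blast
  qed (simp_all add: A.m_assoc A.l_distr A.r_distr A.a_assoc)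
qed

text \<open>Two-sided ideals of an algebra. They are stable under scalars because
  $cx = (c1)x$.\<close>

locale alg_ideal = assoc_alg A + ideal I A
  for A :: "('k::comm_ring_1, 'a) module" (structure) and I
begin

abbreviation "Q \<equiv> quot_alg A I"

lemma carrier_quot: "carrier Q = {I +> x | x. x \<in> carrier A}"
  by (auto simp: quot_alg_simps A_RCOSETS_def' a_r_coset_def)

lemma cls_closed: "x \<in> carrier A \<Longrightarrow> I +> x \<in> carrier Q"
  by (auto simp: carrier_quot)

lemma cls_mult: "x \<in> carrier A \<Longrightarrow> y \<in> carrier A \<Longrightarrow> (I +> x) \<otimes>\<^bsub>Q\<^esub> (I +> y) = I +> (x \<otimes> y)"
  by (simp add: quot_alg_simps rcoset_mult_add)

lemma cls_add: "x \<in> carrier A \<Longrightarrow> y \<in> carrier A \<Longrightarrow> (I +> x) \<oplus>\<^bsub>Q\<^esub> (I +> y) = I +> (x \<oplus> y)"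
  by (simp add: quot_alg_simps a_rcos_sum)

lemma cls_smult:
  assumes x: "x \<in> carrier A"
  shows "c \<odot>\<^bsub>Q\<^esub> (I +> x) = I +> (c \<odot> x)"
proof -
  have "I +> (c \<odot> y) = I +> (c \<odot> x)" if "y \<in> I +> x" for y
  proof -
    from that obtain i where i: "i \<in> I" "y = i \<oplus> x" by (auto simp: a_r_coset_def')
    have ic: "i \<in> carrier A" using i a_subset by auto
    have "c \<odot> i \<in> I"
      using i ic by (subst smult_eq_mult) (auto intro: I_l_closed)
    then have "c \<odot> y \<in> I +> (c \<odot> x)"
      using i ic x by (auto simp: a_r_coset_def' smult_r_distr)
    then show ?thesis using x by (metis a_repr_independence' smult_closed)
  qed
  then have "(\<Union>y\<in>I +> x. I +> (c \<odot> y)) = (\<Union>y\<in>I +> x. I +> (c \<odot> x))"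
    by (rule SUP_cong[OF refl])
  also have "\<dots> = I +> (c \<odot> x)" using a_rcos_self[OF x] by blast
  finally show ?thesis by (simp only: quot_alg_simps)
qed

lemma quot_ring: "ring Q"
  by (rule ring_transfer[OF quotient_is_ring]) (simp_all add: quot_alg_simps FactRing_def)

lemma quot_assoc_alg: "assoc_alg Q"
proof (intro assoc_alg.intro quot_ring assoc_alg_axioms.intro)
qed (auto simp: carrier_quot cls_mult cls_add cls_smult smult_l_distr smult_r_distr smult_assoc
      smult_mult_l smult_mult_r)

lemma cls_hom: "(\<lambda>x. I +> x) \<in> alg_hom A Q"
  unfolding alg_hom_def ring_hom_def
  by (auto simp: cls_closed cls_mult cls_add cls_smult quot_alg_simps(3))

lemma cls_zero: "x \<in> I \<Longrightarrow> I +> x = \<zero>\<^bsub>Q\<^esub>"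
  by (simp add: quot_alg_simps a_rcos_const)

sublocale cls: alg_homomorphism A Q "\<lambda>x. I +> x"
  by (intro alg_homomorphism.intro assoc_alg_axioms quot_assoc_alg
      alg_homomorphism_axioms.intro cls_hom)

text \<open>Universal property of the quotient.\<close>

lemma factor_hom:
  assumes B: "assoc_alg B" and h: "h \<in> alg_hom A B" and k: "\<And>x. x \<in> I \<Longrightarrow> h x = \<zero>\<^bsub>B\<^esub>"
  shows "\<exists>\<phi> \<in> alg_hom Q B. \<phi> \<in> extensional (carrier Q) \<and> (\<forall>x\<in>carrier A. \<phi> (I +> x) = h x)"
proof -
  interpret B: assoc_alg B by fact
  interpret h: alg_homomorphism A B h
    by (intro alg_homomorphism.intro assoc_alg_axioms B alg_homomorphism_axioms.intro h)
  define \<phi> where "\<phi> X = (if X \<in> carrier Q then h (SOME x. x \<in> carrier A \<and> X = I +> x) else undefined)" for X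
  have *: "\<phi> (I +> x) = h x" if x: "x \<in> carrier A" for x
  proof -
    define y where "y = (SOME y. y \<in> carrier A \<and> I +> x = I +> y)"
    have y: "y \<in> carrier A \<and> I +> x = I +> y"
      unfolding y_def by (rule someI[of _ x]) (use x in auto)
    then have "y \<in> I +> x" using a_rcos_self by auto
    then obtain i where i: "i \<in> I" "y = i \<oplus> x" by (auto simp: a_r_coset_def')
    have ic: "i \<in> carrier A" using i(1) a_subset by blast
    have "h y = h x" unfolding i(2) h.hom_simps(3)[OF ic x] k[OF i(1)]
      using x by simp
    moreover have "\<phi> (I +> x) = h y" using x by (simp add: \<phi>_def y_def cls_closed)
    ultimately show ?thesis by simp
  qed
  have "\<phi> \<in> alg_hom Q B"
  proof (rule alg_homI)
    fix X Y c assume X: "X \<in> carrier Q"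
    then obtain x where x: "x \<in> carrier A" "X = I +> x" unfolding carrier_quot by blast
    show "\<phi> X \<in> carrier B" using x h.hom_simps(1) by (simp add: *)
    show "\<phi> (c \<odot>\<^bsub>Q\<^esub> X) = c \<odot>\<^bsub>B\<^esub> \<phi> X"
      unfolding x(2) cls_smult[OF x(1)] *[OF x(1)] *[OF smult_closed[OF x(1)]] by (rule h.hom_simps(5)[OF x(1)])
    assume Y: "Y \<in> carrier Q"
    then obtain y where y: "y \<in> carrier A" "Y = I +> y" unfolding carrier_quot by blast
    show "\<phi> (X \<otimes>\<^bsub>Q\<^esub> Y) = \<phi> X \<otimes>\<^bsub>B\<^esub> \<phi> Y"
      unfolding x(2) y(2) cls_mult[OF x(1) y(1)] *[OF x(1)] *[OF y(1)] *[OF m_closed[OF x(1) y(1)]]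
      by (rule h.hom_simps(2)[OF x(1) y(1)])
    show "\<phi> (X \<oplus>\<^bsub>Q\<^esub> Y) = \<phi> X \<oplus>\<^bsub>B\<^esub> \<phi> Y"
      unfolding x(2) y(2) cls_add[OF x(1) y(1)] *[OF x(1)] *[OF y(1)] *[OF add.m_closed[OF x(1) y(1)]]
      by (rule h.hom_simps(3)[OF x(1) y(1)])
  next
    show "\<phi> \<one>\<^bsub>Q\<^esub> = \<one>\<^bsub>B\<^esub>"
      unfolding quot_alg_simps(3) *[OF one_closed] by (rule h.hom_simps(4))
  qed
  moreover have "\<phi> \<in> extensional (carrier Q)" by (simp add: \<phi>_def extensional_def)
  ultimately show ?thesis using * by blast
qed

end

lemma alg_idealI:
  assumes "assoc_alg A" "R \<subseteq> carrier A"
  shows "alg_ideal A (genideal A R)"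
proof -
  interpret assoc_alg A by fact
  show ?thesis by (intro alg_ideal.intro assms(1) genideal_ideal assms(2))
qed

lemma keys_smult: "supp (Poly_Mapping.map (\<lambda>x. c * x) f) \<subseteq> supp f"
  for c :: "'k::comm_ring_1"
proof
  fix w assume "w \<in> supp (Poly_Mapping.map (\<lambda>x. c * x) f)"
  then have "c * lookup f w \<noteq> 0" by (simp add: in_keys_iff lookup_smult)
  then have "lookup f w \<noteq> 0" by auto
  then show "w \<in> supp f" by (simp add: in_keys_iff)
qed

lemma keys_free_mult:
  "supp f \<subseteq> lists G \<Longrightarrow> supp g \<subseteq> lists G \<Longrightarrow> supp (f \<star> g) \<subseteq> lists G"
  using keys_conv[OF _ _ free_monoid_monoid, of f G g] by simp

section \<open>The universal property of free algebras\<close>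

text \<open>The value at \<open>t\<close> of a noncommutative polynomial.\<close>

definition alg_eval :: "('k, 'b) module \<Rightarrow> ('g \<Rightarrow> 'b) \<Rightarrow> ('g list \<Rightarrow>\<^sub>0 'k::comm_ring_1) \<Rightarrow> 'b" where
  "alg_eval B t f = finsum B (\<lambda>w. lookup f w \<odot>\<^bsub>B\<^esub> lprod B (map t w)) (supp f)"

context assoc_alg
begin

lemma eval_lprod_closed: "t \<in> G \<rightarrow> carrier A \<Longrightarrow> w \<in> lists G \<Longrightarrow> lprod A (map t w) \<in> carrier A"
  by (rule lprod_closed) auto

lemma eval_superset:
  assumes "t \<in> G \<rightarrow> carrier A" "finite S" "supp f \<subseteq> S" "S \<subseteq> lists G"
  shows "alg_eval A t f = finsum A (\<lambda>w. lookup f w \<odot> lprod A (map t w)) S"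
  unfolding alg_eval_def
proof (rule add.finprod_mono_neutral_cong_left)
  fix w assume "w \<in> S - supp f"
  then show "lookup f w \<odot> lprod A (map t w) = \<zero>"
    using assms eval_lprod_closed[OF assms(1)] by (simp add: in_keys_iff subset_iff)
next
  show "(\<lambda>w. lookup f w \<odot> lprod A (map t w)) \<in> S \<rightarrow> carrier A"
    using assms(4) eval_lprod_closed[OF assms(1)] by (blast intro: smult_closed)
qed (use assms in auto)

lemma eval_add:
  assumes t: "t \<in> G \<rightarrow> carrier A" and f: "supp f \<subseteq> lists G" and g: "supp g \<subseteq> lists G"
  shows "alg_eval A t (f + g) = alg_eval A t f \<oplus> alg_eval A t g"
proof -
  let ?S = "supp f \<union> supp g"
  have S: "finite ?S" "?S \<subseteq> lists G" using f g by auto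
  have c: "lprod A (map t w) \<in> carrier A" if "w \<in> ?S" for w
    using that S(2) eval_lprod_closed[OF t] by blast
  have "alg_eval A t (f + g) = finsum A (\<lambda>w. lookup (f + g) w \<odot> lprod A (map t w)) ?S"
    by (rule eval_superset[OF t S(1) keys_add S(2)])
  also have "\<dots> = finsum A (\<lambda>w. lookup f w \<odot> lprod A (map t w)
      \<oplus> lookup g w \<odot> lprod A (map t w)) ?S"
    by (rule finsum_cong') (auto simp: c lookup_add smult_l_distr)
  also have "\<dots> = finsum A (\<lambda>w. lookup f w \<odot> lprod A (map t w)) ?S
      \<oplus> finsum A (\<lambda>w. lookup g w \<odot> lprod A (map t w)) ?S"
    by (rule finsum_addf) (auto simp: c)
  also have "\<dots> = alg_eval A t f \<oplus> alg_eval A t g"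
    using eval_superset[OF t S(1) _ S(2)] by simp
  finally show ?thesis .
qed

lemma eval_single:
  assumes t: "t \<in> G \<rightarrow> carrier A" and w: "w \<in> lists G"
  shows "alg_eval A t (single w c) = c \<odot> lprod A (map t w)"
proof -
  have "alg_eval A t (single w c)
      = finsum A (\<lambda>u. lookup (single w c) u \<odot> lprod A (map t u)) {w}"
    by (rule eval_superset[OF t]) (use w in auto)
  also have "\<dots> = c \<odot> lprod A (map t w)"
    using eval_lprod_closed[OF t w] by (simp add: finsum_insert)
  finally show ?thesis .
qed

lemma eval_zero: "alg_eval A t 0 = \<zero>"
  by (simp add: alg_eval_def finsum_empty)

lemma eval_closed:
  assumes t: "t \<in> G \<rightarrow> carrier A" and f: "supp f \<subseteq> lists G"
  shows "alg_eval A t f \<in> carrier A"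
  using f by (induction f rule: pm_induct)
    (simp_all add: eval_zero eval_single[OF t] eval_lprod_closed[OF t] eval_add[OF t])

lemma eval_hom:
  assumes t: "t \<in> G \<rightarrow> carrier A"
  shows "alg_eval A t \<in> alg_hom (free_alg G) A"
proof -
  have mult: "alg_eval A t (f \<star> g) = alg_eval A t f \<otimes> alg_eval A t g"
    if f: "supp f \<subseteq> lists G" and g: "supp g \<subseteq> lists G" for f g
    using f
  proof (induction f rule: pm_induct)
    case (single u a)
    show ?case
      using g
    proof (induction g rule: pm_induct)
      case zero
      then show ?case using single by (simp add: eval_zero eval_single[OF t] eval_lprod_closed[OF t])
    next
      case (single w b)
      have "set (map t u) \<subseteq> carrier A" "set (map t w) \<subseteq> carrier A"
        using \<open>u \<in> _\<close> single t by auto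
      then have "lprod A (map t (u @ w)) = lprod A (map t u) \<otimes> lprod A (map t w)"
        by (simp add: lprod_append)
      moreover have "u @ w \<in> lists G" using \<open>u \<in> _\<close> single by auto
      ultimately show ?case
        using \<open>u \<in> _\<close> single
        by (simp add: eval_single[OF t] eval_lprod_closed[OF t] smult_mult_l smult_mult_r mult.commute
            flip: smult_assoc)
    next
      case (add g g')
      have "supp (single u a \<star> h) \<subseteq> lists G"
        if "supp h \<subseteq> lists G" for h
        using single that by (intro keys_free_mult) auto
      then show ?case
        using add single
        by (simp add: conv_add_right eval_add[OF t] eval_closed[OF t] r_distr)
    qed
  next
    case zero
    then show ?case using g by (simp add: eval_zero eval_closed[OF t])
  next
    case (add f f')
    have "supp (h \<star> g) \<subseteq> lists G" if "supp h \<subseteq> lists G" for h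
      using that g by (rule keys_free_mult)
    then show ?case
      using add g by (simp add: conv_add_left eval_add[OF t] eval_closed[OF t] l_distr)
  qed
  have smult: "alg_eval A t (Poly_Mapping.map (\<lambda>x. c * x) f) = c \<odot> alg_eval A t f"
    if f: "supp f \<subseteq> lists G" for c f
    using f
  proof (induction f rule: pm_induct)
    case (add f g)
    have "supp (Poly_Mapping.map (\<lambda>x. c * x) h) \<subseteq> lists G" 
      if "supp h \<subseteq> lists G" for h
      using that keys_smult[of c h] by (rule order_trans[rotated])
    then show ?case
      using add by (simp add: map_smult_add eval_add[OF t] eval_closed[OF t] smult_r_distr)
  qed (simp_all add: eval_zero eval_single[OF t] eval_lprod_closed[OF t] smult_assoc)
  have one: "alg_eval A t (single [] 1) = \<one>"
    by (subst eval_single[OF t]) auto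
  show ?thesis
    by (rule alg_homI) (simp_all add: mult smult one eval_add[OF t] eval_closed[OF t])
qed

lemma eval_gen:
  assumes t: "t \<in> G \<rightarrow> carrier A" and "g \<in> G"
  shows "alg_eval A t (fgen g) = t g"
proof -
  have "t g \<in> carrier A" using assms by auto
  then show ?thesis
    using assms by (subst eval_single[OF t]) auto
qed

end

lemma free_alg_induct:
  assumes "f \<in> carrier (free_alg G)" and "P (fconst 1)" and "\<And>g. g \<in> G \<Longrightarrow> P (fgen g)"
    and mult: "\<And>x y. x \<in> carrier (free_alg G) \<Longrightarrow> y \<in> carrier (free_alg G) \<Longrightarrow> P x \<Longrightarrow> P y \<Longrightarrow> P (x \<star> y)"
    and add: "\<And>x y. x \<in> carrier (free_alg G) \<Longrightarrow> y \<in> carrier (free_alg G) \<Longrightarrow> P x \<Longrightarrow> P y \<Longrightarrow> P (x + y)"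
    and smult: "\<And>c x. x \<in> carrier (free_alg G) \<Longrightarrow> P x \<Longrightarrow> P (c \<odot>\<^bsub>free_alg G\<^esub> x)"
  shows "P (f :: 'g list \<Rightarrow>\<^sub>0 'k::comm_ring_1)"
proof -
  have w: "P (single w 1)" if "w \<in> lists G" for w
    using that
  proof (induction w)
    case (Cons g w)
    then have "P (fgen g \<star> single w 1)" using assms(3) by (intro mult) auto
    then show ?case by simp
  qed (use assms(2) in simp)
  from assms(1) have "supp f \<subseteq> lists G" by simp
  then show ?thesis
  proof (induction f rule: pm_induct)
    case zero
    show ?case using smult[of "fconst 1" 0] assms(2) by simp
  next
    case (single x a)
    show ?case using smult[of "single x 1" a] w[OF single] single by auto
  next
    case (add f g)
    then show ?case using assms(5)[of f g] by simp
  qed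
qed

section \<open>The Hecke algebra\<close>

text \<open>The family \<open>t\<close> of elements of \<open>B\<close> satisfies the defining relations of the Hecke algebra
  with parameter \<open>Q\<close>.\<close>

definition hecke_system :: "('f::comm_ring_1, 'b) module \<Rightarrow> 'f \<Rightarrow> nat \<Rightarrow> (nat \<Rightarrow> 'b) \<Rightarrow> bool" where
  "hecke_system B Q r t \<longleftrightarrow>
     t \<in> {1..<r} \<rightarrow> carrier B \<and>
     (\<forall>i\<in>{1..<r}. \<forall>j\<in>{1..<r}. \<bar>int i - int j\<bar> > 1 \<longrightarrow> t i \<otimes>\<^bsub>B\<^esub> t j = t j \<otimes>\<^bsub>B\<^esub> t i) \<and>
     (\<forall>i\<in>{1..<r}. \<forall>j\<in>{1..<r}. \<bar>int i - int j\<bar> = 1 \<longrightarrow>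
        t i \<otimes>\<^bsub>B\<^esub> t j \<otimes>\<^bsub>B\<^esub> t i = t j \<otimes>\<^bsub>B\<^esub> t i \<otimes>\<^bsub>B\<^esub> t j) \<and>
     (\<forall>i\<in>{1..<r}. t i \<otimes>\<^bsub>B\<^esub> t i = (Q - 1) \<odot>\<^bsub>B\<^esub> t i \<oplus>\<^bsub>B\<^esub> Q \<odot>\<^bsub>B\<^esub> \<one>\<^bsub>B\<^esub>)"

lemma hecke_systemD:
  assumes "hecke_system B Q r t"
  shows "i \<in> {1..<r} \<Longrightarrow> t i \<in> carrier B"
    and "i \<in> {1..<r} \<Longrightarrow> j \<in> {1..<r} \<Longrightarrow> \<bar>int i - int j\<bar> > 1 \<Longrightarrow> t i \<otimes>\<^bsub>B\<^esub> t j = t j \<otimes>\<^bsub>B\<^esub> t i"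
    and "i \<in> {1..<r} \<Longrightarrow> j \<in> {1..<r} \<Longrightarrow> \<bar>int i - int j\<bar> = 1 \<Longrightarrow>
        t i \<otimes>\<^bsub>B\<^esub> t j \<otimes>\<^bsub>B\<^esub> t i = t j \<otimes>\<^bsub>B\<^esub> t i \<otimes>\<^bsub>B\<^esub> t j"
    and "i \<in> {1..<r} \<Longrightarrow> t i \<otimes>\<^bsub>B\<^esub> t i = (Q - 1) \<odot>\<^bsub>B\<^esub> t i \<oplus>\<^bsub>B\<^esub> Q \<odot>\<^bsub>B\<^esub> \<one>\<^bsub>B\<^esub>"
  using assms unfolding hecke_system_def by blast+

lemma hecke_systemI:
  assumes "\<And>i. i \<in> {1..<r} \<Longrightarrow> t i \<in> carrier B"
    and "\<And>i j. i \<in> {1..<r} \<Longrightarrow> j \<in> {1..<r} \<Longrightarrow> \<bar>int i - int j\<bar> > 1 \<Longrightarrow> t i \<otimes>\<^bsub>B\<^esub> t j = t j \<otimes>\<^bsub>B\<^esub> t i"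
    and "\<And>i j. i \<in> {1..<r} \<Longrightarrow> j \<in> {1..<r} \<Longrightarrow> \<bar>int i - int j\<bar> = 1 \<Longrightarrow>
        t i \<otimes>\<^bsub>B\<^esub> t j \<otimes>\<^bsub>B\<^esub> t i = t j \<otimes>\<^bsub>B\<^esub> t i \<otimes>\<^bsub>B\<^esub> t j"
    and "\<And>i. i \<in> {1..<r} \<Longrightarrow> t i \<otimes>\<^bsub>B\<^esub> t i = (Q - 1) \<odot>\<^bsub>B\<^esub> t i \<oplus>\<^bsub>B\<^esub> Q \<odot>\<^bsub>B\<^esub> \<one>\<^bsub>B\<^esub>"
  shows "hecke_system B Q r t"
  using assms unfolding hecke_system_def by blast

lemma keys_fgen: "g \<in> G \<Longrightarrow> supp (fgen g) \<subseteq> lists G"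
  by simp

lemma keys_fconst: "supp (fconst c) \<subseteq> lists G"
  by simp

lemma keys_add_lists:
  "supp f \<subseteq> lists G \<Longrightarrow> supp g \<subseteq> lists G \<Longrightarrow> supp (f + g) \<subseteq> lists G"
  using keys_add[of f g] by blast

lemma keys_minus_lists:
  fixes f g :: "'g list \<Rightarrow>\<^sub>0 'k::comm_ring_1"
  assumes "supp f \<subseteq> lists G" "supp g \<subseteq> lists G"
  shows "supp (f - g) \<subseteq> lists G"
proof
  fix w assume "w \<in> supp (f - g)"
  then have "lookup f w \<noteq> 0 \<or> lookup g w \<noteq> 0"
    by (auto simp: in_keys_iff lookup_minus)
  then show "w \<in> lists G" using assms by (auto simp only: in_keys_iff[symmetric])
qed

lemmas free_alg_closed = keys_fgen keys_fconst keys_add_lists keys_minus_lists keys_free_mult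

lemma hecke_rels_closed: "hecke_rels Q r \<subseteq> carrier (free_alg {1..<r})"
proof
  fix x assume "x \<in> hecke_rels Q r"
  then show "x \<in> carrier (free_alg {1..<r})"
    unfolding monoid_alg_simps free_monoid_simps mem_Collect_eq
    by (induction rule: hecke_rels.induct) (intro free_alg_closed; assumption)+
qed

lemma hecke_alg_ideal: "alg_ideal (free_alg {1..<r}) (hecke_ideal Q r)"
  unfolding hecke_ideal_def by (rule alg_idealI[OF free_alg_assoc_alg hecke_rels_closed])

lemma hecke_assoc_alg: "assoc_alg (hecke Q r)"
  unfolding hecke_def by (rule alg_ideal.quot_assoc_alg[OF hecke_alg_ideal])

text \<open>Evaluation of polynomial expressions under a homomorphism from a free algebra.\<close>

lemma free_hom_simps:
  assumes h: "h \<in> alg_hom (free_alg G) B" and B: "assoc_alg B"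
  shows "supp f \<subseteq> lists G \<Longrightarrow> supp g \<subseteq> lists G \<Longrightarrow> h (f \<star> g) = h f \<otimes>\<^bsub>B\<^esub> h g"
    and "supp f \<subseteq> lists G \<Longrightarrow> supp g \<subseteq> lists G \<Longrightarrow> h (f + g) = h f \<oplus>\<^bsub>B\<^esub> h g"
    and "supp f \<subseteq> lists G \<Longrightarrow> supp g \<subseteq> lists G \<Longrightarrow> h (f - g) = h f \<ominus>\<^bsub>B\<^esub> h g"
    and "h (fconst c) = c \<odot>\<^bsub>B\<^esub> \<one>\<^bsub>B\<^esub>"
    and "h 0 = \<zero>\<^bsub>B\<^esub>"
    and "supp f \<subseteq> lists G \<Longrightarrow> h f \<in> carrier B"
proof -
  interpret h: alg_homomorphism "free_alg G" B h
    by (intro alg_homomorphism.intro free_alg_assoc_alg B alg_homomorphism_axioms.intro h)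
  show "h (f \<star> g) = h f \<otimes>\<^bsub>B\<^esub> h g" "h (f + g) = h f \<oplus>\<^bsub>B\<^esub> h g"
    if "supp f \<subseteq> lists G" "supp g \<subseteq> lists G"
    using h.hom_simps(2)[of f g] h.hom_simps(3)[of f g] that by simp_all
  show "h (f - g) = h f \<ominus>\<^bsub>B\<^esub> h g"
    if "supp f \<subseteq> lists G" "supp g \<subseteq> lists G"
    using h.hom_minus[of f g] that monoid_alg_minus[OF free_monoid_monoid, of g G f] by simp
  show "h (fconst c) = c \<odot>\<^bsub>B\<^esub> \<one>\<^bsub>B\<^esub>"
    using h.hom_simps(5)[of "fconst 1" c] h.hom_simps(4) by simp
  show "h 0 = \<zero>\<^bsub>B\<^esub>" using h.rh.hom_zero by simp
  show "h f \<in> carrier B" if "supp f \<subseteq> lists G" using h.hom_simps(1)[of f] that by simp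
qed

lemma hecke_induct [consumes 1, case_names one gen mult add smult]:
  assumes h: "h \<in> carrier (hecke Q r)"
    and one: "P \<one>\<^bsub>hecke Q r\<^esub>" and gen: "\<And>i. i \<in> {1..<r} \<Longrightarrow> P (heckeT Q r i)"
    and mult: "\<And>x y. x \<in> carrier (hecke Q r) \<Longrightarrow> y \<in> carrier (hecke Q r) \<Longrightarrow> P x \<Longrightarrow> P y \<Longrightarrow> P (x \<otimes>\<^bsub>hecke Q r\<^esub> y)"
    and add: "\<And>x y. x \<in> carrier (hecke Q r) \<Longrightarrow> y \<in> carrier (hecke Q r) \<Longrightarrow> P x \<Longrightarrow> P y \<Longrightarrow> P (x \<oplus>\<^bsub>hecke Q r\<^esub> y)"
    and smult: "\<And>c x. x \<in> carrier (hecke Q r) \<Longrightarrow> P x \<Longrightarrow> P (c \<odot>\<^bsub>hecke Q r\<^esub> x)"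
  shows "P h"
proof -
  interpret I: alg_ideal "free_alg {1..<r}" "hecke_ideal Q r" by (rule hecke_alg_ideal)
  let ?c = "\<lambda>f. hecke_ideal Q r +>\<^bsub>free_alg {1..<r}\<^esub> f"
  from h obtain f where f: "f \<in> carrier (free_alg {1..<r})" "h = ?c f"
    unfolding hecke_def I.carrier_quot by blast
  have "P (?c f)"
    using f(1)
  proof (rule free_alg_induct[where P = "\<lambda>f. P (?c f)"])
    show "P (?c (fconst 1))" using one unfolding hecke_def quot_alg_simps by simp
    show "P (?c (fgen i))" if "i \<in> {1..<r}" for i using gen[OF that] unfolding heckeT_def .
    fix x y :: "nat list \<Rightarrow>\<^sub>0 'a" and c
    assume x: "x \<in> carrier (free_alg {1..<r})" "P (?c x)"
    show "P (?c (c \<odot>\<^bsub>free_alg {1..<r}\<^esub> x))"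
      using smult[OF _ x(2), of c] I.cls_closed[OF x(1)] I.cls_smult[OF x(1), of c] unfolding hecke_def by simp
    assume y: "y \<in> carrier (free_alg {1..<r})" "P (?c y)"
    show "P (?c (x \<star> y))"
      using mult[OF _ _ x(2) y(2)] I.cls_closed[OF x(1)] I.cls_closed[OF y(1)] I.cls_mult[OF x(1) y(1)]
      unfolding hecke_def by simp
    show "P (?c (x + y))"
      using add[OF _ _ x(2) y(2)] I.cls_closed[OF x(1)] I.cls_closed[OF y(1)] I.cls_add[OF x(1) y(1)]
      unfolding hecke_def by simp
  qed
  then show ?thesis using f by simp
qed

lemma hecke_rel_values:
  assumes h: "h \<in> alg_hom (free_alg {1..<r}) B" and B: "assoc_alg B" and i: "i \<in> {1..<r}"
  defines "t \<equiv> \<lambda>i. h (fgen i)"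
  shows "j \<in> {1..<r} \<Longrightarrow> h (fgen i \<star> fgen j - fgen j \<star> fgen i)
      = t i \<otimes>\<^bsub>B\<^esub> t j \<ominus>\<^bsub>B\<^esub> t j \<otimes>\<^bsub>B\<^esub> t i"
    and "j \<in> {1..<r} \<Longrightarrow> h (fgen i \<star> fgen j \<star> fgen i - fgen j \<star> fgen i \<star> fgen j)
      = t i \<otimes>\<^bsub>B\<^esub> t j \<otimes>\<^bsub>B\<^esub> t i \<ominus>\<^bsub>B\<^esub> t j \<otimes>\<^bsub>B\<^esub> t i \<otimes>\<^bsub>B\<^esub> t j"
    and "h (fgen i \<star> fgen i - (fconst (Q - 1) \<star> fgen i + fconst Q))
      = t i \<otimes>\<^bsub>B\<^esub> t i \<ominus>\<^bsub>B\<^esub> ((Q - 1) \<odot>\<^bsub>B\<^esub> t i \<oplus>\<^bsub>B\<^esub> Q \<odot>\<^bsub>B\<^esub> \<one>\<^bsub>B\<^esub>)"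
proof -
  interpret B: assoc_alg B by fact
  note s = free_hom_simps[OF h B]
  have c: "h (fgen i) \<in> carrier B" by (rule s(6)[OF keys_fgen[OF i]])
  show "h (fgen i \<star> fgen j - fgen j \<star> fgen i) = t i \<otimes>\<^bsub>B\<^esub> t j \<ominus>\<^bsub>B\<^esub> t j \<otimes>\<^bsub>B\<^esub> t i"
    "h (fgen i \<star> fgen j \<star> fgen i - fgen j \<star> fgen i \<star> fgen j)
      = t i \<otimes>\<^bsub>B\<^esub> t j \<otimes>\<^bsub>B\<^esub> t i \<ominus>\<^bsub>B\<^esub> t j \<otimes>\<^bsub>B\<^esub> t i \<otimes>\<^bsub>B\<^esub> t j" if "j \<in> {1..<r}"
    using i that by (simp_all only: t_def s free_alg_closed)
  show "h (fgen i \<star> fgen i - (fconst (Q - 1) \<star> fgen i + fconst Q))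
      = t i \<otimes>\<^bsub>B\<^esub> t i \<ominus>\<^bsub>B\<^esub> ((Q - 1) \<odot>\<^bsub>B\<^esub> t i \<oplus>\<^bsub>B\<^esub> Q \<odot>\<^bsub>B\<^esub> \<one>\<^bsub>B\<^esub>)"
    using i c by (simp only: t_def s free_alg_closed B.smult_mult_l B.one_closed B.l_one)
qed

lemma hecke_rels_vanish:
  assumes h: "h \<in> alg_hom (free_alg {1..<r}) B" and B: "assoc_alg B"
    and t: "hecke_system B Q r (\<lambda>i. h (fgen i))" and x: "x \<in> hecke_rels Q r"
  shows "h x = \<zero>\<^bsub>B\<^esub>"
proof -
  interpret B: assoc_alg B by fact
  note tc = hecke_systemD(1)[OF t] and val = hecke_rel_values[OF h B]
  have z: "y \<ominus>\<^bsub>B\<^esub> y = \<zero>\<^bsub>B\<^esub>" if "y \<in> carrier B" for y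
    using that by (simp add: B.diff_zero_iff)
  from x show ?thesis
  proof cases
    case (comm i j)
    show ?thesis unfolding comm(1) val(1)[OF comm(2,3)] hecke_systemD(2)[OF t comm(2-4)]
      by (intro z B.m_closed tc comm)
  next
    case (braid i j)
    show ?thesis unfolding braid(1) val(2)[OF braid(2,3)] hecke_systemD(3)[OF t braid(2-4)]
      by (intro z B.m_closed tc braid)
  next
    case (quad i)
    show ?thesis unfolding quad(1) val(3)[OF quad(2)] hecke_systemD(4)[OF t quad(2)]
      by (intro z B.a_closed B.smult_closed B.one_closed tc quad)
  qed
qed

text \<open>Existence and uniqueness of the homomorphism with prescribed values on the generators, which
  turn the description that defines \<open>hecke_hom\<close> into a usable one.\<close>

lemma hecke_hom_props:
  assumes B: "assoc_alg B" and t: "hecke_system B Q r t"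
  shows "hecke_hom Q r B t \<in> alg_hom (hecke Q r) B"
    and "\<And>i. i \<in> {1..<r} \<Longrightarrow> hecke_hom Q r B t (heckeT Q r i) = t i"
proof -
  interpret B: assoc_alg B by fact
  interpret I: alg_ideal "free_alg {1..<r}" "hecke_ideal Q r" by (rule hecke_alg_ideal)
  let ?D = "\<lambda>\<phi>. \<phi> \<in> alg_hom (hecke Q r) B \<and> \<phi> \<in> extensional (carrier (hecke Q r))
      \<and> (\<forall>i\<in>{1..<r}. \<phi> (heckeT Q r i) = t i)"
  have tG: "t \<in> {1..<r} \<rightarrow> carrier B" using t unfolding hecke_system_def by blast
  have ev: "alg_eval B t \<in> alg_hom (free_alg {1..<r}) B" by (rule B.eval_hom[OF tG])
  have gen: "alg_eval B t (fgen i) = t i" if "i \<in> {1..<r}" for i by (rule B.eval_gen[OF tG that])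
  have sys: "hecke_system B Q r (\<lambda>i. alg_eval B t (fgen i))"
    using t unfolding hecke_system_def by (simp add: gen Pi_iff del: One_nat_def)
  interpret ev: alg_homomorphism "free_alg {1..<r}" B "alg_eval B t"
    by (intro alg_homomorphism.intro free_alg_assoc_alg B alg_homomorphism_axioms.intro ev)
  have kill: "alg_eval B t x = \<zero>\<^bsub>B\<^esub>" if "x \<in> hecke_ideal Q r" for x
  proof (rule ev.kills_genideal[OF hecke_rels_closed])
    show "x \<in> genideal (free_alg {1..<r}) (hecke_rels Q r)" using that unfolding hecke_ideal_def .
  qed (rule hecke_rels_vanish[OF ev B sys])
  from I.factor_hom[OF B ev kill]
  obtain \<phi> where \<phi>: "\<phi> \<in> alg_hom (hecke Q r) B" "\<phi> \<in> extensional (carrier (hecke Q r))"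
    "\<And>x. x \<in> carrier (free_alg {1..<r}) \<Longrightarrow> \<phi> (hecke_ideal Q r +>\<^bsub>free_alg {1..<r}\<^esub> x) = alg_eval B t x"
    unfolding hecke_def by blast
  have "\<phi> (heckeT Q r i) = t i" if "i \<in> {1..<r}" for i
    unfolding heckeT_def using \<phi>(3)[of "fgen i"] gen[OF that] that by simp
  then have D: "?D \<phi>" using \<phi> by blast
  have uniq: "\<psi> = \<phi>" if \<psi>: "?D \<psi>" for \<psi>
  proof (rule extensionalityI)
    note h\<psi> = alg_homD[OF conjunct1[OF \<psi>]] and h\<phi> = alg_homD[OF \<phi>(1)]
    show "\<psi> \<in> extensional (carrier (hecke Q r))" "\<phi> \<in> extensional (carrier (hecke Q r))"
      using \<psi> D by blast+
    fix h assume "h \<in> carrier (hecke Q r)"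
    then show "\<psi> h = \<phi> h"
    proof (induction h rule: hecke_induct)
      case one
      show ?case using \<psi> D alg_homD(4) by metis
    next
      case (gen i)
      then show ?case using \<psi> D by simp
    next
      case (mult x y)
      then show ?case by (simp only: h\<psi>(2) h\<phi>(2))
    next
      case (add x y)
      then show ?case by (simp only: h\<psi>(3) h\<phi>(3))
    next
      case (smult c x)
      then show ?case by (simp only: h\<psi>(5) h\<phi>(5))
    qed
  qed
  have "?D (hecke_hom Q r B t)"
    unfolding hecke_hom_def by (rule theI[of ?D, OF D uniq])
  then show "hecke_hom Q r B t \<in> alg_hom (hecke Q r) B"
    "\<And>i. i \<in> {1..<r} \<Longrightarrow> hecke_hom Q r B t (heckeT Q r i) = t i" by blast+
qed

lemma hecke_system_gens: "hecke_system (hecke Q r) Q r (heckeT Q r)"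
proof -
  interpret I: alg_ideal "free_alg {1..<r}" "hecke_ideal Q r" by (rule hecke_alg_ideal)
  interpret H: assoc_alg "hecke Q r" by (rule hecke_assoc_alg)
  let ?c = "\<lambda>f. hecke_ideal Q r +>\<^bsub>free_alg {1..<r}\<^esub> f"
  have c: "?c \<in> alg_hom (free_alg {1..<r}) (hecke Q r)" unfolding hecke_def by (rule I.cls_hom)
  note val = hecke_rel_values[OF c hecke_assoc_alg, folded heckeT_def]
  have Tc: "heckeT Q r i \<in> carrier (hecke Q r)" if "i \<in> {1..<r}" for i
    unfolding heckeT_def by (rule free_hom_simps(6)[OF c hecke_assoc_alg keys_fgen[OF that]])
  have z: "?c x = \<zero>\<^bsub>hecke Q r\<^esub>" if "x \<in> hecke_rels Q r" for x
  proof -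
    have "x \<in> hecke_ideal Q r"
      unfolding hecke_ideal_def using I.genideal_self[OF hecke_rels_closed] that by blast
    then show ?thesis unfolding hecke_def by (rule I.cls_zero)
  qed
  show ?thesis
  proof (rule hecke_systemI)
    fix i assume i: "i \<in> {1..<r}"
    show "heckeT Q r i \<in> carrier (hecke Q r)" by (rule Tc[OF i])
    show "heckeT Q r i \<otimes>\<^bsub>hecke Q r\<^esub> heckeT Q r i
      = (Q - 1) \<odot>\<^bsub>hecke Q r\<^esub> heckeT Q r i \<oplus>\<^bsub>hecke Q r\<^esub> Q \<odot>\<^bsub>hecke Q r\<^esub> \<one>\<^bsub>hecke Q r\<^esub>"
      using z[OF hecke_rels.quad[OF i]] Tc[OF i] unfolding val(3)[OF i] by (simp add: H.diff_zero_iff)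
    fix j assume j: "j \<in> {1..<r}"
    show "heckeT Q r i \<otimes>\<^bsub>hecke Q r\<^esub> heckeT Q r j = heckeT Q r j \<otimes>\<^bsub>hecke Q r\<^esub> heckeT Q r i"
      if "\<bar>int i - int j\<bar> > 1"
      using z[OF hecke_rels.comm[OF i j that]] Tc[OF i] Tc[OF j] unfolding val(1)[OF i j]
      by (simp add: H.diff_zero_iff)
    show "heckeT Q r i \<otimes>\<^bsub>hecke Q r\<^esub> heckeT Q r j \<otimes>\<^bsub>hecke Q r\<^esub> heckeT Q r i
      = heckeT Q r j \<otimes>\<^bsub>hecke Q r\<^esub> heckeT Q r i \<otimes>\<^bsub>hecke Q r\<^esub> heckeT Q r j"
      if "\<bar>int i - int j\<bar> = 1"
      using z[OF hecke_rels.braid[OF i j that]] Tc[OF i] Tc[OF j] unfolding val(2)[OF i j]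
      by (simp add: H.diff_zero_iff)
  qed
qed

context ring
begin

lemma sharp_quad:
  assumes "z \<in> carrier R" "w \<in> carrier R" "a \<in> carrier R" "z \<otimes> a = a \<otimes> z" "a \<otimes> a = z \<otimes> a \<oplus> w"
  shows "(z \<ominus> a) \<otimes> (z \<ominus> a) = z \<otimes> (z \<ominus> a) \<oplus> w"
proof -
  have "(z \<ominus> a) \<otimes> (z \<ominus> a) = z \<otimes> z \<ominus> z \<otimes> a \<ominus> a \<otimes> z \<oplus> a \<otimes> a"
    using assms(1-3) by algebra
  also have "\<dots> = z \<otimes> z \<ominus> z \<otimes> a \<ominus> z \<otimes> a \<oplus> (z \<otimes> a \<oplus> w)" using assms by simp
  also have "\<dots> = z \<otimes> (z \<ominus> a) \<oplus> w" using assms(1-3) by algebra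
  finally show ?thesis .
qed

text \<open>The right-hand side is visibly symmetric in \<open>a\<close> and \<open>b\<close> once $aba = bab$.\<close>

lemma sharp_braid:
  assumes "z \<in> carrier R" "w \<in> carrier R" "a \<in> carrier R" "b \<in> carrier R"
    "z \<otimes> a = a \<otimes> z" "z \<otimes> b = b \<otimes> z" "a \<otimes> a = z \<otimes> a \<oplus> w"
  shows "(z \<ominus> a) \<otimes> (z \<ominus> b) \<otimes> (z \<ominus> a) = z \<otimes> z \<otimes> z \<oplus> z \<otimes> w \<oplus> z \<otimes> (a \<otimes> b) \<oplus> z \<otimes> (b \<otimes> a)
    \<ominus> z \<otimes> (z \<otimes> a) \<ominus> z \<otimes> (z \<otimes> b) \<ominus> a \<otimes> b \<otimes> a"
proof -
  have "(z \<ominus> a) \<otimes> (z \<ominus> b) \<otimes> (z \<ominus> a) = z \<otimes> z \<otimes> z \<ominus> z \<otimes> (z \<otimes> a) \<ominus> z \<otimes> (b \<otimes> z) \<oplus> z \<otimes> (b \<otimes> a)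
     \<ominus> (a \<otimes> z) \<otimes> z \<oplus> (a \<otimes> z) \<otimes> a \<oplus> a \<otimes> (b \<otimes> z) \<ominus> a \<otimes> b \<otimes> a"
    using assms(1-4) by algebra
  also have "b \<otimes> z = z \<otimes> b" using assms by simp
  also have "a \<otimes> z = z \<otimes> a" using assms by simp
  also have "a \<otimes> (z \<otimes> b) = z \<otimes> (a \<otimes> b)" using assms m_assoc by metis
  also have "z \<otimes> a \<otimes> z = z \<otimes> (z \<otimes> a)" using assms m_assoc by metis
  also have "z \<otimes> a \<otimes> a = z \<otimes> (z \<otimes> a \<oplus> w)" using assms m_assoc by metis
  also have "z \<otimes> z \<otimes> z \<ominus> z \<otimes> (z \<otimes> a) \<ominus> z \<otimes> (z \<otimes> b) \<oplus> z \<otimes> (b \<otimes> a)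
     \<ominus> z \<otimes> (z \<otimes> a) \<oplus> z \<otimes> (z \<otimes> a \<oplus> w) \<oplus> z \<otimes> (a \<otimes> b) \<ominus> a \<otimes> b \<otimes> a
    = z \<otimes> z \<otimes> z \<oplus> z \<otimes> w \<oplus> z \<otimes> (a \<otimes> b) \<oplus> z \<otimes> (b \<otimes> a)
    \<ominus> z \<otimes> (z \<otimes> a) \<ominus> z \<otimes> (z \<otimes> b) \<ominus> a \<otimes> b \<otimes> a"
    using assms(1-4) by algebra
  finally show ?thesis .
qed

end

lemma (in assoc_alg) hecke_system_sharp:
  assumes t: "hecke_system A Q r t"
  shows "hecke_system A Q r (\<lambda>i. (Q - 1) \<odot> \<one> \<ominus> t i)"
proof -
  note tc = hecke_systemD(1)[OF t]
  let ?z = "(Q - 1) \<odot> \<one>" and ?w = "Q \<odot> \<one>"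
  have zc: "?z \<in> carrier A" "?w \<in> carrier A" by auto
  have z: "?z \<otimes> x = (Q - 1) \<odot> x" "x \<otimes> ?z = (Q - 1) \<odot> x" if "x \<in> carrier A" for x
    using that by (simp_all add: smult_mult_l smult_mult_r)
  have zz: "?z \<otimes> x = x \<otimes> ?z" if "x \<in> carrier A" for x
    using z that by simp
  have q: "t i \<otimes> t i = ?z \<otimes> t i \<oplus> ?w" if "i \<in> {1..<r}" for i
    using hecke_systemD(4)[OF t that] z(1)[OF tc[OF that]] by simp
  show ?thesis
  proof (rule hecke_systemI)
    fix i assume i: "i \<in> {1..<r}"
    note ti = tc[OF i]
    show "?z \<ominus> t i \<in> carrier A" using zc ti by simp
    then show "(?z \<ominus> t i) \<otimes> (?z \<ominus> t i) = (Q - 1) \<odot> (?z \<ominus> t i) \<oplus> ?w"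
      using sharp_quad[OF zc ti zz[OF ti] q[OF i]] z(1) by simp
    fix j assume j: "j \<in> {1..<r}"
    note tj = tc[OF j]
    show "(?z \<ominus> t i) \<otimes> (?z \<ominus> t j) = (?z \<ominus> t j) \<otimes> (?z \<ominus> t i)" if "\<bar>int i - int j\<bar> > 1"
    proof -
      have e: "(?z \<ominus> x) \<otimes> (?z \<ominus> y)
         = ?z \<otimes> ?z \<ominus> ?z \<otimes> y \<ominus> ?z \<otimes> x \<oplus> x \<otimes> y" if "x \<in> carrier A" "y \<in> carrier A" for x y
        unfolding zz[OF that(1)] using zc(1) that by algebra
      show ?thesis
        unfolding e[OF ti tj] e[OF tj ti] hecke_systemD(2)[OF t i j that]
        using zc(1) ti tj by algebra
    qed
    show "(?z \<ominus> t i) \<otimes> (?z \<ominus> t j) \<otimes> (?z \<ominus> t i)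
      = (?z \<ominus> t j) \<otimes> (?z \<ominus> t i) \<otimes> (?z \<ominus> t j)" if "\<bar>int i - int j\<bar> = 1"
      unfolding sharp_braid[OF zc ti tj zz[OF ti] zz[OF tj] q[OF i]]
        sharp_braid[OF zc tj ti zz[OF tj] zz[OF ti] q[OF j]]
        hecke_systemD(3)[OF t i j that]
      using zc ti tj by algebra
  qed
qed

section \<open>Corner algebras\<close>

lemma corner_simps [simp]:
  "mult (corner A e) = mult A" "one (corner A e) = e" "zero (corner A e) = zero A"
  "add (corner A e) = add A" "smult (corner A e) = smult A"
  by (simp_all add: corner_def)

context assoc_alg
begin

lemma corner_carrier:
  assumes "e \<in> carrier A" "e \<otimes> e = e"
  shows "carrier (corner A e) = {x \<in> carrier A. e \<otimes> x = x \<and> x \<otimes> e = x}"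
proof (intro equalityI subsetI)
  fix x assume "x \<in> carrier (corner A e)"
  then obtain a where a: "a \<in> carrier A" "x = e \<otimes> a \<otimes> e" by (auto simp: corner_def)
  have "e \<otimes> x = (e \<otimes> e) \<otimes> a \<otimes> e" "x \<otimes> e = e \<otimes> a \<otimes> (e \<otimes> e)"
    using a assms(1) by (simp_all add: m_assoc)
  then show "x \<in> {x \<in> carrier A. e \<otimes> x = x \<and> x \<otimes> e = x}" using a assms by simp
next
  fix x assume "x \<in> {x \<in> carrier A. e \<otimes> x = x \<and> x \<otimes> e = x}"
  then have "x \<in> carrier A" "x = e \<otimes> x \<otimes> e" by simp_all
  then show "x \<in> carrier (corner A e)" by (auto simp: corner_def)
qed

lemma corner_assoc_alg:
  assumes e: "e \<in> carrier A" "e \<otimes> e = e"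
  shows "assoc_alg (corner A e)"
proof (intro assoc_alg.intro ringI abelian_groupI monoidI assoc_alg_axioms.intro;
    unfold corner_carrier[OF e] corner_simps)
  show "\<exists>y\<in>{x \<in> carrier A. e \<otimes> x = x \<and> x \<otimes> e = x}. y \<oplus> x = \<zero>"
    if "x \<in> {x \<in> carrier A. e \<otimes> x = x \<and> x \<otimes> e = x}" for x
    by (rule bexI[of _ "\<ominus> x"]) (use that e in \<open>auto simp: l_neg r_minus l_minus\<close>)
  show "x \<oplus> y = y \<oplus> x"
    if "x \<in> {x \<in> carrier A. e \<otimes> x = x \<and> x \<otimes> e = x}" "y \<in> {x \<in> carrier A. e \<otimes> x = x \<and> x \<otimes> e = x}" for x y
    using that by (simp add: a_comm)
  show "x \<otimes> y \<in> {x \<in> carrier A. e \<otimes> x = x \<and> x \<otimes> e = x}"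
    if "x \<in> {x \<in> carrier A. e \<otimes> x = x \<and> x \<otimes> e = x}" "y \<in> {x \<in> carrier A. e \<otimes> x = x \<and> x \<otimes> e = x}" for x y
  proof -
    have "e \<otimes> (x \<otimes> y) = x \<otimes> y" "(x \<otimes> y) \<otimes> e = x \<otimes> y"
      using that e m_assoc[of e x y] m_assoc[of x y e] by simp_all
    then show ?thesis using that by simp
  qed
  show "c \<odot> x \<in> {x \<in> carrier A. e \<otimes> x = x \<and> x \<otimes> e = x}"
    if "x \<in> {x \<in> carrier A. e \<otimes> x = x \<and> x \<otimes> e = x}" for x c
    using that e by (simp add: smult_mult_l smult_mult_r)
qed (use e in \<open>simp_all add: m_assoc a_assoc l_distr r_distr smult_l_distr smult_r_distr smult_assoc
      smult_mult_l smult_mult_r\<close>)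

text \<open>The additive inverse of a ring is chosen inside its carrier, so that the differences in a corner
  and in the ambient algebra have to be compared.\<close>

lemma corner_minus:
  assumes e: "e \<in> carrier A" "e \<otimes> e = e" and "x \<in> carrier (corner A e)" "y \<in> carrier (corner A e)"
  shows "a_minus (corner A e) x y = x \<ominus> y"
proof -
  interpret C: assoc_alg "corner A e" by (rule corner_assoc_alg[OF e])
  have "y \<oplus> a_inv (corner A e) y = \<zero>" "a_inv (corner A e) y \<in> carrier (corner A e)"
    using C.r_neg[OF assms(4)] C.a_inv_closed[OF assms(4)] by simp_all
  then have "a_inv (corner A e) y = \<ominus> y"
    using assms(4) unfolding corner_carrier[OF e]
    by (metis (mono_tags, lifting) add.inv_equality a_comm mem_Collect_eq)
  then show ?thesis by (simp add: a_minus_def)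
qed

end

text \<open>If $aba - u = bab - u'$, where $a^2 = u + a$ and $b^2 = u' + b$, then this shows the braid
  relation for $a - 1$ and $b - 1$.\<close>

lemma (in ring) shift_braid:
  assumes "a \<in> carrier R" "b \<in> carrier R" "u \<in> carrier R" "a \<otimes> a = u \<oplus> a"
  shows "(a \<ominus> \<one>) \<otimes> (b \<ominus> \<one>) \<otimes> (a \<ominus> \<one>) = (a \<otimes> b \<otimes> a \<ominus> u) \<ominus> a \<otimes> b \<ominus> b \<otimes> a \<oplus> a \<oplus> b \<ominus> \<one>"
proof -
  have "(a \<ominus> w) \<otimes> (b \<ominus> w) \<otimes> (a \<ominus> w) = a \<otimes> b \<otimes> a \<ominus> a \<otimes> w \<otimes> a \<ominus> a \<otimes> b \<otimes> w \<ominus> w \<otimes> b \<otimes> a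
      \<oplus> a \<otimes> w \<otimes> w \<oplus> w \<otimes> w \<otimes> a \<oplus> w \<otimes> b \<otimes> w \<ominus> w \<otimes> w \<otimes> w" if "w \<in> carrier R" for w
    using assms(1-2) that by algebra
  from this[OF one_closed] have "(a \<ominus> \<one>) \<otimes> (b \<ominus> \<one>) \<otimes> (a \<ominus> \<one>)
      = a \<otimes> b \<otimes> a \<ominus> a \<otimes> a \<ominus> a \<otimes> b \<ominus> b \<otimes> a \<oplus> a \<oplus> a \<oplus> b \<ominus> \<one>"
    using assms(1-2) by simp
  also have "\<dots> = a \<otimes> b \<otimes> a \<ominus> (u \<oplus> a) \<ominus> a \<otimes> b \<ominus> b \<otimes> a \<oplus> a \<oplus> a \<oplus> b \<ominus> \<one>"
    by (simp only: assms(4))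
  also have "\<dots> = (a \<otimes> b \<otimes> a \<ominus> u) \<ominus> a \<otimes> b \<ominus> b \<otimes> a \<oplus> a \<oplus> b \<ominus> \<one>"
    using assms(1-3) by algebra
  finally show ?thesis .
qed

lemma (in ring) shift_mult:
  assumes "a \<in> carrier R" "b \<in> carrier R"
  shows "(a \<ominus> \<one>) \<otimes> (b \<ominus> \<one>) = a \<otimes> b \<ominus> a \<ominus> b \<oplus> \<one>"
proof -
  have "(a \<ominus> w) \<otimes> (b \<ominus> w) = a \<otimes> b \<ominus> a \<otimes> w \<ominus> w \<otimes> b \<oplus> w \<otimes> w" if "w \<in> carrier R" for w
    using assms that by algebra
  from this[OF one_closed] show ?thesis using assms by simp
qed

text \<open>In the generators $g_i = q^{-1}(T_i + 1)$ the quadratic relation of the Hecke algebra with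
  parameter $q^2$ reads $g_i^2 = (q+q^{-1})g_i$, and the braid relation says that
  $g_i g_j g_i - g_i$ is symmetric in $i$ and $j$.\<close>

lemma (in assoc_alg) hecke_system_shift:
  assumes q: "q * q' = 1"
    and Ac: "\<And>i. i \<in> {1..<r} \<Longrightarrow> g i \<in> carrier A"
    and quad: "\<And>i. i \<in> {1..<r} \<Longrightarrow> g i \<otimes> g i = (q + q') \<odot> g i"
    and comm: "\<And>i j. i \<in> {1..<r} \<Longrightarrow> j \<in> {1..<r} \<Longrightarrow> \<bar>int i - int j\<bar> > 1 \<Longrightarrow> g i \<otimes> g j = g j \<otimes> g i"
    and cubic: "\<And>i j. i \<in> {1..<r} \<Longrightarrow> j \<in> {1..<r} \<Longrightarrow> \<bar>int i - int j\<bar> = 1 \<Longrightarrow>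
      g i \<otimes> g j \<otimes> g i \<ominus> g i = g j \<otimes> g i \<otimes> g j \<ominus> g j"
  shows "hecke_system A (q\<^sup>2) r (\<lambda>i. q \<odot> g i \<ominus> \<one>)"
proof -
  let ?b = "\<lambda>i. q \<odot> g i" and ?u = "\<lambda>i. q\<^sup>2 \<odot> (q \<odot> g i)"
  have bc: "?b i \<in> carrier A" and uc: "?u i \<in> carrier A" if "i \<in> {1..<r}" for i
    using Ac[OF that] by auto
  have bb: "?b i \<otimes> ?b i = ?u i \<oplus> ?b i" if i: "i \<in> {1..<r}" for i
  proof -
    have "?b i \<otimes> ?b i = (q * q * (q + q')) \<odot> g i"
      using Ac[OF i] by (simp add: smult_mult_l smult_mult_r quad[OF i] smult_assoc)
    also have "q * q * (q + q') = q\<^sup>2 * q + q"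
      using q by (simp add: power2_eq_square distrib_left mult.assoc)
    finally show ?thesis using Ac[OF i] by (simp add: smult_l_distr smult_assoc)
  qed
  show ?thesis
  proof (rule hecke_systemI)
    fix i assume i: "i \<in> {1..<r}"
    note ci = bc[OF i] uc[OF i]
    show "?b i \<ominus> \<one> \<in> carrier A" using ci by simp
    have "(?b i \<ominus> \<one>) \<otimes> (?b i \<ominus> \<one>) = ?b i \<otimes> ?b i \<ominus> ?b i \<ominus> ?b i \<oplus> \<one>"
      by (rule shift_mult[OF ci(1) ci(1)])
    also have "\<dots> = ?u i \<ominus> ?b i \<oplus> \<one>"
      unfolding bb[OF i] using ci by algebra
    also have "\<dots> = (?u i \<ominus> q\<^sup>2 \<odot> \<one>) \<ominus> (?b i \<ominus> \<one>) \<oplus> q\<^sup>2 \<odot> \<one>"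
      using ci smult_closed[OF one_closed, of "q\<^sup>2"] by algebra
    also have "(?u i \<ominus> q\<^sup>2 \<odot> \<one>) \<ominus> (?b i \<ominus> \<one>) = (q\<^sup>2 - 1) \<odot> (?b i \<ominus> \<one>)"
    proof -
      have "(q\<^sup>2 - 1) \<odot> (?b i \<ominus> \<one>) = ?u i \<ominus> ?b i \<ominus> (q\<^sup>2 \<odot> \<one> \<ominus> \<one>)"
        using ci by (simp add: smult_l_diff smult_r_diff)
      then show ?thesis using ci smult_closed[OF one_closed, of "q\<^sup>2"] by algebra
    qed
    finally show "(?b i \<ominus> \<one>) \<otimes> (?b i \<ominus> \<one>)
      = (q\<^sup>2 - 1) \<odot> (?b i \<ominus> \<one>) \<oplus> q\<^sup>2 \<odot> \<one>" .
    fix j assume j: "j \<in> {1..<r}"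
    note cj = bc[OF j] uc[OF j]
    show "(?b i \<ominus> \<one>) \<otimes> (?b j \<ominus> \<one>) = (?b j \<ominus> \<one>) \<otimes> (?b i \<ominus> \<one>)"
      if "\<bar>int i - int j\<bar> > 1"
    proof -
      have "?b i \<otimes> ?b j = ?b j \<otimes> ?b i"
        using comm[OF i j that] Ac[OF i] Ac[OF j] by (simp add: smult_mult_l smult_mult_r)
      then show ?thesis
        unfolding shift_mult[OF ci(1) cj(1)] shift_mult[OF cj(1) ci(1)] using ci cj by algebra
    qed
    show "(?b i \<ominus> \<one>) \<otimes> (?b j \<ominus> \<one>) \<otimes> (?b i \<ominus> \<one>)
        = (?b j \<ominus> \<one>) \<otimes> (?b i \<ominus> \<one>) \<otimes> (?b j \<ominus> \<one>)" if "\<bar>int i - int j\<bar> = 1"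
    proof -
      have e: "?b x \<otimes> ?b y \<otimes> ?b x \<ominus> ?u x
         = (q\<^sup>2 * q) \<odot> (g x \<otimes> g y \<otimes> g x \<ominus> g x)" if "x \<in> {1..<r}" "y \<in> {1..<r}" for x y
        using Ac[OF that(1)] Ac[OF that(2)]
        by (simp add: smult_mult_l smult_mult_r smult_r_diff smult_assoc power2_eq_square)
      have "?b i \<otimes> ?b j \<otimes> ?b i \<ominus> ?u i = ?b j \<otimes> ?b i \<otimes> ?b j \<ominus> ?u j"
        unfolding e[OF i j] e[OF j i] cubic[OF i j that] ..
      then show ?thesis
        unfolding shift_braid[OF ci(1) cj(1) ci(2) bb[OF i]] shift_braid[OF cj(1) ci(1) cj(2) bb[OF j]]
        using ci cj by algebra
    qed
  qed
qed

section \<open>Specialisation of the parameter\<close>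

lemma quot_extend_simps:
  fixes A :: "('a, 'x) ring_scheme" and I :: "'a set" and \<sigma> :: "'k \<Rightarrow> 'a set \<Rightarrow> 'a set"
  defines "Q \<equiv> ring.extend (A Quot I) (module.fields \<sigma>)"
  shows "carrier Q = a_rcosets\<^bsub>A\<^esub> I" "mult Q = rcoset_mult A I" "one Q = I +>\<^bsub>A\<^esub> \<one>\<^bsub>A\<^esub>"
    "zero Q = I" "add Q = set_add A" "smult Q c X = \<sigma> c X" "mult (A Quot I) = rcoset_mult A I"
  by (simp_all add: Q_def ring.extend_def module.fields_def FactRing_def)

text \<open>A ring \<open>B\<close> with a multiplication by Laurent polynomials in $\upsilon$. Its base change along
  $\upsilon \mapsto q$ is an algebra, and $b \mapsto b \otimes 1$ is a ring homomorphism that turns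
  multiplication by a Laurent polynomial into multiplication by its value at \<open>q\<close>.\<close>

locale specialisation =
  fixes q :: "'f::field" and B :: "(qv, 'b) module"
  assumes ring_B: "ring B"
    and laurent_closed: "\<And>b p k. b \<in> carrier B \<Longrightarrow> laurent vv p k \<odot>\<^bsub>B\<^esub> b \<in> carrier B"
begin

interpretation B: ring B by (rule ring_B)

abbreviation "P \<equiv> pair_ring B :: (int, ('b \<times> 'f) \<Rightarrow>\<^sub>0 int) module"
abbreviation "J \<equiv> tensor_ideal q B"

lemma pair_monoid: "Group.monoid (B \<times>\<times> (mult_monoid :: 'f monoid))"
proof (rule DirProd_monoid)
  show "Group.monoid B" by (rule B.monoid_axioms)
  show "Group.monoid (mult_monoid :: 'f monoid)"
    by (rule monoidI) (auto simp: mult_monoid_def mult.assoc)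
qed

lemma pair_carrier: "carrier (B \<times>\<times> (mult_monoid :: 'f monoid)) = carrier B \<times> UNIV"
  by (simp add: DirProd_def mult_monoid_def)

lemma pair_assoc_alg: "assoc_alg P"
  unfolding pair_ring_def by (rule monoid_alg_assoc_alg[OF pair_monoid])

lemma pair_ring_simps:
  "carrier P = {f. supp f \<subseteq> carrier B \<times> UNIV}"
  "add P = (+)"
  "one P = single (\<one>\<^bsub>B\<^esub>, 1) 1"
  unfolding pair_ring_def monoid_alg_simps pair_carrier by (simp_all add: mult_monoid_def)

lemma pair_mult:
  "single (b, c) x \<otimes>\<^bsub>P\<^esub> single (b', c') y
    = single (b \<otimes>\<^bsub>B\<^esub> b', c * c') (x * y)"
  unfolding pair_ring_def by (simp add: DirProd_def mult_monoid_def)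

lemma single_closed: "b \<in> carrier B \<Longrightarrow> single (b, c) x \<in> carrier P"
  by (auto simp: pair_ring_simps)

lemma pair_minus:
  assumes "f \<in> carrier P" "g \<in> carrier P" shows "f - g \<in> carrier P" "a_minus P f g = f - g"
proof -
  show m: "a_minus P f g = f - g"
  proof -
    have "supp g \<subseteq> carrier (B \<times>\<times> (mult_monoid :: 'f monoid))"
      using assms(2) unfolding pair_ring_simps pair_carrier by blast
    then show ?thesis unfolding pair_ring_def by (rule monoid_alg_minus[OF pair_monoid])
  qed
  interpret assoc_alg P by (rule pair_assoc_alg)
  show "f - g \<in> carrier P" using minus_closed[OF assms] m by simp
qed

lemma rels_closed: "tensor_rels q B \<subseteq> carrier P"
proof
  fix x assume "x \<in> tensor_rels q B"
  then show "x \<in> carrier P"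
    by (induction rule: tensor_rels.induct)
      (intro pair_minus(1) single_closed B.add.m_closed laurent_closed; assumption)+
qed

interpretation J: alg_ideal P J
  unfolding tensor_ideal_def by (rule alg_idealI[OF pair_assoc_alg rels_closed])

abbreviation "S \<equiv> base_change q B"

lemma base_change_simps:
  "carrier S = {J +>\<^bsub>P\<^esub> x | x. x \<in> carrier P}"
  "mult S = rcoset_mult P J"
  "one S = J +>\<^bsub>P\<^esub> \<one>\<^bsub>P\<^esub>"
  "zero S = J"
  "add S = set_add P"
  "smult S c X = rcoset_mult P J (tens q B \<one>\<^bsub>B\<^esub> c) X"
  by (simp_all only: base_change_def Let_def quot_extend_simps J.carrier_quot[unfolded quot_alg_simps(1)])

lemma cls_mult: "x \<in> carrier P \<Longrightarrow> y \<in> carrier P \<Longrightarrow> (J +>\<^bsub>P\<^esub> x) \<otimes>\<^bsub>S\<^esub> (J +>\<^bsub>P\<^esub> y) = J +>\<^bsub>P\<^esub> (x \<otimes>\<^bsub>P\<^esub> y)"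
  by (simp only: base_change_simps(2) J.rcoset_mult_add)

lemma cls_add: "x \<in> carrier P \<Longrightarrow> y \<in> carrier P \<Longrightarrow> (J +>\<^bsub>P\<^esub> x) \<oplus>\<^bsub>S\<^esub> (J +>\<^bsub>P\<^esub> y) = J +>\<^bsub>P\<^esub> (x + y)"
  by (simp only: base_change_simps(5) J.a_rcos_sum pair_ring_simps(2))

lemma cls_closed: "x \<in> carrier P \<Longrightarrow> J +>\<^bsub>P\<^esub> x \<in> carrier S"
  unfolding base_change_simps(1) by blast

lemma cls_eq:
  assumes "x \<in> carrier P" "y \<in> carrier P" "x - y \<in> J"
  shows "J +>\<^bsub>P\<^esub> x = J +>\<^bsub>P\<^esub> y"
proof -
  have "(x - y) + y \<in> J +>\<^bsub>P\<^esub> y" using assms(3) unfolding a_r_coset_def' pair_ring_simps by blast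
  then have "x \<in> J +>\<^bsub>P\<^esub> y" by simp
  then show ?thesis by (rule J.a_repr_independence'[OF _ assms(2), symmetric])
qed

lemma rels_in_J: "x \<in> tensor_rels q B \<Longrightarrow> x \<in> J"
  unfolding tensor_ideal_def using J.genideal_self[OF rels_closed] by blast

lemma base_change_ring: "ring S"
proof (rule ring_transfer[OF J.quotient_is_ring])
  show "carrier S = carrier (P Quot J)"
    by (simp only: base_change_simps(1) FactRing_def partial_object.simps
        J.carrier_quot[unfolded quot_alg_simps(1)])
qed (simp_all add: base_change_simps FactRing_def)

lemma tens_closed: "b \<in> carrier B \<Longrightarrow> tens q B b c \<in> carrier S"
  unfolding tens_def by (rule cls_closed[OF single_closed])

lemma tens_mult:
  "b \<in> carrier B \<Longrightarrow> b' \<in> carrier B \<Longrightarrow> tens q B b c \<otimes>\<^bsub>S\<^esub> tens q B b' c' = tens q B (b \<otimes>\<^bsub>B\<^esub> b') (c * c')"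
  unfolding tens_def by (simp add: cls_mult single_closed pair_mult)

lemma tens_one: "tens q B \<one>\<^bsub>B\<^esub> 1 = \<one>\<^bsub>S\<^esub>"
  by (simp add: tens_def base_change_simps pair_ring_simps)

lemma tens_add_left:
  assumes "b \<in> carrier B" "b' \<in> carrier B"
  shows "tens q B (b \<oplus>\<^bsub>B\<^esub> b') c = tens q B b c \<oplus>\<^bsub>S\<^esub> tens q B b' c"
  unfolding tens_def cls_add[OF single_closed[OF assms(1)] single_closed[OF assms(2)]]
proof (rule cls_eq)
  show "single (b \<oplus>\<^bsub>B\<^esub> b', c) 1 - (single (b, c) 1 + single (b', c) 1) \<in> J"
    using rels_in_J[OF tensor_rels.add_l[OF assms, of c q]] by (simp add: algebra_simps)
  show "single (b, c) 1 + single (b', c) 1 \<in> carrier P"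
    using J.add.m_closed[OF single_closed[OF assms(1)] single_closed[OF assms(2)]] by (simp add: pair_ring_simps(2))
qed (use assms in \<open>auto intro: single_closed\<close>)

lemma tens_add_right:
  assumes "b \<in> carrier B"
  shows "tens q B b (c + c') = tens q B b c \<oplus>\<^bsub>S\<^esub> tens q B b c'"
  unfolding tens_def cls_add[OF single_closed[OF assms] single_closed[OF assms]]
proof (rule cls_eq)
  show "single (b, c + c') 1 - (single (b, c) 1 + single (b, c') 1) \<in> J"
    using rels_in_J[OF tensor_rels.add_r[OF assms, of c c' q]] by (simp add: algebra_simps)
  show "single (b, c) 1 + single (b, c') 1 \<in> carrier P"
    using J.add.m_closed[OF single_closed[OF assms] single_closed[OF assms]] by (simp add: pair_ring_simps(2))
qed (use assms in \<open>auto intro: single_closed\<close>)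

lemma tens_balance:
  assumes "b \<in> carrier B"
  shows "tens q B (laurent vv p k \<odot>\<^bsub>B\<^esub> b) c = tens q B b (laurent q p k * c)"
  unfolding tens_def
  by (rule cls_eq[OF single_closed[OF laurent_closed[OF assms]] single_closed[OF assms]
        rels_in_J[OF tensor_rels.balance[OF assms]]])

text \<open>The elements $1 \otimes c$ are central; this makes the base change an algebra over \<open>F\<close>.\<close>

lemma scalar_central:
  assumes x: "x \<in> carrier P"
  shows "single (\<one>\<^bsub>B\<^esub>, c) 1 \<otimes>\<^bsub>P\<^esub> x = x \<otimes>\<^bsub>P\<^esub> single (\<one>\<^bsub>B\<^esub>, c) 1"
proof -
  have "supp x \<subseteq> carrier B \<times> UNIV" using x by (simp add: pair_ring_simps)
  then show ?thesis
  proof (induction x rule: pm_induct)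
    case zero
    show ?case by (simp add: pair_ring_def)
  next
    case (single x a)
    then show ?case by (cases x) (simp add: pair_mult mult.commute)
  next
    case (add f g)
    then show ?case by (simp add: pair_ring_def conv_add_left conv_add_right)
  qed
qed

lemma base_change_assoc_alg: "assoc_alg S"
proof -
  interpret S: ring S by (rule base_change_ring)
  have sm: "c \<odot>\<^bsub>S\<^esub> X = tens q B \<one>\<^bsub>B\<^esub> c \<otimes>\<^bsub>S\<^esub> X" for c X by (simp add: base_change_simps)
  have tc: "tens q B \<one>\<^bsub>B\<^esub> c \<in> carrier S" for c by (rule tens_closed) simp
  have comm: "tens q B \<one>\<^bsub>B\<^esub> c \<otimes>\<^bsub>S\<^esub> X = X \<otimes>\<^bsub>S\<^esub> tens q B \<one>\<^bsub>B\<^esub> c" if "X \<in> carrier S" for c X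
  proof -
    have "\<exists>x. X = J +>\<^bsub>P\<^esub> x \<and> x \<in> carrier P"
      using that unfolding base_change_simps(1) mem_Collect_eq .
    then obtain x where x: "X = J +>\<^bsub>P\<^esub> x" "x \<in> carrier P" by (elim exE conjE)
    show ?thesis
      unfolding x(1) tens_def cls_mult[OF single_closed[OF B.one_closed] x(2)]
        cls_mult[OF x(2) single_closed[OF B.one_closed]] scalar_central[OF x(2)] ..
  qed
  show ?thesis
  proof (intro assoc_alg.intro base_change_ring assoc_alg_axioms.intro; unfold sm)
    fix X Y c d assume X: "X \<in> carrier S"
    show "tens q B \<one>\<^bsub>B\<^esub> c \<otimes>\<^bsub>S\<^esub> X \<in> carrier S" using X tc by simp
    show "tens q B \<one>\<^bsub>B\<^esub> (c + d) \<otimes>\<^bsub>S\<^esub> X = tens q B \<one>\<^bsub>B\<^esub> c \<otimes>\<^bsub>S\<^esub> X \<oplus>\<^bsub>S\<^esub> tens q B \<one>\<^bsub>B\<^esub> d \<otimes>\<^bsub>S\<^esub> X"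
      using X tc by (simp add: tens_add_right S.l_distr)
    have "tens q B \<one>\<^bsub>B\<^esub> (c * d) = tens q B \<one>\<^bsub>B\<^esub> c \<otimes>\<^bsub>S\<^esub> tens q B \<one>\<^bsub>B\<^esub> d" by (simp add: tens_mult)
    then show "tens q B \<one>\<^bsub>B\<^esub> (c * d) \<otimes>\<^bsub>S\<^esub> X = tens q B \<one>\<^bsub>B\<^esub> c \<otimes>\<^bsub>S\<^esub> (tens q B \<one>\<^bsub>B\<^esub> d \<otimes>\<^bsub>S\<^esub> X)"
      using X tc by (simp add: S.m_assoc)
    show "tens q B \<one>\<^bsub>B\<^esub> 1 \<otimes>\<^bsub>S\<^esub> X = X" using X by (simp add: tens_one)
    assume Y: "Y \<in> carrier S"
    show "tens q B \<one>\<^bsub>B\<^esub> c \<otimes>\<^bsub>S\<^esub> (X \<oplus>\<^bsub>S\<^esub> Y) = tens q B \<one>\<^bsub>B\<^esub> c \<otimes>\<^bsub>S\<^esub> X \<oplus>\<^bsub>S\<^esub> tens q B \<one>\<^bsub>B\<^esub> c \<otimes>\<^bsub>S\<^esub> Y"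
      using X Y tc by (simp add: S.r_distr)
    show "tens q B \<one>\<^bsub>B\<^esub> c \<otimes>\<^bsub>S\<^esub> X \<otimes>\<^bsub>S\<^esub> Y = tens q B \<one>\<^bsub>B\<^esub> c \<otimes>\<^bsub>S\<^esub> (X \<otimes>\<^bsub>S\<^esub> Y)"
      using X Y tc by (simp add: S.m_assoc)
    show "X \<otimes>\<^bsub>S\<^esub> (tens q B \<one>\<^bsub>B\<^esub> c \<otimes>\<^bsub>S\<^esub> Y) = tens q B \<one>\<^bsub>B\<^esub> c \<otimes>\<^bsub>S\<^esub> (X \<otimes>\<^bsub>S\<^esub> Y)"
      using X Y tc by (metis S.m_assoc comm)
  qed
qed

lemma spec_laurent:
  assumes "b \<in> carrier B"
  shows "tens q B (laurent vv p k \<odot>\<^bsub>B\<^esub> b) 1 = laurent q p k \<odot>\<^bsub>S\<^esub> tens q B b 1"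
proof -
  have "laurent q p k \<odot>\<^bsub>S\<^esub> tens q B b 1 = tens q B \<one>\<^bsub>B\<^esub> (laurent q p k) \<otimes>\<^bsub>S\<^esub> tens q B b 1"
    by (simp add: base_change_simps)
  then show ?thesis using assms by (simp add: tens_mult tens_balance)
qed

lemma spec_minus:
  assumes "b \<in> carrier B" "b' \<in> carrier B"
  shows "tens q B (b \<ominus>\<^bsub>B\<^esub> b') 1 = tens q B b 1 \<ominus>\<^bsub>S\<^esub> tens q B b' 1"
proof -
  interpret S: ring S by (rule base_change_ring)
  have "tens q B (b \<ominus>\<^bsub>B\<^esub> b') 1 \<oplus>\<^bsub>S\<^esub> tens q B b' 1 = tens q B b 1"
    using assms by (simp flip: tens_add_left add: B.minus_eq B.a_assoc B.l_neg)
  then have "tens q B b 1 \<ominus>\<^bsub>S\<^esub> tens q B b' 1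
      = tens q B (b \<ominus>\<^bsub>B\<^esub> b') 1 \<oplus>\<^bsub>S\<^esub> tens q B b' 1 \<ominus>\<^bsub>S\<^esub> tens q B b' 1" by simp
  also have "\<dots> = tens q B (b \<ominus>\<^bsub>B\<^esub> b') 1"
    using assms tens_closed[of _ 1] by (simp add: S.minus_eq S.a_assoc S.r_neg)
  finally show ?thesis by simp
qed

end

section \<open>The indeterminate and quantum integers\<close>

lemma vv_power: "vv ^ k = Fract ([:0, 1:] ^ k) 1"
  by (induction k) (simp_all add: vv_def One_fract_def)

lemma vv_nonzero [simp]: "vv \<noteq> 0"
  by (simp add: vv_def eq_fract Zero_fract_def)

text \<open>The indeterminate is not a root of unity.\<close>

lemma vv_power_eq_1: "vv ^ k = 1 \<Longrightarrow> k = 0"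
proof -
  assume "vv ^ k = 1"
  then have "[:0, 1::rat:] ^ k = 1" by (simp add: vv_power One_fract_def eq_fract)
  then have "degree ([:0, 1::rat:] ^ k) = 0" by simp
  then show "k = 0" by (simp add: degree_power_eq)
qed

lemma vv_powi_eq_1: "vv powi k = 1 \<Longrightarrow> k = 0"
  by (cases k rule: int_cases2) (auto dest: vv_power_eq_1 simp: power_int_minus)

lemma vsub_nonzero [simp]: "vsub m b \<noteq> 0"
  by (simp add: vsub_def)

lemma vsub_powi: "vsub m b powi k = vv powi (sg m b * k)"
  by (simp add: vsub_def power_int_mult)

lemma vsub_powi_eq_1: "vsub m b powi k = 1 \<Longrightarrow> k = 0"
  unfolding vsub_powi by (drule vv_powi_eq_1) (simp add: sg_def split: if_splits)

lemma vsub_powi_inj: "vsub m b powi j = vsub m b powi k \<Longrightarrow> j = k"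
  using vsub_powi_eq_1[of m b "j - k"] by (simp add: power_int_diff)

text \<open>The quantum integer $[d]$ in the variable \<open>u\<close>.\<close>

definition qint :: "qv \<Rightarrow> int \<Rightarrow> qv" where
  "qint u d = (u powi d - u powi (- d)) / (u - inverse u)"

text \<open>The quantum integer $[2]$, which is the same for $\upsilon$ and $\upsilon^{-1}$.\<close>

abbreviation two_q :: qv where "two_q \<equiv> vv + inverse vv"

lemma vsub_diff_nonzero: "vsub m b - inverse (vsub m b) \<noteq> 0"
proof
  assume "vsub m b - inverse (vsub m b) = 0"
  then have "vsub m b powi 1 = vsub m b powi (-1)" by simp
  then show False using vsub_powi_inj by fastforce
qed

lemma qint_simps [simp]:
  "qint u 0 = 0"
  "qint (vsub m b) 1 = 1"
  "qint u (- d) = - qint u d"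
  "qint (vsub m b) 2 = two_q"
proof -
  show "qint u 0 = 0" by (simp add: qint_def)
  show "qint (vsub m b) 1 = 1" using vsub_diff_nonzero[of m b] by (simp add: qint_def)
  show "qint u (- d) = - qint u d" unfolding qint_def by (simp add: minus_divide_left)
  let ?u = "vsub m b"
  have "?u powi 2 - ?u powi (-2) = (?u - inverse ?u) * (?u + inverse ?u)"
    by (simp add: power_int_minus power2_eq_square algebra_simps)
  then have "qint ?u 2 = ?u + inverse ?u" using vsub_diff_nonzero[of m b] by (simp add: qint_def)
  also have "\<dots> = two_q" by (simp add: vsub_def sg_def power_int_minus add.commute)
  finally show "qint ?u 2 = two_q" .
qed

section \<open>Weight spaces\<close>

text \<open>An algebra over $\mathbb Q(\upsilon)$ with elements \<open>E\<close>, \<open>F\<close>, \<open>K\<close>, \<open>Ki\<close> that satisfy those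
  relations of the \<open>q\<close>-Schur superalgebra that are used below; the Serre relations for \<open>F\<close> and the
  relations special to the odd generators other than $[E_m,F_m]$ are not among them.\<close>

locale qschur_system = assoc_alg A for A :: "(qv, 'a) module" (structure) +
  fixes m n r :: nat and E F K Ki :: "nat \<Rightarrow> 'a"
  assumes E_closed [simp]: "a \<in> {1..<m+n} \<Longrightarrow> E a \<in> carrier A"
    and F_closed [simp]: "a \<in> {1..<m+n} \<Longrightarrow> F a \<in> carrier A"
    and K_closed [simp]: "b \<in> {1..m+n} \<Longrightarrow> K b \<in> carrier A"
    and Ki_closed [simp]: "b \<in> {1..m+n} \<Longrightarrow> Ki b \<in> carrier A"
    and KK: "b \<in> {1..m+n} \<Longrightarrow> c \<in> {1..m+n} \<Longrightarrow> K b \<otimes> K c = K c \<otimes> K b"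
    and KiK: "b \<in> {1..m+n} \<Longrightarrow> Ki b \<otimes> K b = \<one>"
    and KE: "b \<in> {1..m+n} \<Longrightarrow> a \<in> {1..<m+n} \<Longrightarrow> K b \<otimes> E a = (vv powi eps_alpha m b a) \<odot> (E a \<otimes> K b)"
    and KF: "b \<in> {1..m+n} \<Longrightarrow> a \<in> {1..<m+n} \<Longrightarrow> K b \<otimes> F a = (vv powi (- eps_alpha m b a)) \<odot> (F a \<otimes> K b)"
    and EF_comm: "a \<in> {1..<m+n} \<Longrightarrow> c \<in> {1..<m+n} \<Longrightarrow> a \<noteq> c \<Longrightarrow> E a \<otimes> F c = F c \<otimes> E a"
    and EF_even: "a \<in> {1..<m+n} \<Longrightarrow> a \<noteq> m \<Longrightarrow> E a \<otimes> F a \<ominus> F a \<otimes> E a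
      = (1 / (vsub m a - inverse (vsub m a))) \<odot> (K a \<otimes> Ki (a+1) \<ominus> Ki a \<otimes> K (a+1))"
    and EF_odd: "m \<in> {1..<m+n} \<Longrightarrow> E m \<otimes> F m \<oplus> F m \<otimes> E m
      = (1 / (vsub m m - inverse (vsub m m))) \<odot> (K m \<otimes> Ki (m+1) \<ominus> Ki m \<otimes> K (m+1))"
    and EE_far: "a \<in> {1..<m+n} \<Longrightarrow> c \<in> {1..<m+n} \<Longrightarrow> \<bar>int a - int c\<bar> > 1 \<Longrightarrow> E a \<otimes> E c = E c \<otimes> E a"
    and FF_far: "a \<in> {1..<m+n} \<Longrightarrow> c \<in> {1..<m+n} \<Longrightarrow> \<bar>int a - int c\<bar> > 1 \<Longrightarrow> F a \<otimes> F c = F c \<otimes> F a"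
    and Serre: "a \<in> {1..<m+n} \<Longrightarrow> c \<in> {1..<m+n} \<Longrightarrow> a \<noteq> m \<Longrightarrow> \<bar>int a - int c\<bar> = 1 \<Longrightarrow>
      E a \<otimes> E a \<otimes> E c \<oplus> E c \<otimes> E a \<otimes> E a = (vsub m a + inverse (vsub m a)) \<odot> (E a \<otimes> E c \<otimes> E a)"
    and total: "lprod A (map K [1..<m+1] @ map Ki [m+1..<m+n+1]) = vv ^ r \<odot> \<one>"
    and each: "b \<in> {1..m+n} \<Longrightarrow> lprod A (map (\<lambda>s. K b \<ominus> vsub m b ^ s \<odot> \<one>) [0..<r+1]) = \<zero>"
begin

text \<open>The left weight space of weight \<open>l\<close>. Weights have integer entries; a weight with a negative
  entry, or whose entries do not add up to \<open>r\<close>, has weight space 0. Only the entries at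
  $1,\dots,m+n$ matter.\<close>

definition wt :: "(nat \<Rightarrow> int) \<Rightarrow> 'a set" where
  "wt l = {x \<in> carrier A. \<forall>b\<in>{1..m+n}. K b \<otimes> x = vsub m b powi l b \<odot> x}"

text \<open>The weights $l + \alpha_a$ and $l - \alpha_a$.\<close>

definition up :: "nat \<Rightarrow> (nat \<Rightarrow> int) \<Rightarrow> nat \<Rightarrow> int" where
  "up a l = l(a := l a + 1, a + 1 := l (a + 1) - 1)"

definition down :: "nat \<Rightarrow> (nat \<Rightarrow> int) \<Rightarrow> nat \<Rightarrow> int" where
  "down a l = l(a := l a - 1, a + 1 := l (a + 1) + 1)"

lemma wt_carrier: "x \<in> wt l \<Longrightarrow> x \<in> carrier A"
  by (simp add: wt_def)

lemma wt_K: "x \<in> wt l \<Longrightarrow> b \<in> {1..m+n} \<Longrightarrow> K b \<otimes> x = vsub m b powi l b \<odot> x"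
  by (simp add: wt_def)

lemma wt_cong: "x \<in> wt l \<Longrightarrow> (\<And>b. b \<in> {1..m+n} \<Longrightarrow> l b = l' b) \<Longrightarrow> x \<in> wt l'"
  by (simp add: wt_def)

lemma wt_Ki:
  assumes x: "x \<in> wt l" and b: "b \<in> {1..m+n}"
  shows "Ki b \<otimes> x = vsub m b powi (- l b) \<odot> x"
proof -
  have xc: "x \<in> carrier A" by (rule wt_carrier[OF x])
  have "x = Ki b \<otimes> (K b \<otimes> x)"
    using KiK[OF b] xc K_closed[OF b] Ki_closed[OF b] by (simp flip: m_assoc)
  also have "\<dots> = vsub m b powi l b \<odot> (Ki b \<otimes> x)"
    using wt_K[OF x b] xc Ki_closed[OF b] by (simp add: smult_mult_r)
  finally have "vsub m b powi (- l b) \<odot> x = vsub m b powi (- l b) \<odot> (vsub m b powi l b \<odot> (Ki b \<otimes> x))"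
    by simp
  also have "\<dots> = Ki b \<otimes> x"
    using xc Ki_closed[OF b] by (simp add: power_int_minus flip: smult_assoc)
  finally show ?thesis by simp
qed

lemma eps_alpha_eq:
  "eps_alpha m b a = sg m b * ((if b = a then 1 else 0) - (if b = a + 1 then 1 else 0))"
  by (simp add: eps_alpha_def eps_form_def)

lemma E_wt:
  assumes x: "x \<in> wt l" and a: "a \<in> {1..<m+n}"
  shows "E a \<otimes> x \<in> wt (up a l)"
proof -
  have xc: "x \<in> carrier A" by (rule wt_carrier[OF x])
  have "K b \<otimes> (E a \<otimes> x) = vsub m b powi up a l b \<odot> (E a \<otimes> x)" if b: "b \<in> {1..m+n}" for b
  proof -
    have "K b \<otimes> (E a \<otimes> x) = (K b \<otimes> E a) \<otimes> x"
      using xc E_closed[OF a] K_closed[OF b] by (simp only: m_assoc)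
    also have "\<dots> = vv powi eps_alpha m b a \<odot> (E a \<otimes> (K b \<otimes> x))"
      using xc E_closed[OF a] K_closed[OF b] by (simp add: KE[OF b a] smult_mult_l m_assoc del: atLeastLessThan_iff)
    also have "\<dots> = (vv powi eps_alpha m b a * vsub m b powi l b) \<odot> (E a \<otimes> x)"
      using xc E_closed[OF a] by (simp add: wt_K[OF x b] smult_mult_r smult_assoc)
    also have "vv powi eps_alpha m b a * vsub m b powi l b = vsub m b powi up a l b"
      unfolding vsub_powi eps_alpha_eq up_def
      by (simp flip: power_int_add add: algebra_simps)
    finally show ?thesis .
  qed
  then show ?thesis using xc E_closed[OF a] by (simp add: wt_def)
qed

lemma F_wt:
  assumes x: "x \<in> wt l" and a: "a \<in> {1..<m+n}"
  shows "F a \<otimes> x \<in> wt (down a l)"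
proof -
  have xc: "x \<in> carrier A" by (rule wt_carrier[OF x])
  have "K b \<otimes> (F a \<otimes> x) = vsub m b powi down a l b \<odot> (F a \<otimes> x)" if b: "b \<in> {1..m+n}" for b
  proof -
    have "K b \<otimes> (F a \<otimes> x) = (K b \<otimes> F a) \<otimes> x"
      using xc F_closed[OF a] K_closed[OF b] by (simp only: m_assoc)
    also have "\<dots> = vv powi (- eps_alpha m b a) \<odot> (F a \<otimes> (K b \<otimes> x))"
      using xc F_closed[OF a] K_closed[OF b] by (simp add: KF[OF b a] smult_mult_l m_assoc del: atLeastLessThan_iff)
    also have "\<dots> = (vv powi (- eps_alpha m b a) * vsub m b powi l b) \<odot> (F a \<otimes> x)"
      using xc F_closed[OF a] by (simp add: wt_K[OF x b] smult_mult_r smult_assoc)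
    also have "vv powi (- eps_alpha m b a) * vsub m b powi l b = vsub m b powi down a l b"
      unfolding vsub_powi eps_alpha_eq down_def
      by (simp flip: power_int_add add: algebra_simps)
    finally show ?thesis .
  qed
  then show ?thesis using xc F_closed[OF a] by (simp add: wt_def)
qed

lemma lprod_eigen:
  assumes "x \<in> carrier A" "\<And>i. i \<in> set is \<Longrightarrow> f i \<in> carrier A" "\<And>i. i \<in> set is \<Longrightarrow> f i \<otimes> x = c i \<odot> x"
  shows "lprod A (map f is) \<otimes> x = prod_list (map c is) \<odot> x"
  using assms(2,3)
proof (induction "is")
  case Nil
  then show ?case using assms(1) by simp
next
  case (Cons i "is")
  have "lprod A (map f is) \<in> carrier A" by (rule lprod_closed) (use Cons in auto)
  then show ?case
    using Cons assms(1) by (simp add: m_assoc smult_mult_r mult.commute[of "c i"] flip: smult_assoc)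
qed

lemma smult_cancel: "c \<odot> x = \<zero> \<Longrightarrow> c \<noteq> 0 \<Longrightarrow> x \<in> carrier A \<Longrightarrow> x = \<zero>"
  by (metis left_inverse smult_assoc smult_one smult_zero_right)

text \<open>Nonzero weight spaces have weights that are compositions of \<open>r\<close>: the relation
  $\prod_s (K_b - \upsilon_b^s) = 0$ bounds the entries from below, and the relation for the product of
  all $K_b^{\pm1}$ determines their sum.\<close>

lemma wt_negative:
  assumes x: "x \<in> wt l" and b: "b \<in> {1..m+n}" and neg: "l b < 0"
  shows "x = \<zero>"
proof -
  have xc: "x \<in> carrier A" by (rule wt_carrier[OF x])
  have kc: "K b \<ominus> vsub m b ^ s \<odot> \<one> \<in> carrier A" for s using K_closed[OF b] by simp
  have e: "(K b \<ominus> vsub m b ^ s \<odot> \<one>) \<otimes> x = (vsub m b powi l b - vsub m b ^ s) \<odot> x" for s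
    using xc K_closed[OF b] wt_K[OF x b]
    by (simp add: minus_eq l_distr l_minus smult_mult_l smult_l_diff)
  have "\<zero> = prod_list (map (\<lambda>s. vsub m b powi l b - vsub m b ^ s) [0..<r+1]) \<odot> x"
    using lprod_eigen[OF xc, where f = "\<lambda>s. K b \<ominus> vsub m b ^ s \<odot> \<one>", OF kc e, of "[0..<r+1]"] each[OF b] xc
    by (simp del: upt_Suc)
  moreover have "prod_list (map (\<lambda>s. vsub m b powi l b - vsub m b ^ s) [0..<r+1]) \<noteq> 0"
  proof -
    have "vsub m b powi l b - vsub m b ^ s \<noteq> 0" for s
      using neg vsub_powi_inj[of m b "l b" "int s"] by auto
    then show ?thesis by (auto simp: prod_list_zero_iff simp del: right_minus_eq eq_iff_diff_eq_0[symmetric])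
  qed
  ultimately show ?thesis using smult_cancel xc by metis
qed

lemma wt_total:
  assumes x: "x \<in> wt l" and s: "(\<Sum>b\<in>{1..m+n}. l b) \<noteq> int r"
  shows "x = \<zero>"
proof -
  have xc: "x \<in> carrier A" by (rule wt_carrier[OF x])
  let ?f = "\<lambda>b. if b \<le> m then K b else Ki b"
  have "map K [1..<m+1] @ map Ki [m+1..<m+n+1] = map ?f [1..<m+1] @ map ?f [m+1..<m+n+1]"
    by (auto simp del: upt_Suc)
  also have "\<dots> = map ?f [1..<m+n+1]"
    using upt_add_eq_append[of 1 "m+1" n] by (simp del: upt_Suc flip: map_append)
  finally have eq: "lprod A (map ?f [1..<m+n+1]) = vv ^ r \<odot> \<one>" using total by simp
  have "lprod A (map ?f [1..<m+n+1]) \<otimes> x = prod_list (map (\<lambda>b. vv powi l b) [1..<m+n+1]) \<odot> x"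
  proof (rule lprod_eigen[OF xc])
    fix b assume "b \<in> set [1..<m+n+1]"
    then have b: "b \<in> {1..m+n}" by auto
    show "?f b \<in> carrier A" using K_closed[OF b] Ki_closed[OF b] by simp
    show "?f b \<otimes> x = vv powi l b \<odot> x"
      using wt_K[OF x b] wt_Ki[OF x b] by (simp add: vsub_powi sg_def)
  qed
  also have "prod_list (map (\<lambda>b. vv powi l b) bs) = vv powi sum_list (map l bs)" for bs
    by (induction bs) (simp_all add: power_int_add)
  also have "sum_list (map l [1..<m+n+1]) = (\<Sum>b\<in>{1..m+n}. l b)"
    by (simp add: sum_list_distinct_conv_sum_set atLeastLessThanSuc_atLeastAtMost del: upt_Suc)
  finally have "vv ^ r \<odot> \<one> \<otimes> x = vv powi (\<Sum>b\<in>{1..m+n}. l b) \<odot> x"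
    unfolding eq .
  then have "vv ^ r \<odot> x = vv powi (\<Sum>b\<in>{1..m+n}. l b) \<odot> x"
    using xc by (simp add: smult_mult_l)
  then have "(vv ^ r - vv powi (\<Sum>b\<in>{1..m+n}. l b)) \<odot> x = \<zero>"
    using xc by (simp add: smult_l_diff diff_zero_iff)
  moreover have "vv ^ r - vv powi (\<Sum>b\<in>{1..m+n}. l b) \<noteq> 0"
  proof
    assume "vv ^ r - vv powi (\<Sum>b\<in>{1..m+n}. l b) = 0"
    then have "vv powi (int r - (\<Sum>b\<in>{1..m+n}. l b)) = 1" by (simp add: power_int_diff)
    then show False using vv_powi_eq_1 s by fastforce
  qed
  ultimately show ?thesis using smult_cancel xc by metis
qed

lemma E_kill: "x \<in> wt l \<Longrightarrow> a \<in> {1..<m+n} \<Longrightarrow> l (a + 1) \<le> 0 \<Longrightarrow> E a \<otimes> x = \<zero>"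
  by (rule wt_negative[OF E_wt, of x l a "a+1"]) (auto simp: up_def)

lemma F_kill: "x \<in> wt l \<Longrightarrow> a \<in> {1..<m+n} \<Longrightarrow> l a \<le> 0 \<Longrightarrow> F a \<otimes> x = \<zero>"
  by (rule wt_negative[OF F_wt, of x l a a]) (auto simp: down_def)

lemma K_diff_wt:
  assumes x: "x \<in> wt l" and a: "a \<in> {1..<m+n}"
  shows "((1 / (vsub m a - inverse (vsub m a))) \<odot> (K a \<otimes> Ki (a+1) \<ominus> Ki a \<otimes> K (a+1))) \<otimes> x
    = qint (vsub m a) (l a - (if a = m then - l (a+1) else l (a+1))) \<odot> x"
proof -
  have xc: "x \<in> carrier A" by (rule wt_carrier[OF x])
  have b: "a \<in> {1..m+n}" "a + 1 \<in> {1..m+n}" using a by auto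
  let ?u = "vsub m a" and ?w = "vsub m (a+1)"
  have 1: "K a \<otimes> Ki (a+1) \<otimes> x = (?u powi l a * ?w powi (- l (a+1))) \<odot> x"
    using xc wt_K[OF x b(1)] wt_Ki[OF x b(2)] K_closed[OF b(1)] Ki_closed[OF b(2)]
    by (simp add: m_assoc smult_mult_r mult.commute flip: smult_assoc)
  have 2: "Ki a \<otimes> K (a+1) \<otimes> x = (?u powi (- l a) * ?w powi l (a+1)) \<odot> x"
    using xc wt_Ki[OF x b(1)] wt_K[OF x b(2)] Ki_closed[OF b(1)] K_closed[OF b(2)]
    by (simp add: m_assoc smult_mult_r mult.commute flip: smult_assoc)
  have w: "?w = (if a = m then inverse ?u else ?u)"
    by (auto simp: vsub_def sg_def power_int_minus)
  let ?d = "l a - (if a = m then - l (a+1) else l (a+1))"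
  have 3: "?u powi l a * ?w powi (- l (a+1)) = ?u powi ?d" "?u powi (- l a) * ?w powi l (a+1) = ?u powi (- ?d)"
    unfolding w by (auto simp: power_int_inverse simp flip: power_int_minus power_int_add)
      (metis minus_diff_commute)
  have "(K a \<otimes> Ki (a+1) \<ominus> Ki a \<otimes> K (a+1)) \<otimes> x = (?u powi ?d - ?u powi (- ?d)) \<odot> x"
    using xc b 1 2 3 K_closed[OF b(1)] Ki_closed[OF b(1)] K_closed[OF b(2)] Ki_closed[OF b(2)]
    by (simp add: minus_eq l_distr l_minus smult_l_diff)
  then show ?thesis
    using xc K_closed[OF b(1)] Ki_closed[OF b(1)] K_closed[OF b(2)] Ki_closed[OF b(2)]
    by (simp add: smult_mult_l qint_def flip: smult_assoc)
qed

lemma EF_wt: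
  assumes x: "x \<in> wt l" and a: "a \<in> {1..<m+n}" and "a \<noteq> m"
  shows "E a \<otimes> (F a \<otimes> x) = F a \<otimes> (E a \<otimes> x) \<oplus> qint (vsub m a) (l a - l (a+1)) \<odot> x"
proof -
  have xc: "x \<in> carrier A" by (rule wt_carrier[OF x])
  note c = xc E_closed[OF a] F_closed[OF a]
  have "E a \<otimes> (F a \<otimes> x) \<ominus> F a \<otimes> (E a \<otimes> x) = (E a \<otimes> F a \<ominus> F a \<otimes> E a) \<otimes> x"
    using c by (simp add: minus_eq l_distr l_minus m_assoc)
  also have "\<dots> = qint (vsub m a) (l a - l (a+1)) \<odot> x"
    unfolding EF_even[OF a \<open>a \<noteq> m\<close>] K_diff_wt[OF x a] using \<open>a \<noteq> m\<close> by simp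
  finally have e: "E a \<otimes> (F a \<otimes> x) \<ominus> F a \<otimes> (E a \<otimes> x) = qint (vsub m a) (l a - l (a+1)) \<odot> x" .
  have "E a \<otimes> (F a \<otimes> x) = F a \<otimes> (E a \<otimes> x) \<oplus> (E a \<otimes> (F a \<otimes> x) \<ominus> F a \<otimes> (E a \<otimes> x))"
    using c by algebra
  then show ?thesis unfolding e .
qed

lemma EF_wt_odd:
  assumes x: "x \<in> wt l" and a: "m \<in> {1..<m+n}"
  shows "E m \<otimes> (F m \<otimes> x) \<oplus> F m \<otimes> (E m \<otimes> x) = qint (vsub m m) (l m + l (m+1)) \<odot> x"
proof -
  have xc: "x \<in> carrier A" by (rule wt_carrier[OF x])
  note c = xc E_closed[OF a] F_closed[OF a]
  have "E m \<otimes> (F m \<otimes> x) \<oplus> F m \<otimes> (E m \<otimes> x) = (E m \<otimes> F m \<oplus> F m \<otimes> E m) \<otimes> x"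
    using c by (simp add: l_distr m_assoc)
  also have "\<dots> = qint (vsub m m) (l m + l (m+1)) \<odot> x"
    unfolding EF_odd[OF a] K_diff_wt[OF x a] by simp
  finally show ?thesis .
qed

end

context qschur_system
begin

text \<open>The action of $E_a F_a$ and $F_a E_a$ on weight vectors with small entries at $a$, $a+1$.\<close>

lemma EF_10:
  assumes x: "x \<in> wt l" and a: "a \<in> {1..<m+n}" and l: "l a = 1" "l (a+1) = 0"
  shows "E a \<otimes> (F a \<otimes> x) = x"
proof -
  have xc: "x \<in> carrier A" by (rule wt_carrier[OF x])
  have z: "E a \<otimes> x = \<zero>" by (rule E_kill[OF x a]) (use l in simp)
  show ?thesis
  proof (cases "a = m")
    case True
    show ?thesis
      using EF_wt_odd[OF x] a z l xc F_closed[OF a] E_closed[OF a] unfolding True by simp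
  next
    case False
    show ?thesis using EF_wt[OF x a False] z l xc F_closed[OF a] by simp
  qed
qed

lemma FE_01:
  assumes x: "x \<in> wt l" and a: "a \<in> {1..<m+n}" and l: "l a = 0" "l (a+1) = 1"
  shows "F a \<otimes> (E a \<otimes> x) = x"
proof -
  have xc: "x \<in> carrier A" by (rule wt_carrier[OF x])
  have z: "F a \<otimes> x = \<zero>" by (rule F_kill[OF x a]) (use l in simp)
  show ?thesis
  proof (cases "a = m")
    case True
    show ?thesis
      using EF_wt_odd[OF x] a z l xc F_closed[OF a] E_closed[OF a] unfolding True by simp
  next
    case False
    have "\<zero> = F a \<otimes> (E a \<otimes> x) \<ominus> x"
      using EF_wt[OF x a False] z l xc F_closed[OF a] E_closed[OF a] qint_simps(3)[of "vsub m a" 1]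
      by (simp add: smult_minus_left minus_eq del: qint_simps(3))
    then show ?thesis
      using xc F_closed[OF a] E_closed[OF a] diff_zero_iff[of "F a \<otimes> (E a \<otimes> x)" x] by simp
  qed
qed

lemma EF_11:
  assumes x: "x \<in> wt l" and a: "a \<in> {1..<m+n}" and "a \<noteq> m" and l: "l a = l (a+1)"
  shows "E a \<otimes> (F a \<otimes> x) = F a \<otimes> (E a \<otimes> x)"
  using EF_wt[OF x a \<open>a \<noteq> m\<close>] l wt_carrier[OF x] F_closed[OF a] E_closed[OF a] by simp

lemma EF_11_odd:
  assumes x: "x \<in> wt l" and a: "m \<in> {1..<m+n}" and l: "l m = 1" "l (m+1) = 1"
  shows "E m \<otimes> (F m \<otimes> x) = two_q \<odot> x \<ominus> F m \<otimes> (E m \<otimes> x)"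
proof -
  note c = wt_carrier[OF x] F_closed[OF a] E_closed[OF a]
  have "E m \<otimes> (F m \<otimes> x) = (E m \<otimes> (F m \<otimes> x) \<oplus> F m \<otimes> (E m \<otimes> x)) \<ominus> F m \<otimes> (E m \<otimes> x)"
    using c by algebra
  then show ?thesis using EF_wt_odd[OF x a] l by simp
qed

lemma EF_21:
  assumes x: "x \<in> wt l" and a: "a \<in> {1..<m+n}" and "a \<noteq> m" and l: "l a = 2" "l (a+1) = 1"
  shows "E a \<otimes> (F a \<otimes> x) = x \<oplus> F a \<otimes> (E a \<otimes> x)"
  using EF_wt[OF x a \<open>a \<noteq> m\<close>] l wt_carrier[OF x] F_closed[OF a] E_closed[OF a] by (simp add: a_comm)

lemma EF_20:
  assumes x: "x \<in> wt l" and a: "a \<in> {1..<m+n}" and "a \<noteq> m" and l: "l a = 2" "l (a+1) = 0"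
  shows "E a \<otimes> (F a \<otimes> x) = two_q \<odot> x"
proof -
  have z: "E a \<otimes> x = \<zero>" by (rule E_kill[OF x a]) (use l in simp)
  show ?thesis
    using EF_wt[OF x a \<open>a \<noteq> m\<close>] l z wt_carrier[OF x] F_closed[OF a] E_closed[OF a] by simp
qed

lemma FE_02:
  assumes x: "x \<in> wt l" and a: "a \<in> {1..<m+n}" and "a \<noteq> m" and l: "l a = 0" "l (a+1) = 2"
  shows "F a \<otimes> (E a \<otimes> x) = two_q \<odot> x"
proof -
  note c = wt_carrier[OF x] F_closed[OF a] E_closed[OF a]
  have z: "F a \<otimes> x = \<zero>" by (rule F_kill[OF x a]) (use l in simp)
  have q: "qint (vsub m a) (l a - l (a+1)) = - two_q"
    using l qint_simps(3)[of "vsub m a" 2] by simp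
  have "\<zero> = F a \<otimes> (E a \<otimes> x) \<oplus> (- two_q) \<odot> x"
    using EF_wt[OF x a \<open>a \<noteq> m\<close>] z c unfolding q by simp
  then have "\<zero> = F a \<otimes> (E a \<otimes> x) \<ominus> two_q \<odot> x"
    unfolding smult_minus_left[OF c(1)] minus_eq .
  then show ?thesis using c diff_zero_iff[of "F a \<otimes> (E a \<otimes> x)" "two_q \<odot> x"] by simp
qed

lemma EF_swap:
  assumes "x \<in> carrier A" "a \<in> {1..<m+n}" "c \<in> {1..<m+n}" "a \<noteq> c"
  shows "E a \<otimes> (F c \<otimes> x) = F c \<otimes> (E a \<otimes> x)"
proof -
  note cl = assms(1) E_closed[OF assms(2)] F_closed[OF assms(3)]
  show ?thesis using EF_comm[OF assms(2-4)] cl by (metis m_assoc)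
qed

lemma FF_swap:
  assumes "x \<in> carrier A" "a \<in> {1..<m+n}" "c \<in> {1..<m+n}" "\<bar>int a - int c\<bar> > 1"
  shows "F a \<otimes> (F c \<otimes> x) = F c \<otimes> (F a \<otimes> x)"
proof -
  note cl = assms(1) F_closed[OF assms(2)] F_closed[OF assms(3)]
  show ?thesis using FF_far[OF assms(2-4)] cl by (metis m_assoc)
qed

lemma EE_swap:
  assumes "x \<in> carrier A" "a \<in> {1..<m+n}" "c \<in> {1..<m+n}" "\<bar>int a - int c\<bar> > 1"
  shows "E a \<otimes> (E c \<otimes> x) = E c \<otimes> (E a \<otimes> x)"
proof -
  note cl = assms(1) E_closed[OF assms(2)] E_closed[OF assms(3)]
  show ?thesis using EE_far[OF assms(2-4)] cl by (metis m_assoc)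
qed

lemma Serre_act:
  assumes "x \<in> carrier A" "a \<in> {1..<m+n}" "c \<in> {1..<m+n}" "a \<noteq> m" "\<bar>int a - int c\<bar> = 1"
  shows "two_q \<odot> (E a \<otimes> (E c \<otimes> (E a \<otimes> x))) = E a \<otimes> (E a \<otimes> (E c \<otimes> x)) \<oplus> E c \<otimes> (E a \<otimes> (E a \<otimes> x))"
proof -
  note cl = assms(1) E_closed[OF assms(2)] E_closed[OF assms(3)]
  have t: "vsub m a + inverse (vsub m a) = two_q"
    by (simp add: vsub_def sg_def power_int_minus add.commute)
  have "E a \<otimes> (E a \<otimes> (E c \<otimes> x)) \<oplus> E c \<otimes> (E a \<otimes> (E a \<otimes> x)) = (E a \<otimes> E a \<otimes> E c \<oplus> E c \<otimes> E a \<otimes> E a) \<otimes> x"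
    using cl by (simp add: l_distr m_assoc)
  also have "\<dots> = two_q \<odot> (E a \<otimes> (E c \<otimes> (E a \<otimes> x)))"
    unfolding Serre[OF assms(2-5)] t using cl by (simp add: smult_mult_l m_assoc)
  finally show ?thesis by simp
qed

section \<open>Hecke relations on weight vectors\<close>

text \<open>For $A = E_aF_a$ these are the relations $A^2 = [2]A$, and, with $A' = E_{a+1}F_{a+1}$,
  $AA'A = A + Y$ and $A'AA' = A' + Y$ with the same $Y = F_{a+1}E_aF_aE_{a+1}$, on vectors whose
  weight has entries 1 at the places involved.\<close>

lemma quad_rel:
  assumes x: "x \<in> wt l" and a: "a \<in> {1..<m+n}" and "a \<noteq> m" and l: "l a = 1" "l (a+1) = 1"
  shows "E a \<otimes> (F a \<otimes> (E a \<otimes> (F a \<otimes> x))) = two_q \<odot> (E a \<otimes> (F a \<otimes> x))"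
proof -
  have "F a \<otimes> (E a \<otimes> (F a \<otimes> x)) = two_q \<odot> (F a \<otimes> x)"
    by (rule FE_02[OF F_wt[OF x a] a \<open>a \<noteq> m\<close>]) (use l in \<open>simp_all add: down_def\<close>)
  then show ?thesis
    using wt_carrier[OF x] F_closed[OF a] E_closed[OF a] by (simp add: smult_mult_r)
qed

lemma two_q_nonzero: "two_q \<noteq> 0"
proof
  assume "two_q = 0"
  then have "vv * vv = - 1" by (simp add: field_simps add_eq_0_iff)
  then have "vv ^ 4 = 1" by (simp add: power4_eq_xxxx)
  then show False using vv_power_eq_1 by fastforce
qed

lemma two_q_cancel:
  assumes "two_q \<odot> x = two_q \<odot> y" "x \<in> carrier A" "y \<in> carrier A"
  shows "x = y"
proof -
  have "two_q \<odot> (x \<ominus> y) = \<zero>" using assms by (simp add: smult_r_diff diff_zero_iff)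
  then have "x \<ominus> y = \<zero>" using smult_cancel two_q_nonzero assms by blast
  then show ?thesis using assms diff_zero_iff by blast
qed

lemma cubic_rel1:
  assumes x: "x \<in> wt l" and a: "a \<in> {1..<m+n}" "a + 1 \<in> {1..<m+n}" and m: "a \<noteq> m" "a + 1 \<noteq> m"
    and l: "l a = 1" "l (a+1) = 1" "l (a+2) = 1"
  shows "E a \<otimes> (F a \<otimes> (E (a+1) \<otimes> (F (a+1) \<otimes> (E a \<otimes> (F a \<otimes> x)))))
    = E a \<otimes> (F a \<otimes> x) \<oplus> F (a+1) \<otimes> (E a \<otimes> (F a \<otimes> (E (a+1) \<otimes> x)))"
proof -
  note ac = E_closed[OF a(1)] F_closed[OF a(1)] E_closed[OF a(2)] F_closed[OF a(2)]
  let ?y = "F a \<otimes> x"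
  let ?z = "F (a+1) \<otimes> ?y"
  let ?w = "E (a+1) \<otimes> ?z"
  note xc = wt_carrier[OF x]
  have y: "?y \<in> wt (down a l)" by (rule F_wt[OF x a(1)])
  have z: "?z \<in> wt (down (a+1) (down a l))" by (rule F_wt[OF y a(2)])
  have w: "?w \<in> wt (up (a+1) (down (a+1) (down a l)))" by (rule E_wt[OF z a(2)])
  have yc: "?y \<in> carrier A" and zc: "?z \<in> carrier A" and wc: "?w \<in> carrier A"
    using y z w by (blast intro: wt_carrier)+
  have 1: "F (a+1) \<otimes> (E a \<otimes> ?y) = E a \<otimes> ?z"
    by (rule EF_swap[symmetric]) (use a yc in auto)
  have Ez: "E a \<otimes> ?z \<in> wt (up a (down (a+1) (down a l)))" by (rule E_wt[OF z a(1)])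
  have t: "E (a+1) \<otimes> (E a \<otimes> ?z) \<in> wt (up (a+1) (up a (down (a+1) (down a l))))"
    by (rule E_wt[OF Ez a(2)])
  have 2: "E a \<otimes> (F a \<otimes> (E (a+1) \<otimes> (E a \<otimes> ?z))) = F a \<otimes> (E a \<otimes> (E (a+1) \<otimes> (E a \<otimes> ?z)))"
    by (rule EF_11[OF t a(1) m(1)]) (use l in \<open>simp add: up_def down_def\<close>)
  \<comment> \<open>One of the three terms of the Serre relation vanishes, for reasons of weight.\<close>
  have 3: "E a \<otimes> (E a \<otimes> ?z) = \<zero>"
    by (rule E_kill[OF Ez a(1)]) (use l in \<open>simp add: up_def down_def\<close>)
  have 4: "two_q \<odot> (E a \<otimes> (E (a+1) \<otimes> (E a \<otimes> ?z))) = E a \<otimes> (E a \<otimes> ?w)"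
    using Serre_act[OF zc a m(1)] 3 ac wc by simp
  have Ew: "E a \<otimes> ?w \<in> wt (up a (up (a+1) (down (a+1) (down a l))))" by (rule E_wt[OF w a(1)])
  have 5: "F a \<otimes> (E a \<otimes> (E a \<otimes> ?w)) = E a \<otimes> (F a \<otimes> (E a \<otimes> ?w))"
    by (rule EF_11[OF Ew a(1) m(1), symmetric]) (use l in \<open>simp add: up_def down_def\<close>)
  have 6: "F a \<otimes> (E a \<otimes> ?w) = two_q \<odot> ?w"
    by (rule FE_02[OF w a(1) m(1)]) (use l in \<open>simp_all add: up_def down_def\<close>)
  have "two_q \<odot> (F a \<otimes> (E a \<otimes> (E (a+1) \<otimes> (E a \<otimes> ?z)))) = F a \<otimes> (E a \<otimes> (E a \<otimes> ?w))"
    unfolding 4[symmetric] using ac zc by (simp add: smult_mult_r)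
  also have "\<dots> = two_q \<odot> (E a \<otimes> ?w)" unfolding 5 6 using ac wc by (simp add: smult_mult_r)
  finally have 7: "F a \<otimes> (E a \<otimes> (E (a+1) \<otimes> (E a \<otimes> ?z))) = E a \<otimes> ?w"
    by (rule two_q_cancel) (use ac zc wc in simp_all)
  have 8: "?w = ?y \<oplus> F (a+1) \<otimes> (E (a+1) \<otimes> ?y)"
    by (rule EF_21[OF y a(2) m(2)]) (use l in \<open>simp_all add: down_def\<close>)
  have 9: "E (a+1) \<otimes> ?y = F a \<otimes> (E (a+1) \<otimes> x)"
    by (rule EF_swap[OF xc a(2) a(1)]) simp
  have "E a \<otimes> (F a \<otimes> (E (a+1) \<otimes> (F (a+1) \<otimes> (E a \<otimes> ?y)))) = E a \<otimes> ?w"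
    unfolding 1 2 7 ..
  also have "\<dots> = E a \<otimes> ?y \<oplus> E a \<otimes> (F (a+1) \<otimes> (F a \<otimes> (E (a+1) \<otimes> x)))"
    unfolding 8 9 using ac xc by (simp add: r_distr)
  also have "E a \<otimes> (F (a+1) \<otimes> (F a \<otimes> (E (a+1) \<otimes> x))) = F (a+1) \<otimes> (E a \<otimes> (F a \<otimes> (E (a+1) \<otimes> x)))"
    by (rule EF_swap) (use a ac xc in auto)
  finally show ?thesis .
qed

lemma cubic_rel2:
  assumes x: "x \<in> wt l" and a: "a \<in> {1..<m+n}" "a + 1 \<in> {1..<m+n}" and m: "a \<noteq> m" "a + 1 \<noteq> m"
    and l: "l a = 1" "l (a+1) = 1" "l (a+2) = 1"
  shows "E (a+1) \<otimes> (F (a+1) \<otimes> (E a \<otimes> (F a \<otimes> (E (a+1) \<otimes> (F (a+1) \<otimes> x)))))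
    = E (a+1) \<otimes> (F (a+1) \<otimes> x) \<oplus> F (a+1) \<otimes> (E a \<otimes> (F a \<otimes> (E (a+1) \<otimes> x)))"
proof -
  note ac = E_closed[OF a(1)] F_closed[OF a(1)] E_closed[OF a(2)] F_closed[OF a(2)]
  let ?y = "F (a+1) \<otimes> x"
  let ?z = "F a \<otimes> ?y"
  note xc = wt_carrier[OF x]
  have y: "?y \<in> wt (down (a+1) l)" by (rule F_wt[OF x a(2)])
  have z: "?z \<in> wt (down a (down (a+1) l))" by (rule F_wt[OF y a(1)])
  have yc: "?y \<in> carrier A" and zc: "?z \<in> carrier A"
    using y z by (blast intro: wt_carrier)+
  have 1: "F a \<otimes> (E (a+1) \<otimes> ?y) = E (a+1) \<otimes> ?z"
    by (rule EF_swap[symmetric]) (use a yc in auto)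
  have Ez: "E (a+1) \<otimes> ?z \<in> wt (up (a+1) (down a (down (a+1) l)))" by (rule E_wt[OF z a(2)])
  have t: "E a \<otimes> (E (a+1) \<otimes> ?z) \<in> wt (up a (up (a+1) (down a (down (a+1) l))))"
    by (rule E_wt[OF Ez a(1)])
  have 2: "E (a+1) \<otimes> (F (a+1) \<otimes> (E a \<otimes> (E (a+1) \<otimes> ?z))) = F (a+1) \<otimes> (E (a+1) \<otimes> (E a \<otimes> (E (a+1) \<otimes> ?z)))"
    by (rule EF_11[OF t a(2) m(2)]) (use l in \<open>simp add: up_def down_def\<close>)
  \<comment> \<open>After applying $F_{a+1}$ and dividing by $[2]$, the first term gives $A'x$, the second one $Yx$.\<close>
  have S: "two_q \<odot> (E (a+1) \<otimes> (E a \<otimes> (E (a+1) \<otimes> ?z)))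
      = E (a+1) \<otimes> (E (a+1) \<otimes> (E a \<otimes> ?z)) \<oplus> E a \<otimes> (E (a+1) \<otimes> (E (a+1) \<otimes> ?z))"
    by (rule Serre_act[OF zc a(2) a(1) m(2)]) simp
  have 3: "E a \<otimes> ?z = ?y"
    by (rule EF_10[OF y a(1)]) (use l in \<open>simp_all add: down_def\<close>)
  have Ey: "E (a+1) \<otimes> ?y \<in> wt (up (a+1) (down (a+1) l))" by (rule E_wt[OF y a(2)])
  have 4: "F (a+1) \<otimes> (E (a+1) \<otimes> (E (a+1) \<otimes> ?y)) = E (a+1) \<otimes> (F (a+1) \<otimes> (E (a+1) \<otimes> ?y))"
    by (rule EF_11[OF Ey a(2) m(2), symmetric]) (use l in \<open>simp add: up_def down_def\<close>)
  have 5: "F (a+1) \<otimes> (E (a+1) \<otimes> ?y) = two_q \<odot> ?y"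
    by (rule FE_02[OF y a(2) m(2)]) (use l in \<open>simp_all add: down_def\<close>)
  have first: "F (a+1) \<otimes> (E (a+1) \<otimes> (E (a+1) \<otimes> (E a \<otimes> ?z))) = two_q \<odot> (E (a+1) \<otimes> ?y)"
    unfolding 3 4 5 using ac yc by (simp add: smult_mult_r)
  have Ex: "E (a+1) \<otimes> x \<in> wt (up (a+1) l)" by (rule E_wt[OF x a(2)])
  have Exc: "E (a+1) \<otimes> x \<in> carrier A" using Ex by (rule wt_carrier)
  have 6: "E (a+1) \<otimes> ?y = F (a+1) \<otimes> (E (a+1) \<otimes> x)"
    by (rule EF_11[OF x a(2) m(2)]) (use l in simp)
  have 7: "E (a+1) \<otimes> (F (a+1) \<otimes> (E (a+1) \<otimes> x)) = two_q \<odot> (E (a+1) \<otimes> x)"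
    by (rule EF_20[OF Ex a(2) m(2)]) (use l in \<open>simp_all add: up_def\<close>)
  have 8: "E (a+1) \<otimes> (E (a+1) \<otimes> ?z) = two_q \<odot> (F a \<otimes> (E (a+1) \<otimes> x))"
  proof -
    have "E (a+1) \<otimes> (E (a+1) \<otimes> ?z) = E (a+1) \<otimes> (F a \<otimes> (E (a+1) \<otimes> ?y))" unfolding 1 ..
    also have "\<dots> = F a \<otimes> (E (a+1) \<otimes> (E (a+1) \<otimes> ?y))"
      by (rule EF_swap) (use a ac yc in auto)
    also have "\<dots> = two_q \<odot> (F a \<otimes> (E (a+1) \<otimes> x))"
      unfolding 6 7 using ac Exc by (simp add: smult_mult_r)
    finally show ?thesis .
  qed
  have second: "F (a+1) \<otimes> (E a \<otimes> (E (a+1) \<otimes> (E (a+1) \<otimes> ?z)))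
      = two_q \<odot> (F (a+1) \<otimes> (E a \<otimes> (F a \<otimes> (E (a+1) \<otimes> x))))"
    unfolding 8 using ac Exc by (simp add: smult_mult_r)
  have "two_q \<odot> (F (a+1) \<otimes> (E (a+1) \<otimes> (E a \<otimes> (E (a+1) \<otimes> ?z))))
      = F (a+1) \<otimes> (two_q \<odot> (E (a+1) \<otimes> (E a \<otimes> (E (a+1) \<otimes> ?z))))"
    using ac zc by (simp add: smult_mult_r)
  also have "\<dots> = two_q \<odot> (E (a+1) \<otimes> ?y) \<oplus> two_q \<odot> (F (a+1) \<otimes> (E a \<otimes> (F a \<otimes> (E (a+1) \<otimes> x))))"
    unfolding S first[symmetric] second[symmetric] using ac zc by (simp add: r_distr)
  also have "\<dots> = two_q \<odot> (E (a+1) \<otimes> ?y \<oplus> F (a+1) \<otimes> (E a \<otimes> (F a \<otimes> (E (a+1) \<otimes> x))))"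
    using ac yc Exc by (simp add: smult_r_distr)
  finally have "F (a+1) \<otimes> (E (a+1) \<otimes> (E a \<otimes> (E (a+1) \<otimes> ?z)))
      = E (a+1) \<otimes> ?y \<oplus> F (a+1) \<otimes> (E a \<otimes> (F a \<otimes> (E (a+1) \<otimes> x)))"
    by (rule two_q_cancel) (use ac zc yc Exc in simp_all)
  then show ?thesis unfolding 1 2 .
qed

lemma far_rel:
  assumes x: "x \<in> carrier A" and a: "a \<in> {1..<m+n}" and c: "c \<in> {1..<m+n}" and d: "\<bar>int a - int c\<bar> > 1"
  shows "E a \<otimes> (F a \<otimes> (E c \<otimes> (F c \<otimes> x))) = E c \<otimes> (F c \<otimes> (E a \<otimes> (F a \<otimes> x)))"
proof -
  note ac = E_closed[OF a] F_closed[OF a] E_closed[OF c] F_closed[OF c]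
  have n: "a \<noteq> c" "c \<noteq> a" using d by auto
  have "E a \<otimes> (F a \<otimes> (E c \<otimes> (F c \<otimes> x))) = E a \<otimes> (E c \<otimes> (F a \<otimes> (F c \<otimes> x)))"
    using EF_swap[of "F c \<otimes> x", OF _ c a n(2)] ac x by simp
  also have "\<dots> = E c \<otimes> (E a \<otimes> (F c \<otimes> (F a \<otimes> x)))"
    using EE_swap[OF _ a c d] FF_swap[OF x a c d] ac x by simp
  also have "E a \<otimes> (F c \<otimes> (F a \<otimes> x)) = F c \<otimes> (E a \<otimes> (F a \<otimes> x))"
    by (rule EF_swap) (use ac x a c n in auto)
  finally show ?thesis .
qed

section \<open>Shifting a block of weights\<close>

text \<open>The elementary step: two neighbouring ones at $a$, $a+1$, followed by an empty place, are moved by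
  $F_aF_{a+1}$. Both $F_aF_{a+1}(E_aF_a)$ and $F_{a+1}E_{a+1}(F_aF_{a+1})$ reduce to $F_{a+1}F_a$.\<close>

lemma shift_left:
  assumes x: "x \<in> wt l" and a: "a \<in> {1..<m+n}" "a + 1 \<in> {1..<m+n}"
    and l: "l a = 1" "l (a+1) = 1" "l (a+2) = 0"
  shows "F a \<otimes> (F (a+1) \<otimes> (E a \<otimes> (F a \<otimes> x))) = F (a+1) \<otimes> (F a \<otimes> x)"
proof -
  note ac = E_closed[OF a(1)] F_closed[OF a(1)] E_closed[OF a(2)] F_closed[OF a(2)] wt_carrier[OF x]
  have 1: "F (a+1) \<otimes> (E a \<otimes> (F a \<otimes> x)) = E a \<otimes> (F (a+1) \<otimes> (F a \<otimes> x))"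
    by (rule EF_swap[symmetric]) (use a ac in auto)
  show ?thesis unfolding 1
    by (rule FE_01[OF F_wt[OF F_wt[OF x a(1)] a(2)] a(1)]) (use l in \<open>simp_all add: down_def\<close>)
qed

lemma shift_right:
  assumes x: "x \<in> wt l" and a: "a \<in> {1..<m+n}" "a + 1 \<in> {1..<m+n}"
    and l: "l a = 1" "l (a+1) = 1" "l (a+2) = 0"
  shows "E (a+1) \<otimes> (F (a+1) \<otimes> (F a \<otimes> (F (a+1) \<otimes> x)))
    = (if a + 1 = m then two_q \<odot> (F a \<otimes> (F (a+1) \<otimes> x)) \<ominus> F a \<otimes> (F (a+1) \<otimes> (E a \<otimes> (F a \<otimes> x)))
       else F a \<otimes> (F (a+1) \<otimes> (E a \<otimes> (F a \<otimes> x))))"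
proof -
  note ac = E_closed[OF a(1)] F_closed[OF a(1)] E_closed[OF a(2)] F_closed[OF a(2)] wt_carrier[OF x]
  let ?t = "F a \<otimes> (F (a+1) \<otimes> x)"
  have t: "?t \<in> wt (down a (down (a+1) l))" by (rule F_wt[OF F_wt[OF x a(2)] a(1)])
  have 1: "E (a+1) \<otimes> ?t = F a \<otimes> (E (a+1) \<otimes> (F (a+1) \<otimes> x))"
    by (rule EF_swap) (use a ac in auto)
  have 2: "E (a+1) \<otimes> (F (a+1) \<otimes> x) = x"
    by (rule EF_10[OF x a(2)]) (use l in simp_all)
  have 3: "F (a+1) \<otimes> (E (a+1) \<otimes> ?t) = F a \<otimes> (F (a+1) \<otimes> (E a \<otimes> (F a \<otimes> x)))"
    unfolding 1 2 shift_left[OF x a l] ..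
  show ?thesis
  proof (cases "a + 1 = m")
    case True
    have "E m \<otimes> (F m \<otimes> ?t) = two_q \<odot> ?t \<ominus> F m \<otimes> (E m \<otimes> ?t)"
      by (rule EF_11_odd[OF t]) (use a True l in \<open>auto simp: down_def\<close>)
    then show ?thesis using 3 True by simp
  next
    case False
    have "E (a+1) \<otimes> (F (a+1) \<otimes> ?t) = F (a+1) \<otimes> (E (a+1) \<otimes> ?t)"
      by (rule EF_11[OF t a(2) False]) (use l in \<open>simp add: down_def\<close>)
    then show ?thesis using 3 False by simp
  qed
qed

end

lemma prod_list_upt: "prod_list (map f [1..<t+1]) = (\<Prod>s=1..t. f s :: 'a::comm_monoid_mult)"
  by (induction t) simp_all

context qschur_system
begin

text \<open>The weight with ones at the places $s+1,\dots,s+r$; $\omega$ is \<open>block 0\<close> and $\omega'$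
  is \<open>block (m + n - r)\<close>.\<close>

definition block :: "nat \<Rightarrow> nat \<Rightarrow> int" where
  "block s i = (if s < i \<and> i \<le> s + r then 1 else 0)"

text \<open>The weight with ones at $s+1,\dots,s+r+1$ except for $s+k+1$. As $k$ decreases from \<open>r\<close>
  to 0, the gap travels through the block, which thereby moves one place to the right.\<close>

definition gap :: "nat \<Rightarrow> nat \<Rightarrow> nat \<Rightarrow> int" where
  "gap s k i = (if s < i \<and> i \<le> s + r + 1 \<and> i \<noteq> s + k + 1 then 1 else 0)"

text \<open>The products $F_{lo} \cdots F_{hi-1}$ and $E_{hi-1} \cdots E_{lo}$.\<close>

definition fchain :: "nat \<Rightarrow> nat \<Rightarrow> 'a" where
  "fchain lo hi = lprod A (map F [lo..<hi])"

definition echain :: "nat \<Rightarrow> nat \<Rightarrow> 'a" where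
  "echain lo hi = lprod A (map E (rev [lo..<hi]))"

lemma gap_block: "gap s 0 = block (s + 1)" "gap s r = block s"
  by (auto simp: gap_def block_def)

lemma fchain_closed: "1 \<le> lo \<Longrightarrow> hi \<le> m + n \<Longrightarrow> fchain lo hi \<in> carrier A"
  unfolding fchain_def by (rule lprod_closed) auto

lemma echain_closed: "1 \<le> lo \<Longrightarrow> hi \<le> m + n \<Longrightarrow> echain lo hi \<in> carrier A"
  unfolding echain_def by (rule lprod_closed) auto

lemma fchain_Cons: "lo < hi \<Longrightarrow> fchain lo hi = F lo \<otimes> fchain (Suc lo) hi"
  by (simp add: fchain_def upt_conv_Cons)

lemma echain_snoc:
  assumes "lo < hi" "1 \<le> lo" "hi \<le> m + n"
  shows "echain lo hi = echain (Suc lo) hi \<otimes> E lo"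
proof -
  have "lprod A (map E (rev [Suc lo..<hi]) @ [E lo]) = lprod A (map E (rev [Suc lo..<hi])) \<otimes> lprod A [E lo]"
    by (rule lprod_append) (use assms in auto)
  then show ?thesis using assms by (simp add: echain_def upt_conv_Cons)
qed

lemma fchain_snoc:
  assumes "lo \<le> hi" "1 \<le> lo" "hi < m + n"
  shows "fchain lo (Suc hi) = fchain lo hi \<otimes> F hi"
proof -
  have "lprod A (map F [lo..<hi] @ [F hi]) = lprod A (map F [lo..<hi]) \<otimes> lprod A [F hi]"
    by (rule lprod_append) (use assms in auto)
  then show ?thesis using assms by (simp add: fchain_def)
qed

lemma echain_Cons: "lo \<le> hi \<Longrightarrow> echain lo (Suc hi) = E hi \<otimes> echain lo hi"
  by (simp add: echain_def)

lemma fchain_gap: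
  assumes x: "x \<in> wt (block s)" and s: "s + r < m + n" and k: "k \<le> r"
  shows "fchain (s+k+1) (s+r+1) \<otimes> x \<in> wt (gap s k)
    \<and> echain (s+k+1) (s+r+1) \<otimes> (fchain (s+k+1) (s+r+1) \<otimes> x) = x"
  using k
proof (induction k rule: inc_induct)
  case base
  then show ?case using x wt_carrier[OF x] by (simp add: fchain_def echain_def gap_block)
next
  case (step k)
  let ?a = "s + k + 1"
  have a: "?a \<in> {1..<m+n}" using step s by auto
  let ?y = "fchain (s + Suc k + 1) (s+r+1) \<otimes> x"
  have y: "?y \<in> wt (gap s (Suc k))" using step.IH by blast
  have c: "fchain (s + Suc k + 1) (s+r+1) \<in> carrier A" "echain (s + Suc k + 1) (s+r+1) \<in> carrier A"
    using fchain_closed echain_closed s by auto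
  note cc = c E_closed[OF a] F_closed[OF a] wt_carrier[OF x] wt_carrier[OF y]
  have f: "fchain ?a (s+r+1) \<otimes> x = F ?a \<otimes> ?y"
    using fchain_Cons[of ?a "s+r+1"] step.hyps cc by (simp add: m_assoc)
  have "down ?a (gap s (Suc k)) = gap s k"
    using step.hyps by (auto simp: down_def gap_def fun_eq_iff)
  then have w: "F ?a \<otimes> ?y \<in> wt (gap s k)" using F_wt[OF y a] by simp
  have "E ?a \<otimes> (F ?a \<otimes> ?y) = ?y"
    by (rule EF_10[OF y a]) (use step.hyps in \<open>auto simp: gap_def\<close>)
  then have "echain ?a (s+r+1) \<otimes> (F ?a \<otimes> ?y) = echain (s + Suc k + 1) (s+r+1) \<otimes> ?y"
    using echain_snoc[of ?a "s+r+1"] step.hyps s cc by (simp add: m_assoc)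
  also have "\<dots> = x" using step.IH by blast
  finally show ?case using w unfolding f by blast
qed

lemma echain_gap:
  assumes y: "y \<in> wt (block (s + 1))" and s: "s + r < m + n"
  shows "k \<le> r \<Longrightarrow> echain (s+1) (s+k+1) \<otimes> y \<in> wt (gap s k)
    \<and> fchain (s+1) (s+k+1) \<otimes> (echain (s+1) (s+k+1) \<otimes> y) = y"
proof (induction k)
  case 0
  then show ?case using y wt_carrier[OF y] by (simp add: fchain_def echain_def gap_block)
next
  case (Suc k)
  let ?a = "s + k + 1"
  have a: "?a \<in> {1..<m+n}" using Suc s by auto
  let ?z = "echain (s+1) ?a \<otimes> y"
  have z: "?z \<in> wt (gap s k)" and zy: "fchain (s+1) ?a \<otimes> ?z = y" using Suc by auto
  have c: "fchain (s+1) ?a \<in> carrier A" "echain (s+1) ?a \<in> carrier A"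
    using fchain_closed echain_closed s Suc.prems by auto
  note cc = c E_closed[OF a] F_closed[OF a] wt_carrier[OF y] wt_carrier[OF z]
  have e: "echain (s+1) (s + Suc k + 1) \<otimes> y = E ?a \<otimes> ?z"
    using echain_Cons[of "s+1" ?a] cc by (simp add: m_assoc)
  have "up ?a (gap s k) = gap s (Suc k)"
    using Suc.prems by (auto simp: up_def gap_def fun_eq_iff)
  then have w: "E ?a \<otimes> ?z \<in> wt (gap s (Suc k))" using E_wt[OF z a] by simp
  have "F ?a \<otimes> (E ?a \<otimes> ?z) = ?z"
    by (rule FE_01[OF z a]) (use Suc.prems in \<open>auto simp: gap_def\<close>)
  then have "fchain (s+1) (s + Suc k + 1) \<otimes> (E ?a \<otimes> ?z) = fchain (s+1) ?a \<otimes> ?z"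
    using fchain_snoc[of "s+1" ?a] s Suc.prems cc by (simp add: m_assoc)
  then show ?case using w zy unfolding e by simp
qed

lemma EF_far_chain:
  assumes x: "x \<in> carrier A" and a: "a \<in> {1..<m+n}"
    and cs: "\<And>c. c \<in> set cs \<Longrightarrow> c \<in> {1..<m+n} \<and> \<bar>int a - int c\<bar> > 1"
  shows "E a \<otimes> (F a \<otimes> (lprod A (map F cs) \<otimes> x)) = lprod A (map F cs) \<otimes> (E a \<otimes> (F a \<otimes> x))"
  using cs
proof (induction cs)
  case Nil
  then show ?case using x a by simp
next
  case (Cons c cs)
  have c: "c \<in> {1..<m+n}" "\<bar>int a - int c\<bar> > 1" using Cons.prems[of c] by auto
  have L: "lprod A (map F cs) \<in> carrier A"
    by (rule lprod_closed) (use Cons.prems in auto)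
  let ?y = "lprod A (map F cs) \<otimes> x"
  note cl = x L E_closed[OF a] F_closed[OF a] F_closed[OF c(1)]
  have n: "a \<noteq> c" using c by auto
  have "E a \<otimes> (F a \<otimes> (F c \<otimes> ?y)) = E a \<otimes> (F c \<otimes> (F a \<otimes> ?y))"
    using FF_swap[OF _ a c] cl by simp
  also have "\<dots> = F c \<otimes> (E a \<otimes> (F a \<otimes> ?y))"
    by (rule EF_swap[OF _ a c(1) n]) (use cl in simp)
  also have "\<dots> = F c \<otimes> (lprod A (map F cs) \<otimes> (E a \<otimes> (F a \<otimes> x)))"
    using Cons by simp
  finally show ?case using cl by (simp add: m_assoc)
qed

lemma shift_step:
  assumes x: "x \<in> wt (block s)" and s: "s + r < m + n" and i: "i \<in> {1..<r}"
  defines "p \<equiv> fchain (s+1) (s+r+1)"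
  shows "E (s+i+1) \<otimes> (F (s+i+1) \<otimes> (p \<otimes> x))
    = (if s + i + 1 = m then two_q \<odot> (p \<otimes> x) \<ominus> p \<otimes> (E (s+i) \<otimes> (F (s+i) \<otimes> x))
       else p \<otimes> (E (s+i) \<otimes> (F (s+i) \<otimes> x)))"
proof -
  let ?a = "s + i"
  have a: "?a \<in> {1..<m+n}" "?a + 1 \<in> {1..<m+n}" using i s by auto
  let ?L = "fchain (s+1) ?a" and ?G = "fchain (?a+2) (s+r+1)"
  have Lc: "?L \<in> carrier A" and Gc: "?G \<in> carrier A"
    using fchain_closed i s by auto
  have xc: "x \<in> carrier A" by (rule wt_carrier[OF x])
  note cl = Lc Gc xc E_closed[OF a(1)] F_closed[OF a(1)] E_closed[OF a(2)] F_closed[OF a(2)]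
  have split: "p \<otimes> y = ?L \<otimes> (F ?a \<otimes> (F (?a+1) \<otimes> (?G \<otimes> y)))" if y: "y \<in> carrier A" for y
  proof -
    have "[s+1..<s+r+1] = [s+1..<?a] @ [?a..<s+r+1]"
      using upt_add_eq_append[of "s+1" ?a "r+1-i"] i by simp
    also have "[?a..<s+r+1] = [?a, ?a+1] @ [?a+2..<s+r+1]"
      using i by (simp add: upt_conv_Cons del: upt_Suc)
    finally have "p = lprod A (map F [s+1..<?a] @ (map F [?a, ?a+1] @ map F [?a+2..<s+r+1]))"
      unfolding p_def fchain_def by (metis map_append)
    also have "\<dots> = ?L \<otimes> lprod A (map F [?a, ?a+1] @ map F [?a+2..<s+r+1])"
      unfolding fchain_def by (rule lprod_append) (use i s a in auto)
    also have "lprod A (map F [?a, ?a+1] @ map F [?a+2..<s+r+1]) = F ?a \<otimes> (F (?a+1) \<otimes> ?G)"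
      by (simp add: fchain_def)
    finally show ?thesis using cl y by (simp add: m_assoc)
  qed
  let ?g = "?G \<otimes> x"
  have g: "?g \<in> wt (gap s (i+1))" using fchain_gap[OF x s, of "i+1"] i by (simp add: add.assoc)
  have gc: "?g \<in> carrier A" by (rule wt_carrier[OF g])
  have lg: "gap s (i+1) ?a = 1" "gap s (i+1) (?a+1) = 1" "gap s (i+1) (?a+2) = 0"
    using i by (auto simp: gap_def)
  have far1: "?G \<otimes> (E ?a \<otimes> (F ?a \<otimes> x)) = E ?a \<otimes> (F ?a \<otimes> ?g)"
    unfolding fchain_def by (rule EF_far_chain[OF xc a(1), symmetric]) (use s in auto)
  have far2: "E (?a+1) \<otimes> (F (?a+1) \<otimes> (?L \<otimes> y)) = ?L \<otimes> (E (?a+1) \<otimes> (F (?a+1) \<otimes> y))"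
    if "y \<in> carrier A" for y
    unfolding fchain_def by (rule EF_far_chain[OF that a(2)]) (use a in auto)
  have px: "p \<otimes> x = ?L \<otimes> (F ?a \<otimes> (F (?a+1) \<otimes> ?g))" by (rule split[OF xc])
  have pA: "p \<otimes> (E ?a \<otimes> (F ?a \<otimes> x)) = ?L \<otimes> (F ?a \<otimes> (F (?a+1) \<otimes> (E ?a \<otimes> (F ?a \<otimes> ?g))))"
    using split[of "E ?a \<otimes> (F ?a \<otimes> x)"] far1 cl by simp
  have "E (?a+1) \<otimes> (F (?a+1) \<otimes> (p \<otimes> x))
      = ?L \<otimes> (E (?a+1) \<otimes> (F (?a+1) \<otimes> (F ?a \<otimes> (F (?a+1) \<otimes> ?g))))"
    unfolding px by (rule far2) (use cl gc in simp)
  also have "\<dots> = (if ?a + 1 = m then two_q \<odot> (p \<otimes> x) \<ominus> p \<otimes> (E ?a \<otimes> (F ?a \<otimes> x))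
       else p \<otimes> (E ?a \<otimes> (F ?a \<otimes> x)))"
  proof (cases "?a + 1 = m")
    case True
    have "?L \<otimes> (two_q \<odot> t \<ominus> u) = two_q \<odot> (?L \<otimes> t) \<ominus> ?L \<otimes> u"
      if "t \<in> carrier A" "u \<in> carrier A" for t u
      using Lc that by (simp add: minus_eq r_distr r_minus smult_mult_r)
    from this[of "F ?a \<otimes> (F (?a+1) \<otimes> ?g)" "F ?a \<otimes> (F (?a+1) \<otimes> (E ?a \<otimes> (F ?a \<otimes> ?g)))"]
    show ?thesis
      unfolding shift_right[OF g a lg] px pA if_P[OF True] using cl gc by simp
  next
    case False
    show ?thesis unfolding shift_right[OF g a lg] px pA if_not_P[OF False] ..
  qed
  finally show ?thesis .
qed

text \<open>The monomials that move the block of ones from place 1 to place $s+1$, and back.\<close>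

primrec shiftF :: "nat \<Rightarrow> 'a" where
  "shiftF 0 = \<one>"
| "shiftF (Suc s) = fchain (s+1) (s+r+1) \<otimes> shiftF s"

primrec shiftE :: "nat \<Rightarrow> 'a" where
  "shiftE 0 = \<one>"
| "shiftE (Suc s) = shiftE s \<otimes> echain (s+1) (s+r+1)"

lemma shiftF_closed: "s + r \<le> m + n \<Longrightarrow> shiftF s \<in> carrier A"
  by (induction s) (auto intro!: m_closed fchain_closed)

lemma shiftE_closed: "s + r \<le> m + n \<Longrightarrow> shiftE s \<in> carrier A"
  by (induction s) (auto intro!: m_closed echain_closed)

lemma shiftF_wt:
  assumes x: "x \<in> wt (block 0)"
  shows "s + r \<le> m + n \<Longrightarrow> shiftF s \<otimes> x \<in> wt (block s) \<and> shiftE s \<otimes> (shiftF s \<otimes> x) = x"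
proof (induction s)
  case 0
  then show ?case using x wt_carrier[OF x] by simp
next
  case (Suc s)
  have s: "s + r < m + n" using Suc.prems by simp
  let ?y = "shiftF s \<otimes> x"
  have y: "?y \<in> wt (block s)" and yx: "shiftE s \<otimes> ?y = x" using Suc by auto
  have c: "shiftF s \<in> carrier A" "shiftE s \<in> carrier A" "fchain (s+1) (s+r+1) \<in> carrier A"
     "echain (s+1) (s+r+1) \<in> carrier A"
    using shiftF_closed shiftE_closed fchain_closed echain_closed s by auto
  note cl = c wt_carrier[OF x] wt_carrier[OF y]
  have 1: "shiftF (Suc s) \<otimes> x = fchain (s+1) (s+r+1) \<otimes> ?y" using cl by (simp add: m_assoc)
  have 2: "fchain (s+1) (s+r+1) \<otimes> ?y \<in> wt (block (Suc s))"
    "echain (s+1) (s+r+1) \<otimes> (fchain (s+1) (s+r+1) \<otimes> ?y) = ?y"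
    using fchain_gap[OF y s, of 0] gap_block(1)[of s] by simp_all
  have "shiftE (Suc s) \<otimes> (fchain (s+1) (s+r+1) \<otimes> ?y)
     = shiftE s \<otimes> (echain (s+1) (s+r+1) \<otimes> (fchain (s+1) (s+r+1) \<otimes> ?y))"
    using cl by (simp add: m_assoc)
  then show ?case unfolding 1 2(2) yx using 2(1) by blast
qed

lemma shiftE_wt:
  "s + r \<le> m + n \<Longrightarrow> y \<in> wt (block s) \<Longrightarrow> shiftE s \<otimes> y \<in> wt (block 0) \<and> shiftF s \<otimes> (shiftE s \<otimes> y) = y"
proof (induction s arbitrary: y)
  case 0
  then show ?case using wt_carrier[OF 0(2)] by simp
next
  case (Suc s)
  have s: "s + r < m + n" using Suc.prems by simp
  let ?z = "echain (s+1) (s+r+1) \<otimes> y"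
  have "y \<in> wt (block (s+1))" using Suc.prems by simp
  from echain_gap[OF this s, of r]
  have z: "?z \<in> wt (block s)" and zy: "fchain (s+1) (s+r+1) \<otimes> ?z = y" by (auto simp: gap_block)
  have IH: "shiftE s \<otimes> ?z \<in> wt (block 0)" "shiftF s \<otimes> (shiftE s \<otimes> ?z) = ?z"
    using Suc.IH[OF _ z] s by auto
  have c: "shiftF s \<in> carrier A" "shiftE s \<in> carrier A" "fchain (s+1) (s+r+1) \<in> carrier A"
     "echain (s+1) (s+r+1) \<in> carrier A"
    using shiftF_closed shiftE_closed fchain_closed echain_closed s by auto
  note cl = c wt_carrier[OF Suc.prems(2)] wt_carrier[OF z]
  have 1: "shiftE (Suc s) \<otimes> y = shiftE s \<otimes> ?z" using cl by (simp add: m_assoc)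
  have "shiftF (Suc s) \<otimes> (shiftE s \<otimes> ?z) = fchain (s+1) (s+r+1) \<otimes> (shiftF s \<otimes> (shiftE s \<otimes> ?z))"
    using cl by (simp add: m_assoc)
  then show ?case unfolding 1 IH(2) zy using IH(1) by blast
qed

text \<open>Moving the block carries $E_iF_i$ to $E_{s+i}F_{s+i}$ as long as the $i$-th and $(i+1)$-st
  ones lie at places at most \<open>m\<close>, that is $s+i < m$. After the move for which the two ones come to
  lie on both sides of the odd root, it is carried to $[2] - E_{s+i}F_{s+i}$.\<close>

lemma shiftF_intertwines:
  assumes x: "x \<in> wt (block 0)" and i: "i \<in> {1..<r}" and "r \<le> m"
  shows "s + r \<le> m + n \<Longrightarrow> E (s+i) \<otimes> (F (s+i) \<otimes> (shiftF s \<otimes> x))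
    = (if s + i < m then shiftF s \<otimes> (E i \<otimes> (F i \<otimes> x))
       else two_q \<odot> (shiftF s \<otimes> x) \<ominus> shiftF s \<otimes> (E i \<otimes> (F i \<otimes> x)))"
proof (induction s)
  case 0
  have "i \<in> {1..<m+n}" using i 0 by auto
  then show ?case using i \<open>r \<le> m\<close> wt_carrier[OF x] by simp
next
  case (Suc s)
  have s: "s + r < m + n" using Suc.prems by simp
  have ii: "i \<in> {1..<m+n}" using i s by auto
  let ?p = "fchain (s+1) (s+r+1)" and ?y = "shiftF s \<otimes> x" and ?A = "E i \<otimes> (F i \<otimes> x)"
  have y: "?y \<in> wt (block s)" using shiftF_wt[OF x] s by auto
  have c: "shiftF s \<in> carrier A" "?p \<in> carrier A" using shiftF_closed fchain_closed s by auto
  note cl = c wt_carrier[OF x] wt_carrier[OF y] E_closed[OF ii] F_closed[OF ii]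
  have 1: "shiftF (Suc s) \<otimes> z = ?p \<otimes> (shiftF s \<otimes> z)" if "z \<in> carrier A" for z
    using cl that by (simp add: m_assoc)
  have IH: "E (s+i) \<otimes> (F (s+i) \<otimes> ?y)
    = (if s + i < m then shiftF s \<otimes> ?A else two_q \<odot> ?y \<ominus> shiftF s \<otimes> ?A)"
    using Suc by simp
  have Ac: "?A \<in> carrier A" using cl by simp
  have st: "E (s+i+1) \<otimes> (F (s+i+1) \<otimes> (?p \<otimes> ?y))
    = (if s + i + 1 = m then two_q \<odot> (?p \<otimes> ?y) \<ominus> ?p \<otimes> (E (s+i) \<otimes> (F (s+i) \<otimes> ?y))
       else ?p \<otimes> (E (s+i) \<otimes> (F (s+i) \<otimes> ?y)))" by (rule shift_step[OF y s i])
  consider "s + i + 1 = m" | "s + i + 1 < m" | "m \<le> s + i" by linarith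
  then show ?case
  proof cases
    case 1
    then show ?thesis using st IH \<open>\<And>z. z \<in> carrier A \<Longrightarrow> shiftF (Suc s) \<otimes> z = ?p \<otimes> (shiftF s \<otimes> z)\<close> Ac cl
      by (simp del: shiftF.simps)
  next
    case 2
    then show ?thesis using st IH 1 Ac cl by (simp del: shiftF.simps)
  next
    case 3
    have "?p \<otimes> (two_q \<odot> ?y \<ominus> shiftF s \<otimes> ?A) = two_q \<odot> (?p \<otimes> ?y) \<ominus> ?p \<otimes> (shiftF s \<otimes> ?A)"
      using cl Ac by (simp add: minus_eq r_distr r_minus smult_mult_r)
    then show ?thesis using st IH 1 Ac cl 3 by (simp del: shiftF.simps)
  qed
qed

section \<open>Weight idempotents\<close>

text \<open>The Gaussian binomial ${K_b \brack t}$ and the product of these over all \<open>b\<close>.\<close>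

definition kbinom :: "nat \<Rightarrow> nat \<Rightarrow> 'a" where
  "kbinom b t = lprod A (map (\<lambda>s. (1 / (vsub m b ^ s - inverse (vsub m b) ^ s)) \<odot>
      ((vsub m b powi (1 - int s)) \<odot> K b \<ominus> (vsub m b powi (int s - 1)) \<odot> Ki b)) [1..<t+1])"

definition proj :: "(nat \<Rightarrow> nat) \<Rightarrow> 'a" where
  "proj \<mu> = lprod A (map (\<lambda>b. kbinom b (\<mu> b)) [1..<m+n+1])"

text \<open>The value of ${K_b \brack t}$ on vectors whose weight has the entry \<open>j\<close> at \<open>b\<close>.\<close>

definition qbin :: "nat \<Rightarrow> nat \<Rightarrow> int \<Rightarrow> qv" where
  "qbin b t j = (\<Prod>s=1..t. (vsub m b powi (j + 1 - int s) - vsub m b powi (- (j + 1 - int s)))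
      / (vsub m b ^ s - inverse (vsub m b) ^ s))"

lemma kbinom_closed: "b \<in> {1..m+n} \<Longrightarrow> kbinom b t \<in> carrier A"
  unfolding kbinom_def
proof (rule lprod_closed)
  assume "b \<in> {1..m+n}"
  note c = K_closed[OF this] Ki_closed[OF this]
  show "set (map (\<lambda>s. (1 / (vsub m b ^ s - inverse (vsub m b) ^ s)) \<odot>
      ((vsub m b powi (1 - int s)) \<odot> K b \<ominus> (vsub m b powi (int s - 1)) \<odot> Ki b)) [1..<t+1]) \<subseteq> carrier A"
    using c by auto
qed

lemma proj_closed: "proj \<mu> \<in> carrier A"
  unfolding proj_def by (rule lprod_closed) (use kbinom_closed in auto)

lemma kbinom_wt:
  assumes x: "x \<in> wt l" and b: "b \<in> {1..m+n}"
  shows "kbinom b t \<otimes> x = qbin b t (l b) \<odot> x"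
proof -
  let ?v = "vsub m b"
  note c = wt_carrier[OF x] K_closed[OF b] Ki_closed[OF b]
  have "kbinom b t \<otimes> x = prod_list (map (\<lambda>s. (?v powi (l b + 1 - int s) - ?v powi (- (l b + 1 - int s)))
      / (?v ^ s - inverse ?v ^ s)) [1..<t+1]) \<odot> x"
    unfolding kbinom_def
  proof (rule lprod_eigen[OF c(1)])
    fix s
    have "((?v powi (1 - int s)) \<odot> K b \<ominus> (?v powi (int s - 1)) \<odot> Ki b) \<otimes> x
        = (?v powi (1 - int s) * ?v powi l b - ?v powi (int s - 1) * ?v powi (- l b)) \<odot> x"
      using c wt_K[OF x b] wt_Ki[OF x b]
      by (simp add: minus_eq l_distr l_minus smult_mult_l smult_l_diff smult_assoc)
    also have "?v powi (1 - int s) * ?v powi l b = ?v powi (l b + 1 - int s)"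
      by (simp flip: power_int_add add: algebra_simps)
    also have "?v powi (int s - 1) * ?v powi (- l b) = ?v powi (- (l b + 1 - int s))"
      by (simp flip: power_int_add add: algebra_simps)
    finally show "(1 / (?v ^ s - inverse ?v ^ s)) \<odot> ((?v powi (1 - int s)) \<odot> K b \<ominus> (?v powi (int s - 1)) \<odot> Ki b) \<otimes> x
      = ((?v powi (l b + 1 - int s) - ?v powi (- (l b + 1 - int s))) / (?v ^ s - inverse ?v ^ s)) \<odot> x"
      using c by (simp add: smult_mult_l flip: smult_assoc)
  qed (use c in simp)
  also have "prod_list (map (\<lambda>s. (?v powi (l b + 1 - int s) - ?v powi (- (l b + 1 - int s)))
      / (?v ^ s - inverse ?v ^ s)) [1..<t+1]) = qbin b t (l b)"
    unfolding qbin_def by (rule prod_list_upt)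
  finally show ?thesis .
qed

lemma qbin_less:
  assumes "0 \<le> j" "j < int t"
  shows "qbin b t j = 0"
proof -
  have "nat j + 1 \<in> {1..t}" using assms by auto
  moreover have "j + 1 - int (nat j + 1) = 0" using assms by simp
  ultimately show ?thesis unfolding qbin_def by (intro prod_zero) (auto intro!: bexI[of _ "nat j + 1"])
qed

lemma qbin_self: "qbin b t (int t) = 1"
proof -
  let ?v = "vsub m b"
  let ?g = "\<lambda>s. ?v ^ s - inverse ?v ^ s"
  have g: "?v powi (int t + 1 - int s) - ?v powi (- (int t + 1 - int s)) = ?g (t + 1 - s)" if "s \<in> {1..t}" for s
  proof -
    have "int t + 1 - int s = int (t + 1 - s)" using that by auto
    then show ?thesis by (simp only: power_int_minus power_int_of_nat power_inverse)
  qed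
  have nz: "?g s \<noteq> 0" if "s \<in> {1..t}" for s
  proof
    assume "?g s = 0"
    then have "?v powi int s = ?v powi (- int s)" by (simp add: power_int_minus power_inverse)
    then have "int s = - int s" by (rule vsub_powi_inj)
    then show False using that by simp
  qed
  have "qbin b t (int t) = (\<Prod>s=1..t. ?g (t + 1 - s) / ?g s)"
    unfolding qbin_def by (rule prod.cong) (simp_all add: g del: minus_diff_eq)
  also have "\<dots> = (\<Prod>s=1..t. ?g (t + 1 - s)) / (\<Prod>s=1..t. ?g s)" by (rule prod_dividef)
  also have "(\<Prod>s=1..t. ?g (t + 1 - s)) = (\<Prod>s=1..t. ?g s)"
    by (rule prod.atLeastAtMost_rev[symmetric])
  finally show ?thesis using nz by (simp add: prod_zero_iff)
qed

lemma proj_wt: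
  assumes x: "x \<in> wt l"
  shows "proj \<mu> \<otimes> x = (\<Prod>b\<in>{1..m+n}. qbin b (\<mu> b) (l b)) \<odot> x"
proof -
  have "proj \<mu> \<otimes> x = prod_list (map (\<lambda>b. qbin b (\<mu> b) (l b)) [1..<m+n+1]) \<odot> x"
    unfolding proj_def
    by (rule lprod_eigen[OF wt_carrier[OF x]]) (auto intro!: kbinom_closed kbinom_wt[OF x])
  also have "prod_list (map (\<lambda>b. qbin b (\<mu> b) (l b)) [1..<m+n+1]) = (\<Prod>b\<in>{1..m+n}. qbin b (\<mu> b) (l b))"
    by (rule prod_list_upt)
  finally show ?thesis .
qed

lemma proj_act:
  assumes "x \<in> wt l" "\<And>b. b \<in> {1..m+n} \<Longrightarrow> l b = int (\<mu> b)"
  shows "proj \<mu> \<otimes> x = x"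
proof -
  have "(\<Prod>b\<in>{1..m+n}. qbin b (\<mu> b) (l b)) = 1"
    by (rule prod.neutral) (simp add: assms(2) qbin_self)
  then show ?thesis using proj_wt[OF assms(1)] wt_carrier[OF assms(1)] by simp
qed

text \<open>On a weight space of another weight the product vanishes: if that weight is a composition of
  \<open>r\<close> other than \<open>\<mu>\<close>, one of its entries is smaller than that of \<open>\<mu>\<close>, where the binomial
  vanishes.\<close>

lemma proj_other:
  assumes x: "x \<in> wt l" and \<mu>: "(\<Sum>b\<in>{1..m+n}. \<mu> b) = r" and ne: "\<exists>b\<in>{1..m+n}. l b \<noteq> int (\<mu> b)"
  shows "proj \<mu> \<otimes> x = \<zero>"
proof (cases "(\<exists>b\<in>{1..m+n}. l b < 0) \<or> (\<Sum>b\<in>{1..m+n}. l b) \<noteq> int r")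
  case True
  then have "x = \<zero>" using wt_negative[OF x] wt_total[OF x] by blast
  then show ?thesis using proj_closed by simp
next
  case False
  have "\<exists>b\<in>{1..m+n}. l b < int (\<mu> b)"
  proof (rule ccontr)
    assume "\<not> ?thesis"
    then have le: "int (\<mu> b) \<le> l b" if "b \<in> {1..m+n}" for b using that by (meson not_less)
    from ne obtain b where b: "b \<in> {1..m+n}" "l b \<noteq> int (\<mu> b)" by blast
    then have "int (\<mu> b) < l b" using le[OF b(1)] by auto
    then have "(\<Sum>b\<in>{1..m+n}. int (\<mu> b)) < (\<Sum>b\<in>{1..m+n}. l b)"
      using le b(1) by (intro sum_strict_mono_ex1) auto
    moreover have "(\<Sum>b\<in>{1..m+n}. int (\<mu> b)) = int r" using \<mu> by (simp flip: of_nat_sum)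
    ultimately show False using False by simp
  qed
  then obtain b where b: "b \<in> {1..m+n}" "l b < int (\<mu> b)" by blast
  have "0 \<le> l b" using False b(1) by (meson not_less)
  then have "qbin b (\<mu> b) (l b) = 0" using b(2) by (rule qbin_less)
  then have z: "(\<Prod>b\<in>{1..m+n}. qbin b (\<mu> b) (l b)) = 0" using b(1) by (intro prod_zero) auto
  show ?thesis unfolding proj_wt[OF x] z using wt_carrier[OF x] by simp
qed

text \<open>If \<open>x\<close> is annihilated by $\prod_c (k - c)$ with distinct \<open>c\<close>, then it is a sum of eigenvectors
  of \<open>k\<close>, by Lagrange interpolation; hence an additive property that holds for all eigenvectors in a
  \<open>k\<close>-stable subspace holds for \<open>x\<close>.\<close>

lemma eigen_induct:
  assumes k: "k \<in> carrier A" and M: "M \<subseteq> carrier A"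
    and Mk: "\<And>y. y \<in> M \<Longrightarrow> k \<otimes> y \<in> M" and Ms: "\<And>c y. y \<in> M \<Longrightarrow> c \<odot> y \<in> M"
    and Mm: "\<And>y z. y \<in> M \<Longrightarrow> z \<in> M \<Longrightarrow> y \<ominus> z \<in> M"
    and P0: "P \<zero>" and Padd: "\<And>y z. y \<in> carrier A \<Longrightarrow> z \<in> carrier A \<Longrightarrow> P y \<Longrightarrow> P z \<Longrightarrow> P (y \<oplus> z)"
  shows "distinct cs \<Longrightarrow> (\<And>y c. y \<in> M \<Longrightarrow> c \<in> set cs \<Longrightarrow> k \<otimes> y = c \<odot> y \<Longrightarrow> P y) \<Longrightarrow> x \<in> M \<Longrightarrow>
    lprod A (map (\<lambda>c. k \<ominus> c \<odot> \<one>) cs) \<otimes> x = \<zero> \<Longrightarrow> P x"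
proof (induction cs arbitrary: x)
  case Nil
  then show ?case using M P0 by auto
next
  case (Cons c cs)
  let ?L = "\<lambda>ds. lprod A (map (\<lambda>c. k \<ominus> c \<odot> \<one>) ds)"
  have Lc: "?L ds \<in> carrier A" for ds by (rule lprod_closed) (use k in auto)
  have e: "(k \<ominus> d \<odot> \<one>) \<otimes> y = k \<otimes> y \<ominus> d \<odot> y" if "y \<in> carrier A" for d y
    using that k by (simp add: minus_eq l_distr l_minus smult_mult_l)
  have LM: "?L ds \<otimes> y \<in> M" if "y \<in> M" for ds y
    using that
  proof (induction ds)
    case Nil
    then show ?case using M by auto
  next
    case (Cons d ds)
    then have "(k \<ominus> d \<odot> \<one>) \<otimes> (?L ds \<otimes> y) \<in> M" using M Mk Ms Mm by (subst e) auto
    then show ?case using M Cons.prems Lc k by (auto simp: m_assoc)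
  qed
  have xc: "x \<in> carrier A" using Cons.prems M by auto
  let ?y = "?L cs \<otimes> x"
  have yM: "?y \<in> M" using LM Cons.prems by blast
  then have yc: "?y \<in> carrier A" using M by auto
  have "k \<otimes> ?y \<ominus> c \<odot> ?y = \<zero>"
    using Cons.prems(4) e[OF yc] Lc k xc by (simp add: m_assoc)
  then have ky: "k \<otimes> ?y = c \<odot> ?y" using yc k by (simp add: diff_zero_iff)
  let ?d = "prod_list (map (\<lambda>d. c - d) cs)"
  have d: "?d \<noteq> 0" using Cons.prems(1) by (auto simp: prod_list_zero_iff)
  have Ly: "?L cs \<otimes> ?y = ?d \<odot> ?y"
    by (rule lprod_eigen[OF yc]) (use k e[OF yc] ky yc in \<open>auto simp: smult_l_diff\<close>)
  let ?x0 = "inverse ?d \<odot> ?y"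
  have x0: "?x0 \<in> M" "?x0 \<in> carrier A" using Ms[OF yM] yc by auto
  have "k \<otimes> ?x0 = c \<odot> ?x0"
    using ky k yc by (simp add: smult_mult_r mult.commute flip: smult_assoc)
  then have P0: "P ?x0" by (rule Cons.prems(2)[OF x0(1), rotated]) simp
  have "?L cs \<otimes> (x \<ominus> ?x0) = ?y \<ominus> inverse ?d \<odot> (?L cs \<otimes> ?y)"
    using Lc xc yc by (simp add: minus_eq r_distr r_minus smult_mult_r)
  also have "\<dots> = \<zero>" unfolding Ly using d yc by (simp add: minus_eq r_neg flip: smult_assoc)
  finally have z: "?L cs \<otimes> (x \<ominus> ?x0) = \<zero>" .
  have "P (x \<ominus> ?x0)"
  proof (rule Cons.IH[OF _ _ Mm[OF Cons.prems(3) x0(1)] z])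
    show "distinct cs" using Cons.prems(1) by simp
    show "P u" if "u \<in> M" "d \<in> set cs" "k \<otimes> u = d \<odot> u" for u d
      by (rule Cons.prems(2)[OF that(1) _ that(3)]) (simp add: that(2))
  qed
  then have "P ((x \<ominus> ?x0) \<oplus> ?x0)" using P0 xc x0 by (intro Padd) auto
  moreover have "(x \<ominus> ?x0) \<oplus> ?x0 = x" using xc x0 by (simp add: minus_eq a_assoc l_neg)
  ultimately show ?case by simp
qed

text \<open>The algebra is spanned by weight vectors.\<close>

lemma wt_induct:
  assumes P0: "P \<zero>" and Padd: "\<And>y z. y \<in> carrier A \<Longrightarrow> z \<in> carrier A \<Longrightarrow> P y \<Longrightarrow> P z \<Longrightarrow> P (y \<oplus> z)"
    and Pwt: "\<And>l y. y \<in> wt l \<Longrightarrow> P y" and x: "x \<in> carrier A"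
  shows "P x"
proof -
  define W where "W k l = {x \<in> carrier A. \<forall>b\<in>{1..k}. K b \<otimes> x = vsub m b powi l b \<odot> x}" for k l
  have main: "k \<le> m + n \<Longrightarrow> \<forall>l. \<forall>y\<in>W (m+n-k) l. P y" for k
  proof (induction k)
    case 0
    then show ?case using Pwt by (auto simp: W_def wt_def)
  next
    case (Suc k)
    let ?j = "m + n - Suc k" and ?b = "m + n - k"
    have b: "?b \<in> {1..m+n}" "?b = Suc ?j" using Suc.prems by auto
    show ?case
    proof (intro allI ballI)
      fix l y assume y: "y \<in> W ?j l"
      let ?cs = "map (\<lambda>s. vsub m ?b ^ s) [0..<r+1]"
      have Wc: "W ?j l \<subseteq> carrier A" by (auto simp: W_def)
      show "P y"
      proof (rule eigen_induct[where k = "K ?b" and M = "W ?j l" and cs = ?cs])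
        show "K ?b \<in> carrier A" by (rule K_closed[OF b(1)])
        show "W ?j l \<subseteq> carrier A" by (rule Wc)
        show "P \<zero>" by (rule P0)
        show "y \<in> W ?j l" by (rule y)
        show "P (u \<oplus> w)" if "u \<in> carrier A" "w \<in> carrier A" "P u" "P w" for u w
          using that by (rule Padd)
        show "distinct ?cs"
        proof (simp add: distinct_map del: upt_Suc, rule inj_onI)
          fix i j assume "vsub m ?b ^ i = vsub m ?b ^ j"
          then have "vsub m ?b powi int i = vsub m ?b powi int j" by simp
          then show "i = j" using vsub_powi_inj by fastforce
        qed
        show "lprod A (map (\<lambda>c. K ?b \<ominus> c \<odot> \<one>) ?cs) \<otimes> y = \<zero>"
          using each[OF b(1)] y Wc by (simp add: comp_def subset_iff del: upt_Suc)
        fix z assume z: "z \<in> W ?j l"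
        have zc: "z \<in> carrier A" using z Wc by auto
        have zb: "c \<in> {1..m+n} \<and> K c \<otimes> z = vsub m c powi l c \<odot> z" if "c \<in> {1..?j}" for c
          using z that by (auto simp: W_def)
        show "K ?b \<otimes> z \<in> W ?j l"
        proof -
          have "K c \<otimes> (K ?b \<otimes> z) = vsub m c powi l c \<odot> (K ?b \<otimes> z)" if c: "c \<in> {1..?j}" for c
          proof -
            have cc: "c \<in> {1..m+n}" using zb[OF c] by blast
            have "K c \<otimes> (K ?b \<otimes> z) = K ?b \<otimes> (K c \<otimes> z)"
              using KK[OF cc b(1)] K_closed[OF cc] K_closed[OF b(1)] zc by (metis m_assoc)
            then show ?thesis using zb[OF c] zc K_closed[OF b(1)] by (simp add: smult_mult_r)
          qed
          then show ?thesis using zc K_closed[OF b(1)] by (simp add: W_def)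
        qed
        show "d \<odot> z \<in> W ?j l" for d
        proof -
          have "K c \<otimes> (d \<odot> z) = vsub m c powi l c \<odot> (d \<odot> z)" if c: "c \<in> {1..?j}" for c
            using zb[OF c] K_closed[of c] zc
            by (simp add: smult_mult_r mult.commute flip: smult_assoc)
          then show ?thesis using zc by (simp add: W_def)
        qed
        show "z \<ominus> w \<in> W ?j l" if w: "w \<in> W ?j l" for w
        proof -
          have wc: "w \<in> carrier A" using w Wc by auto
          have "K c \<otimes> (z \<ominus> w) = vsub m c powi l c \<odot> (z \<ominus> w)" if c: "c \<in> {1..?j}" for c
          proof -
            have "K c \<otimes> w = vsub m c powi l c \<odot> w" using w c by (auto simp: W_def)
            then show ?thesis using zb[OF c] K_closed[of c] zc wc
              by (simp add: minus_eq r_distr r_minus smult_r_distr smult_minus_right)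
          qed
          then show ?thesis using zc wc by (simp add: W_def)
        qed
        fix c assume c: "c \<in> set ?cs" and kz: "K ?b \<otimes> z = c \<odot> z"
        then obtain s where s: "c = vsub m ?b ^ s" by auto
        have "z \<in> W ?b (l(?b := int s))"
          using z kz s unfolding W_def b(2) by (auto simp: le_Suc_eq)
        then show "P z" using Suc by simp
      qed
    qed
  qed
  have "x \<in> W (m + n - (m + n)) (\<lambda>_. 0)" using x by (simp add: W_def)
  then show ?thesis using main[of "m+n"] by blast
qed

lemma proj_in_wt:
  assumes \<mu>: "(\<Sum>b\<in>{1..m+n}. \<mu> b) = r"
  shows "proj \<mu> \<in> wt (\<lambda>b. int (\<mu> b))"
proof -
  have "proj \<mu> \<otimes> x \<in> wt (\<lambda>b. int (\<mu> b))" if "x \<in> carrier A" for x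
    using that
  proof (rule wt_induct[rotated 3])
    show "proj \<mu> \<otimes> \<zero> \<in> wt (\<lambda>b. int (\<mu> b))"
      using proj_closed by (simp add: wt_def)
  next
    fix y z assume yz: "y \<in> carrier A" "z \<in> carrier A" "proj \<mu> \<otimes> y \<in> wt (\<lambda>b. int (\<mu> b))"
      "proj \<mu> \<otimes> z \<in> wt (\<lambda>b. int (\<mu> b))"
    then show "proj \<mu> \<otimes> (y \<oplus> z) \<in> wt (\<lambda>b. int (\<mu> b))"
      using proj_closed by (simp add: wt_def r_distr smult_r_distr)
  next
    fix l y assume y: "y \<in> wt l"
    show "proj \<mu> \<otimes> y \<in> wt (\<lambda>b. int (\<mu> b))"
    proof (cases "\<exists>b\<in>{1..m+n}. l b \<noteq> int (\<mu> b)")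
      case True
      then show ?thesis using proj_other[OF y \<mu>] by (simp add: wt_def)
    next
      case False
      then have "proj \<mu> \<otimes> y = y" by (intro proj_act[OF y]) auto
      then show ?thesis using wt_cong[OF y] False by simp
    qed
  qed
  from this[of \<one>] show ?thesis using proj_closed by simp
qed

end

section \<open>Comparing modules over two corners\<close>

lemma left_moduleD:
  assumes "left_module A M"
  shows "vector_space (scl M)" "module.subspace (scl M) (mspace M)"
    and "a \<in> carrier A \<Longrightarrow> x \<in> mspace M \<Longrightarrow> act M a x \<in> mspace M"
    and "a \<in> carrier A \<Longrightarrow> x \<in> mspace M \<Longrightarrow> y \<in> mspace M \<Longrightarrow> act M a (x + y) = act M a x + act M a y"
    and "a \<in> carrier A \<Longrightarrow> x \<in> mspace M \<Longrightarrow> act M a (scl M c x) = scl M c (act M a x)"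
    and "a \<in> carrier A \<Longrightarrow> b \<in> carrier A \<Longrightarrow> x \<in> mspace M \<Longrightarrow> act M (a \<otimes>\<^bsub>A\<^esub> b) x = act M a (act M b x)"
  using assms unfolding left_module_def by blast+

text \<open>If \<open>p\<close> and \<open>p'\<close> are mutually inverse between the idempotents \<open>e\<close> and \<open>e'\<close>, and \<open>p\<close>
  intertwines the twisted generators, then \<open>p\<close> induces an isomorphism \<open>eV \<rightarrow> e'V\<close>.\<close>

lemma corner_modules_isomorphic:
  fixes S :: "('f::field, 'a) module" and V :: "('f, 'a, 'v::ab_group_add, 'z) lmod_scheme"
  assumes S: "assoc_alg S" and V: "left_module S V"
    and e: "e \<in> carrier S" "e \<otimes>\<^bsub>S\<^esub> e = e" and e': "e' \<in> carrier S" "e' \<otimes>\<^bsub>S\<^esub> e' = e'"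
    and p: "p \<in> carrier S" "e' \<otimes>\<^bsub>S\<^esub> p = p" "p \<otimes>\<^bsub>S\<^esub> e = p"
    and p': "p' \<in> carrier S" "e \<otimes>\<^bsub>S\<^esub> p' = p'"
    and inv: "p' \<otimes>\<^bsub>S\<^esub> p = e" "p \<otimes>\<^bsub>S\<^esub> p' = e'"
    and t: "hecke_system (corner S e) Q r t" and t': "hecke_system (corner S e') Q r t'"
    and tw: "\<And>i. i \<in> {1..<r} \<Longrightarrow> p \<otimes>\<^bsub>S\<^esub> ((Q - 1) \<odot>\<^bsub>S\<^esub> e \<ominus>\<^bsub>S\<^esub> t i) = t' i \<otimes>\<^bsub>S\<^esub> p"
  shows "lmod_isomorphic (hecke Q r)
     (twist (sharp Q r) (twist (hecke_hom Q r (corner S e) t) (schur_functor e V)))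
     (twist (hecke_hom Q r (corner S e') t') (schur_functor e' V))"
proof -
  interpret S: assoc_alg S by (rule S)
  interpret H: assoc_alg "hecke Q r" by (rule hecke_assoc_alg)
  have C: "assoc_alg (corner S e)" and C': "assoc_alg (corner S e')"
    by (rule S.corner_assoc_alg[OF e] S.corner_assoc_alg[OF e'])+
  interpret C: assoc_alg "corner S e" by (rule C)
  let ?\<sigma> = "sharp Q r" and ?f = "hecke_hom Q r (corner S e) t" and ?g = "hecke_hom Q r (corner S e') t'"
  note cC = S.corner_carrier[OF e] and cC' = S.corner_carrier[OF e']
  have sys: "hecke_system (hecke Q r) Q r (\<lambda>i. (Q - 1) \<odot>\<^bsub>hecke Q r\<^esub> \<one>\<^bsub>hecke Q r\<^esub> \<ominus>\<^bsub>hecke Q r\<^esub> heckeT Q r i)"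
    by (rule H.hecke_system_sharp[OF hecke_system_gens])
  have \<sigma>: "?\<sigma> \<in> alg_hom (hecke Q r) (hecke Q r)"
    "\<And>i. i \<in> {1..<r} \<Longrightarrow> ?\<sigma> (heckeT Q r i) = (Q - 1) \<odot>\<^bsub>hecke Q r\<^esub> \<one>\<^bsub>hecke Q r\<^esub> \<ominus>\<^bsub>hecke Q r\<^esub> heckeT Q r i"
    unfolding sharp_def Let_def by (rule hecke_hom_props[OF hecke_assoc_alg sys], assumption?)+
  have f: "?f \<in> alg_hom (hecke Q r) (corner S e)" "\<And>i. i \<in> {1..<r} \<Longrightarrow> ?f (heckeT Q r i) = t i"
    by (rule hecke_hom_props[OF C t], assumption?)+
  have g: "?g \<in> alg_hom (hecke Q r) (corner S e')" "\<And>i. i \<in> {1..<r} \<Longrightarrow> ?g (heckeT Q r i) = t' i"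
    by (rule hecke_hom_props[OF C' t'], assumption?)+
  interpret f: alg_homomorphism "hecke Q r" "corner S e" ?f
    by (intro alg_homomorphism.intro hecke_assoc_alg C alg_homomorphism_axioms.intro f(1))
  let ?h = "\<lambda>h. ?f (?\<sigma> h)"
  have h: "?h \<in> alg_hom (hecke Q r) (corner S e)" by (rule alg_hom_comp[OF \<sigma>(1) f(1)])
  have hc: "?h x \<in> carrier S" "?h x \<otimes>\<^bsub>S\<^esub> e = ?h x" "e \<otimes>\<^bsub>S\<^esub> ?h x = ?h x" if "x \<in> carrier (hecke Q r)" for x
    using alg_homD(1)[OF h that] unfolding cC by simp_all
  have gc: "?g x \<in> carrier S" "e' \<otimes>\<^bsub>S\<^esub> ?g x = ?g x" if "x \<in> carrier (hecke Q r)" for x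
    using alg_homD(1)[OF g(1) that] unfolding cC' by simp_all
  have inter: "p \<otimes>\<^bsub>S\<^esub> ?h x = ?g x \<otimes>\<^bsub>S\<^esub> p" if "x \<in> carrier (hecke Q r)" for x
    using that
  proof (induction x rule: hecke_induct)
    case one
    show ?case using alg_homD(4)[OF h] alg_homD(4)[OF g(1)] p by simp
  next
    case (gen i)
    have T: "heckeT Q r i \<in> carrier (hecke Q r)" by (rule hecke_systemD(1)[OF hecke_system_gens gen])
    have ec: "e \<in> carrier (corner S e)" using e by (simp add: cC)
    have "?h (heckeT Q r i) = ((Q - 1) \<odot>\<^bsub>corner S e\<^esub> \<one>\<^bsub>corner S e\<^esub>) \<ominus>\<^bsub>corner S e\<^esub> t i"
      unfolding \<sigma>(2)[OF gen] f.hom_minus[OF H.smult_closed[OF H.one_closed] T]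
        f.hom_simps(5)[OF H.one_closed] f.hom_simps(4) f(2)[OF gen] ..
    also have "\<dots> = (Q - 1) \<odot>\<^bsub>S\<^esub> e \<ominus>\<^bsub>S\<^esub> t i"
      using S.corner_minus[OF e C.smult_closed[OF ec] hecke_systemD(1)[OF t gen], of "Q - 1"] by simp
    finally show ?case using tw[OF gen] g(2)[OF gen] by simp
  next
    case (mult x y)
    note xy = hc(1)[OF mult(1)] hc(1)[OF mult(2)] gc(1)[OF mult(1)] gc(1)[OF mult(2)] p(1)
    have "p \<otimes>\<^bsub>S\<^esub> ?h (x \<otimes>\<^bsub>hecke Q r\<^esub> y) = (p \<otimes>\<^bsub>S\<^esub> ?h x) \<otimes>\<^bsub>S\<^esub> ?h y"
      using alg_homD(2)[OF h mult(1,2)] xy by (simp add: S.m_assoc)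
    also have "\<dots> = ?g x \<otimes>\<^bsub>S\<^esub> (p \<otimes>\<^bsub>S\<^esub> ?h y)" unfolding mult(3) using xy by (simp add: S.m_assoc)
    also have "\<dots> = (?g x \<otimes>\<^bsub>S\<^esub> ?g y) \<otimes>\<^bsub>S\<^esub> p" unfolding mult(4) using xy by (simp add: S.m_assoc)
    finally show ?case using alg_homD(2)[OF g(1) mult(1,2)] by simp
  next
    case (add x y)
    note xy = hc(1)[OF add(1)] hc(1)[OF add(2)] gc(1)[OF add(1)] gc(1)[OF add(2)] p(1)
    show ?case
      using alg_homD(3)[OF h add(1,2)] alg_homD(3)[OF g(1) add(1,2)] add(3,4) xy
      by (simp add: S.l_distr S.r_distr)
  next
    case (smult c x)
    note xx = hc(1)[OF smult(1)] gc(1)[OF smult(1)] p(1)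
    show ?case
      using alg_homD(5)[OF h smult(1), of c] alg_homD(5)[OF g(1) smult(1), of c] smult(2) xx
      by (simp add: S.smult_mult_l S.smult_mult_r)
  qed
  note V3 = left_moduleD(3)[OF V] and V4 = left_moduleD(4)[OF V] and V5 = left_moduleD(5)[OF V]
    and V6 = left_moduleD(6)[OF V]
  let ?X = "act V e ` mspace V" and ?Y = "act V e' ` mspace V"
  have X: "x \<in> mspace V \<and> act V e x = x" if x: "x \<in> ?X" for x
  proof -
    obtain y where y: "y \<in> mspace V" "x = act V e y" using x by blast
    show ?thesis using V6[OF e(1) e(1) y(1)] V3[OF e(1) y(1)] unfolding y(2) e(2) by simp
  qed
  have Y: "y \<in> mspace V \<and> act V e' y = y" if y: "y \<in> ?Y" for y
  proof -
    obtain z where z: "z \<in> mspace V" "y = act V e' z" using y by blast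
    show ?thesis using V6[OF e'(1) e'(1) z(1)] V3[OF e'(1) z(1)] unfolding z(2) e'(2) by simp
  qed
  have pX: "act V p x \<in> ?Y" if "x \<in> ?X" for x
  proof -
    have x: "x \<in> mspace V" using X[OF that] by blast
    have "act V p x = act V e' (act V p x)" using V6[OF e'(1) p(1) x] p(2) by simp
    then show ?thesis using V3[OF p(1) x] by blast
  qed
  have pY: "act V p' y \<in> ?X" if "y \<in> ?Y" for y
  proof -
    have y: "y \<in> mspace V" using Y[OF that] by blast
    have "act V p' y = act V e (act V p' y)" using V6[OF e(1) p'(1) y] p'(2) by simp
    then show ?thesis using V3[OF p'(1) y] by blast
  qed
  have bij: "bij_betw (act V p) ?X ?Y"
  proof (rule bij_betw_byWitness[where f' = "act V p'"])
    show "\<forall>x\<in>?X. act V p' (act V p x) = x"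
    proof
      fix x assume "x \<in> ?X"
      then have x: "x \<in> mspace V" "act V e x = x" using X by blast+
      show "act V p' (act V p x) = x" using V6[OF p'(1) p(1) x(1)] unfolding inv x(2) by (rule sym)
    qed
    show "\<forall>y\<in>?Y. act V p (act V p' y) = y"
    proof
      fix y assume "y \<in> ?Y"
      then have y: "y \<in> mspace V" "act V e' y = y" using Y by blast+
      show "act V p (act V p' y) = y" using V6[OF p(1) p'(1) y(1)] unfolding inv y(2) by (rule sym)
    qed
    show "act V p ` ?X \<subseteq> ?Y" using pX by (rule image_subsetI)
    show "act V p' ` ?Y \<subseteq> ?X" using pY by (rule image_subsetI)
  qed
  have act: "act V p (act V (?h a) x) = act V (?g a) (act V p x)"
    if "a \<in> carrier (hecke Q r)" "x \<in> ?X" for a x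
  proof -
    have x: "x \<in> mspace V" using X[OF that(2)] by blast
    show ?thesis
      unfolding V6[OF p(1) hc(1)[OF that(1)] x, symmetric] V6[OF gc(1)[OF that(1)] p(1) x, symmetric]
        inter[OF that(1)] ..
  qed
  show ?thesis
    unfolding lmod_isomorphic_def twist_def schur_functor_def lmod.simps
  proof (intro exI[of _ "act V p"] conjI ballI allI)
    show "bij_betw (act V p) ?X ?Y" by (rule bij)
    show "act V p (x + y) = act V p x + act V p y" if "x \<in> ?X" "y \<in> ?X" for x y
      using V4[OF p(1)] X[OF that(1)] X[OF that(2)] by blast
    show "act V p (scl V c x) = scl V c (act V p x)" if "x \<in> ?X" for c x
      using V5[OF p(1)] X[OF that] by blast
    show "act V p (act V (?h a) x) = act V (?g a) (act V p x)"
      if "a \<in> carrier (hecke Q r)" "x \<in> ?X" for a x by (rule act[OF that])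
  qed
qed

section \<open>Generators of the corners\<close>

context qschur_system
begin

text \<open>The element $1_\mu E_jF_j1_\mu = E_jF_j1_\mu$.\<close>

definition gen :: "(nat \<Rightarrow> nat) \<Rightarrow> nat \<Rightarrow> 'a" where
  "gen \<mu> j = E j \<otimes> (F j \<otimes> proj \<mu>)"

lemma wt_EF:
  assumes x: "x \<in> wt l" and j: "j \<in> {1..<m+n}"
  shows "E j \<otimes> (F j \<otimes> x) \<in> wt l"
proof -
  have "up j (down j l) = l" by (auto simp: up_def down_def)
  then show ?thesis using E_wt[OF F_wt[OF x j] j] by simp
qed

context
  fixes \<mu> :: "nat \<Rightarrow> nat" and s :: nat
  assumes sum_\<mu>: "(\<Sum>b\<in>{1..m+n}. \<mu> b) = r"
begin

lemma proj_mem: "proj \<mu> \<in> wt (\<lambda>b. int (\<mu> b))"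
  by (rule proj_in_wt[OF sum_\<mu>])

lemma proj_fix: "x \<in> wt (\<lambda>b. int (\<mu> b)) \<Longrightarrow> proj \<mu> \<otimes> x = x"
  by (rule proj_act) auto

lemma proj_idem: "proj \<mu> \<otimes> proj \<mu> = proj \<mu>"
  by (rule proj_fix[OF proj_mem])

lemma gen_wt: "j \<in> {1..<m+n} \<Longrightarrow> gen \<mu> j \<in> wt (\<lambda>b. int (\<mu> b))"
  unfolding gen_def by (rule wt_EF[OF proj_mem])

lemma gen_mult:
  assumes j: "j \<in> {1..<m+n}" and x: "x \<in> wt (\<lambda>b. int (\<mu> b))"
  shows "gen \<mu> j \<otimes> x = E j \<otimes> (F j \<otimes> x)"
  using proj_fix[OF x] wt_carrier[OF x] E_closed[OF j] F_closed[OF j] proj_closed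
  by (simp add: gen_def m_assoc)

lemma gen_proj: "j \<in> {1..<m+n} \<Longrightarrow> gen \<mu> j \<otimes> proj \<mu> = gen \<mu> j" "j \<in> {1..<m+n} \<Longrightarrow> proj \<mu> \<otimes> gen \<mu> j = gen \<mu> j"
  using gen_mult[OF _ proj_mem] proj_fix[OF gen_wt] by (simp_all add: gen_def del: atLeastLessThan_iff)

lemma gen_eq: "j \<in> {1..<m+n} \<Longrightarrow> proj \<mu> \<otimes> E j \<otimes> F j \<otimes> proj \<mu> = gen \<mu> j"
  using gen_proj(2)[of j] E_closed[of j] F_closed[of j] proj_closed[of \<mu>]
  by (simp add: gen_def m_assoc del: atLeastLessThan_iff)

lemma gen_quad:
  assumes j: "j \<in> {1..<m+n}" "j \<noteq> m" and \<mu>: "\<mu> j = 1" "\<mu> (j+1) = 1"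
  shows "gen \<mu> j \<otimes> gen \<mu> j = two_q \<odot> gen \<mu> j"
  unfolding gen_mult[OF j(1) gen_wt[OF j(1)]] unfolding gen_def
  by (rule quad_rel[OF proj_mem j]) (use \<mu> in simp_all)

lemma gen_comm:
  assumes i: "i \<in> {1..<m+n}" and j: "j \<in> {1..<m+n}" and "\<bar>int i - int j\<bar> > 1"
  shows "gen \<mu> i \<otimes> gen \<mu> j = gen \<mu> j \<otimes> gen \<mu> i"
  unfolding gen_mult[OF i gen_wt[OF j]] gen_mult[OF j gen_wt[OF i]] unfolding gen_def
  by (rule far_rel[OF proj_closed i j assms(3)])

lemma gen_cubic:
  assumes j: "j \<in> {1..<m+n}" "j + 1 \<in> {1..<m+n}" "j \<noteq> m" "j + 1 \<noteq> m"
    and \<mu>: "\<mu> j = 1" "\<mu> (j+1) = 1" "\<mu> (j+2) = 1"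
  shows "gen \<mu> j \<otimes> gen \<mu> (j+1) \<otimes> gen \<mu> j \<ominus> gen \<mu> j
    = gen \<mu> (j+1) \<otimes> gen \<mu> j \<otimes> gen \<mu> (j+1) \<ominus> gen \<mu> (j+1)"
proof -
  let ?a = "gen \<mu> j" and ?b = "gen \<mu> (j+1)"
  let ?Y = "F (j+1) \<otimes> (E j \<otimes> (F j \<otimes> (E (j+1) \<otimes> proj \<mu>)))"
  note w = gen_wt[OF j(1)] gen_wt[OF j(2)]
  note c = wt_carrier[OF w(1)] wt_carrier[OF w(2)]
  have Yc: "?Y \<in> carrier A"
    using E_closed[OF j(1)] E_closed[OF j(2)] F_closed[OF j(1)] F_closed[OF j(2)] proj_closed by simp
  have w2: "?b \<otimes> ?a \<in> wt (\<lambda>b. int (\<mu> b))" "?a \<otimes> ?b \<in> wt (\<lambda>b. int (\<mu> b))"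
    unfolding gen_mult[OF j(2) w(1)] gen_mult[OF j(1) w(2)] using wt_EF w j by blast+
  have "?a \<otimes> ?b \<otimes> ?a = ?a \<otimes> (?b \<otimes> ?a)" using c by (simp add: m_assoc)
  also have "\<dots> = E j \<otimes> (F j \<otimes> (E (j+1) \<otimes> (F (j+1) \<otimes> (E j \<otimes> (F j \<otimes> proj \<mu>)))))"
    unfolding gen_mult[OF j(1) w2(1)] unfolding gen_mult[OF j(2) w(1)] unfolding gen_def ..
  also have "\<dots> = ?a \<oplus> ?Y"
    unfolding gen_def by (rule cubic_rel1[OF proj_mem j]) (use \<mu> in simp_all)
  finally have 1: "?a \<otimes> ?b \<otimes> ?a = ?a \<oplus> ?Y" .
  have "?b \<otimes> ?a \<otimes> ?b = ?b \<otimes> (?a \<otimes> ?b)" using c by (simp add: m_assoc)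
  also have "\<dots> = E (j+1) \<otimes> (F (j+1) \<otimes> (E j \<otimes> (F j \<otimes> (E (j+1) \<otimes> (F (j+1) \<otimes> proj \<mu>)))))"
    unfolding gen_mult[OF j(2) w2(2)] unfolding gen_mult[OF j(1) w(2)] unfolding gen_def ..
  also have "\<dots> = ?b \<oplus> ?Y"
    unfolding gen_def by (rule cubic_rel2[OF proj_mem j]) (use \<mu> in simp_all)
  finally have 2: "?b \<otimes> ?a \<otimes> ?b = ?b \<oplus> ?Y" .
  show ?thesis unfolding 1 2 using c Yc by algebra
qed

end

lemma omega_wt: "wt (\<lambda>b. int (omega r b)) = wt (block 0)"
  by (auto simp: wt_def omega_def block_def)

lemma omega'_wt: "r \<le> n \<Longrightarrow> wt (\<lambda>b. int (omega' m n r b)) = wt (block (m + n - r))"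
  by (auto simp: wt_def omega'_def block_def)

lemma sum_omega: "r \<le> m \<Longrightarrow> (\<Sum>b\<in>{1..m+n}. omega r b) = r"
proof -
  assume "r \<le> m"
  then have "(\<Sum>b\<in>{1..m+n}. omega r b) = (\<Sum>b\<in>{1..r}. 1)"
    by (intro sum.mono_neutral_cong_right) (auto simp: omega_def)
  then show ?thesis by simp
qed

lemma sum_omega': "r \<le> n \<Longrightarrow> (\<Sum>b\<in>{1..m+n}. omega' m n r b) = r"
proof -
  assume "r \<le> n"
  then have "(\<Sum>b\<in>{1..m+n}. omega' m n r b) = (\<Sum>b\<in>{m+n-r+1..m+n}. 1)"
    by (intro sum.mono_neutral_cong_right) (auto simp: omega'_def)
  then show ?thesis using \<open>r \<le> n\<close> by simp
qed

text \<open>The elements that identify the weight spaces of \<open>\<omega>\<close> and \<open>\<omega>'\<close>.\<close>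

definition forward :: 'a where "forward = shiftF (m + n - r) \<otimes> proj (omega r)"
definition backward :: 'a where "backward = shiftE (m + n - r) \<otimes> proj (omega' m n r)"

context
  assumes rm: "r \<le> m" and rn: "r \<le> n"
begin

lemma forward_wt: "forward \<in> wt (\<lambda>b. int (omega' m n r b))"
  using shiftF_wt[of "proj (omega r)" "m + n - r"] proj_mem[OF sum_omega[OF rm]] rm rn
  unfolding forward_def omega_wt omega'_wt[OF rn] by auto

lemma backward_wt: "backward \<in> wt (\<lambda>b. int (omega r b))"
  using shiftE_wt[of "m + n - r" "proj (omega' m n r)"] proj_mem[OF sum_omega'[OF rn]] rm rn
  unfolding backward_def omega_wt omega'_wt[OF rn] by auto

lemma forward_proj:
  "proj (omega' m n r) \<otimes> forward = forward" "forward \<otimes> proj (omega r) = forward"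
proof -
  show "proj (omega' m n r) \<otimes> forward = forward"
    by (rule proj_fix[OF sum_omega'[OF rn] forward_wt])
  have "shiftF (m+n-r) \<in> carrier A" using shiftF_closed rm by simp
  then show "forward \<otimes> proj (omega r) = forward"
    unfolding forward_def using proj_idem[OF sum_omega[OF rm]] proj_closed by (simp add: m_assoc)
qed

lemma backward_proj: "proj (omega r) \<otimes> backward = backward"
  by (rule proj_fix[OF sum_omega[OF rm] backward_wt])

lemma backward_forward: "backward \<otimes> forward = proj (omega r)"
proof -
  have c: "shiftE (m+n-r) \<in> carrier A" using shiftE_closed rm by simp
  have "backward \<otimes> forward = shiftE (m+n-r) \<otimes> (proj (omega' m n r) \<otimes> forward)"
    unfolding backward_def using c proj_closed wt_carrier[OF forward_wt] by (simp add: m_assoc)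
  also have "\<dots> = proj (omega r)"
    unfolding forward_proj unfolding forward_def
    using shiftF_wt[of "proj (omega r)" "m + n - r"] proj_mem[OF sum_omega[OF rm]] rm unfolding omega_wt by auto
  finally show ?thesis .
qed

lemma forward_backward: "forward \<otimes> backward = proj (omega' m n r)"
proof -
  have c: "shiftF (m+n-r) \<in> carrier A" using shiftF_closed rm by simp
  have "forward \<otimes> backward = shiftF (m+n-r) \<otimes> (proj (omega r) \<otimes> backward)"
    unfolding forward_def using c proj_closed wt_carrier[OF backward_wt] by (simp add: m_assoc)
  also have "\<dots> = proj (omega' m n r)"
    unfolding backward_proj unfolding backward_def
    using shiftE_wt[of "m + n - r" "proj (omega' m n r)"] proj_mem[OF sum_omega'[OF rn]] rm
    unfolding omega'_wt[OF rn] by auto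
  finally show ?thesis .
qed

lemma forward_intertwines:
  assumes i: "i \<in> {1..<r}"
  shows "gen (omega' m n r) (m + n - r + i) \<otimes> forward
    = two_q \<odot> forward \<ominus> forward \<otimes> gen (omega r) i"
proof -
  let ?N = "m + n - r" and ?e = "proj (omega r)"
  have ii: "i \<in> {1..<m+n}" "?N + i \<in> {1..<m+n}" using i rm rn by auto
  have e: "?e \<in> wt (block 0)" using proj_mem[OF sum_omega[OF rm]] unfolding omega_wt .
  have c: "shiftF ?N \<in> carrier A" using shiftF_closed rm by simp
  have "gen (omega' m n r) (?N + i) \<otimes> forward = E (?N+i) \<otimes> (F (?N+i) \<otimes> (shiftF ?N \<otimes> ?e))"
    unfolding gen_mult[OF sum_omega'[OF rn] ii(2) forward_wt] unfolding forward_def ..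
  also have "\<dots> = two_q \<odot> forward \<ominus> shiftF ?N \<otimes> gen (omega r) i"
    using shiftF_intertwines[OF e i rm, of ?N] rm rn unfolding forward_def gen_def by auto
  also have "shiftF ?N \<otimes> gen (omega r) i = forward \<otimes> gen (omega r) i"
    unfolding forward_def
    using gen_proj(2)[OF sum_omega[OF rm] ii(1)] c proj_closed wt_carrier[OF gen_wt[OF sum_omega[OF rm] ii(1)]]
    by (simp add: m_assoc)
  finally show ?thesis .
qed

end

end

section \<open>The quantum group and the \<open>q\<close>-Schur superalgebra\<close>

lemma carrier_update_simps:
  "carrier (A\<lparr>carrier := C\<rparr>) = C" "mult (A\<lparr>carrier := C\<rparr>) = mult A" "one (A\<lparr>carrier := C\<rparr>) = one A"
  "zero (A\<lparr>carrier := C\<rparr>) = zero A" "add (A\<lparr>carrier := C\<rparr>) = add A" "smult (A\<lparr>carrier := C\<rparr>) = smult A"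
  by simp_all

lemma (in assoc_alg) subalgebra_ring:
  assumes C: "C \<subseteq> carrier A" and one: "\<one> \<in> C" and add: "\<And>x y. x \<in> C \<Longrightarrow> y \<in> C \<Longrightarrow> x \<oplus> y \<in> C"
    and mult: "\<And>x y. x \<in> C \<Longrightarrow> y \<in> C \<Longrightarrow> x \<otimes> y \<in> C" and inv: "\<And>x. x \<in> C \<Longrightarrow> \<ominus> x \<in> C"
  shows "ring (A\<lparr>carrier := C\<rparr>)"
    and "\<And>x y. x \<in> C \<Longrightarrow> y \<in> C \<Longrightarrow> a_minus (A\<lparr>carrier := C\<rparr>) x y = x \<ominus> y"
proof -
  have c: "x \<in> carrier A" if "x \<in> C" for x using that C by blast
  have "\<one> \<oplus> \<ominus> \<one> \<in> C" by (rule add[OF one inv[OF one]])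
  then have zero: "\<zero> \<in> C" by (simp add: r_neg)
  show R: "ring (A\<lparr>carrier := C\<rparr>)"
  proof (intro ringI abelian_groupI monoidI; unfold carrier_update_simps)
    show "x \<oplus> y = y \<oplus> x" if "x \<in> C" "y \<in> C" for x y using that c by (simp add: a_comm)
    show "\<exists>y\<in>C. y \<oplus> x = \<zero>" if "x \<in> C" for x
      using inv[OF that] l_neg[OF c[OF that]] by blast
  qed (simp_all add: c add mult one zero a_assoc m_assoc l_distr r_distr)
  interpret R: ring "A\<lparr>carrier := C\<rparr>" by (rule R)
  show "a_minus (A\<lparr>carrier := C\<rparr>) x y = x \<ominus> y" if "x \<in> C" "y \<in> C" for x y
  proof -
    have "a_inv (A\<lparr>carrier := C\<rparr>) y = \<ominus> y"
      by (rule R.add.inv_equality) (use that c inv in \<open>simp_all add: l_neg\<close>)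
    then show ?thesis by (simp add: a_minus_def)
  qed
qed

lemma keys_gens:
  "a \<in> {1..<m+n} \<Longrightarrow> supp (fE a) \<subseteq> lists (qgens m n)"
  "a \<in> {1..<m+n} \<Longrightarrow> supp (fF a) \<subseteq> lists (qgens m n)"
  "b \<in> {1..m+n} \<Longrightarrow> supp (fK b) \<subseteq> lists (qgens m n)"
  "b \<in> {1..m+n} \<Longrightarrow> supp (fKinv b) \<subseteq> lists (qgens m n)"
  "supp (fconst c :: qfree) \<subseteq> lists (qgens m n)"
  by (auto simp: qgens_def)

lemmas qfree_closed = keys_gens keys_add_lists keys_minus_lists keys_free_mult

lemma succ_index: "a \<in> {1..<m+n} \<Longrightarrow> a \<in> {1..m+n}" "a \<in> {1..<m+n} \<Longrightarrow> a + 1 \<in> {1..m+n}" for a m n :: nat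
  by auto

lemma qrels_closed: "qrels m n \<subseteq> carrier (free_alg (qgens m n))"
proof
  fix x assume "x \<in> qrels m n"
  then have "supp x \<subseteq> lists (qgens m n)"
  proof (induction rule: qrels.induct)
    case (EF a b)
    have "supp (if a = b then fconst (1 / (vsub m a - inverse (vsub m a)))
        \<star> (fK a \<star> fKinv (a+1) - fKinv a \<star> fK (a+1)) else 0) \<subseteq> lists (qgens m n)"
    proof (cases "a = b")
      case True
      show ?thesis unfolding if_P[OF True]
        by (intro qfree_closed succ_index EF(1))
    qed simp
    moreover have "supp (sbracket (a = m) (b = m) (fE a) (fF b)) \<subseteq> lists (qgens m n)"
    proof (cases "a = m \<and> b = m")
      case True
      show ?thesis unfolding sbracket_def if_P[OF True] by (intro qfree_closed EF(1,2))
    next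
      case False
      show ?thesis unfolding sbracket_def if_not_P[OF False] by (intro qfree_closed EF(1,2))
    qed
    ultimately show ?case by (rule keys_minus_lists[rotated])
  next
    case superE
    then have i: "m - 1 \<in> {1..<m+n}" "m \<in> {1..<m+n}" "m + 1 \<in> {1..<m+n}" by auto
    show ?case unfolding sbracket_def Eodd_def simp_thms if_True by (intro qfree_closed i)
  next
    case superF
    then have i: "m - 1 \<in> {1..<m+n}" "m \<in> {1..<m+n}" "m + 1 \<in> {1..<m+n}" by auto
    show ?case unfolding sbracket_def Fodd_def simp_thms if_True by (intro qfree_closed i)
  qed (intro qfree_closed; assumption)+
  then show "x \<in> carrier (free_alg (qgens m n))" by simp
qed

lemma laurent_const: "laurent x [:c:] 0 = of_int c"
  by (simp add: laurent_def map_poly_pCons)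

lemma laurent_two: "x \<noteq> 0 \<Longrightarrow> laurent x [:1, 0, 1:] 1 = x + inverse x"
  by (simp add: laurent_def map_poly_pCons field_simps)

lemma zsubalg_closed:
  assumes A: "assoc_alg A" and G: "G \<subseteq> carrier A" and x: "x \<in> zsubalg A G"
  shows "x \<in> carrier A"
proof -
  interpret assoc_alg A by (rule A)
  show ?thesis using x by induction (use G in auto)
qed

lemma (in ring) add_sub_cancel:
  assumes "x \<in> carrier R" "y \<in> carrier R" "z \<in> carrier R"
  shows "x \<ominus> y \<ominus> (z \<ominus> y) = x \<oplus> y \<ominus> z \<ominus> y"
  using assms by algebra

context
  fixes m n r :: nat
begin

abbreviation (input) "U \<equiv> Ualg m n"
abbreviation (input) "S \<equiv> Salg m n r"
abbreviation (input) "SZr \<equiv> SZ m n r"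

lemma U_ideal: "alg_ideal (free_alg (qgens m n)) (Uideal m n)"
  unfolding Uideal_def by (rule alg_idealI[OF free_alg_assoc_alg qrels_closed])

lemma U_assoc_alg: "assoc_alg U"
  unfolding Ualg_def by (rule alg_ideal.quot_assoc_alg[OF U_ideal])

interpretation U: assoc_alg U by (rule U_assoc_alg)

lemma ucls_hom: "ucls m n \<in> alg_hom (free_alg (qgens m n)) U"
  using alg_ideal.cls_hom[OF U_ideal] unfolding Ualg_def ucls_def[abs_def] .

lemma ucls_closed: "supp f \<subseteq> lists (qgens m n) \<Longrightarrow> ucls m n f \<in> carrier U"
  by (rule free_hom_simps(6)[OF ucls_hom U_assoc_alg])

lemma u_closed:
  "a \<in> {1..<m+n} \<Longrightarrow> uE m n a \<in> carrier U" "a \<in> {1..<m+n} \<Longrightarrow> uF m n a \<in> carrier U"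
  "b \<in> {1..m+n} \<Longrightarrow> uK m n b \<in> carrier U" "b \<in> {1..m+n} \<Longrightarrow> uKinv m n b \<in> carrier U"
  by (rule ucls_closed, rule keys_gens, assumption)+

lemma Srels_closed: "Srels m n r \<subseteq> carrier U"
proof
  fix x assume "x \<in> Srels m n r"
  then show "x \<in> carrier U"
  proof cases
    case total
    have "set (map (uK m n) [1..<m+1] @ map (uKinv m n) [m+1..<m+n+1]) \<subseteq> carrier U"
      using u_closed by auto
    then show ?thesis
      unfolding total by (intro U.minus_closed U.lprod_closed U.smult_closed U.one_closed)
  next
    case (each a)
    have "set (map (\<lambda>s. uK m n a \<ominus>\<^bsub>U\<^esub> (vsub m a ^ s) \<odot>\<^bsub>U\<^esub> \<one>\<^bsub>U\<^esub>) [0..<r+1]) \<subseteq> carrier U"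
      using u_closed(3)[OF each(2)] by auto
    then show ?thesis unfolding each(1) by (rule U.lprod_closed)
  qed
qed

lemma S_ideal: "alg_ideal U (Sideal m n r)"
  unfolding Sideal_def by (rule alg_idealI[OF U_assoc_alg Srels_closed])

lemma S_assoc_alg: "assoc_alg S"
  unfolding Salg_def by (rule alg_ideal.quot_assoc_alg[OF S_ideal])

interpretation S: assoc_alg S by (rule S_assoc_alg)

lemma eta_hom: "eta m n r \<in> alg_hom U S"
  using alg_ideal.cls_hom[OF S_ideal] unfolding Salg_def eta_def[abs_def] .

interpretation eta: alg_homomorphism U S "eta m n r"
  by (intro alg_homomorphism.intro U_assoc_alg S_assoc_alg alg_homomorphism_axioms.intro eta_hom)

lemma eta_rel: "x \<in> Srels m n r \<Longrightarrow> eta m n r x = \<zero>\<^bsub>S\<^esub>"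
  using alg_ideal.cls_zero[OF S_ideal] U.genideal_self[OF Srels_closed]
  unfolding Salg_def eta_def Sideal_def by blast

text \<open>The image in the \<open>q\<close>-Schur superalgebra of a noncommutative polynomial in the generators.\<close>

definition sch :: "qfree \<Rightarrow> sel" where "sch f = eta m n r (ucls m n f)"

lemma sch_hom: "sch \<in> alg_hom (free_alg (qgens m n)) S"
  unfolding sch_def[abs_def] by (rule alg_hom_comp[OF ucls_hom eta_hom])

lemmas sch_simps = free_hom_simps[OF sch_hom S_assoc_alg]

lemma sch_rel:
  assumes "x \<in> qrels m n" shows "sch x = \<zero>\<^bsub>S\<^esub>"
proof -
  interpret I: alg_ideal "free_alg (qgens m n)" "Uideal m n" by (rule U_ideal)
  have "x \<in> Uideal m n" unfolding Uideal_def using I.genideal_self[OF qrels_closed] assms by blast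
  then have "ucls m n x = \<zero>\<^bsub>U\<^esub>" unfolding ucls_def Ualg_def by (rule I.cls_zero)
  then show ?thesis unfolding sch_def by simp
qed

abbreviation "sE a \<equiv> sch (fE a)"
abbreviation "sF a \<equiv> sch (fF a)"
abbreviation "sK a \<equiv> sch (fK a)"
abbreviation "sKi a \<equiv> sch (fKinv a)"

lemma s_closed:
  "a \<in> {1..<m+n} \<Longrightarrow> sE a \<in> carrier S" "a \<in> {1..<m+n} \<Longrightarrow> sF a \<in> carrier S"
  "b \<in> {1..m+n} \<Longrightarrow> sK b \<in> carrier S" "b \<in> {1..m+n} \<Longrightarrow> sKi b \<in> carrier S"
  by (rule sch_simps(6), rule keys_gens, assumption)+

text \<open>The value of the superbracket of $E_a$ and $F_a$.\<close>

definition EF_rhs :: "nat \<Rightarrow> sel" where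
  "EF_rhs a = (1 / (vsub m a - inverse (vsub m a))) \<odot>\<^bsub>S\<^esub> (sK a \<otimes>\<^bsub>S\<^esub> sKi (a+1) \<ominus>\<^bsub>S\<^esub> sKi a \<otimes>\<^bsub>S\<^esub> sK (a+1))"

lemma EF_rhs:
  assumes a: "a \<in> {1..<m+n}"
  shows "sch (fconst (1 / (vsub m a - inverse (vsub m a))) \<star> (fK a \<star> fKinv (a+1) - fKinv a \<star> fK (a+1))) = EF_rhs a"
    and "supp (fconst (1 / (vsub m a - inverse (vsub m a)))
                \<star> (fK a \<star> fKinv (a+1) - fKinv a \<star> fK (a+1))) \<subseteq> lists (qgens m n)"
    and "EF_rhs a \<in> carrier S"
proof -
  note a' = succ_index[OF a]
  note ca = s_closed(1,2)[OF a] s_closed(3,4)[OF a'(1)] s_closed(3,4)[OF a'(2)]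
  show "EF_rhs a \<in> carrier S" unfolding EF_rhs_def using ca by (intro S.smult_closed S.minus_closed S.m_closed)
  show "sch (fconst (1 / (vsub m a - inverse (vsub m a))) \<star> (fK a \<star> fKinv (a+1) - fKinv a \<star> fK (a+1))) = EF_rhs a"
    using a a' ca
    by (simp only: EF_rhs_def sch_simps qfree_closed S.smult_mult_l S.minus_closed S.m_closed S.one_closed S.l_one)
  show "supp (fconst (1 / (vsub m a - inverse (vsub m a)))
                \<star> (fK a \<star> fKinv (a+1) - fKinv a \<star> fK (a+1))) \<subseteq> lists (qgens m n)"
    by (intro qfree_closed a a')
qed

lemma sEF_odd:
  assumes a: "m \<in> {1..<m+n}"
  shows "sE m \<otimes>\<^bsub>S\<^esub> sF m \<oplus>\<^bsub>S\<^esub> sF m \<otimes>\<^bsub>S\<^esub> sE m = EF_rhs m"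
proof -
  note ca = s_closed(1,2)[OF a]
  have "(sE m \<otimes>\<^bsub>S\<^esub> sF m \<oplus>\<^bsub>S\<^esub> sF m \<otimes>\<^bsub>S\<^esub> sE m) \<ominus>\<^bsub>S\<^esub> EF_rhs m = \<zero>\<^bsub>S\<^esub>"
    using sch_rel[OF qrels.EF[OF a a]] a EF_rhs(2)[OF a]
    by (simp only: sbracket_def simp_thms if_True sch_simps(1,2,3) EF_rhs(1)[OF a] qfree_closed)
  then show ?thesis
    using ca EF_rhs(3)[OF a] S.diff_zero_iff[of "sE m \<otimes>\<^bsub>S\<^esub> sF m \<oplus>\<^bsub>S\<^esub> sF m \<otimes>\<^bsub>S\<^esub> sE m" "EF_rhs m"]
    by blast
qed

lemma sEF_even:
  assumes a: "a \<in> {1..<m+n}" "a \<noteq> m"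
  shows "sE a \<otimes>\<^bsub>S\<^esub> sF a \<ominus>\<^bsub>S\<^esub> sF a \<otimes>\<^bsub>S\<^esub> sE a = EF_rhs a"
proof -
  note ca = s_closed(1,2)[OF a(1)]
  have b: "\<not> (a = m \<and> a = m)" using a by blast
  have "(sE a \<otimes>\<^bsub>S\<^esub> sF a \<ominus>\<^bsub>S\<^esub> sF a \<otimes>\<^bsub>S\<^esub> sE a) \<ominus>\<^bsub>S\<^esub> EF_rhs a = \<zero>\<^bsub>S\<^esub>"
    using sch_rel[OF qrels.EF[OF a(1) a(1)]] a(1) EF_rhs(2)[OF a(1)]
    by (simp only: sbracket_def if_not_P[OF b] if_not_P[OF a(2)] simp_thms if_True sch_simps(1,2,3) EF_rhs(1)[OF a(1)] qfree_closed)
  then show ?thesis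
    using ca EF_rhs(3)[OF a(1)] S.diff_zero_iff[of "sE a \<otimes>\<^bsub>S\<^esub> sF a \<ominus>\<^bsub>S\<^esub> sF a \<otimes>\<^bsub>S\<^esub> sE a" "EF_rhs a"]
    by blast
qed

lemma qschur: "qschur_system S m n r sE sF sK sKi"
proof (intro qschur_system.intro S_assoc_alg qschur_system_axioms.intro)
  fix a c assume a: "a \<in> {1..<m+n}"
  note a' = succ_index[OF a]
  show "sE a \<in> carrier S" "sF a \<in> carrier S" by (rule s_closed(1,2)[OF a])+
  note ca = s_closed(1,2)[OF a] s_closed(3,4)[OF a'(1)] s_closed(3,4)[OF a'(2)]
  show "sE a \<otimes>\<^bsub>S\<^esub> sF a \<ominus>\<^bsub>S\<^esub> sF a \<otimes>\<^bsub>S\<^esub> sE a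
    = (1 / (vsub m a - inverse (vsub m a))) \<odot>\<^bsub>S\<^esub> (sK a \<otimes>\<^bsub>S\<^esub> sKi (a+1) \<ominus>\<^bsub>S\<^esub> sKi a \<otimes>\<^bsub>S\<^esub> sK (a+1))"
    if "a \<noteq> m" using sEF_even[OF a that] unfolding EF_rhs_def .
  assume c: "c \<in> {1..<m+n}"
  note cc = s_closed(1,2)[OF c]
  show "sE a \<otimes>\<^bsub>S\<^esub> sF c = sF c \<otimes>\<^bsub>S\<^esub> sE a" if "a \<noteq> c"
  proof -
    have b: "\<not> (a = m \<and> c = m)" using that by blast
    have "(sE a \<otimes>\<^bsub>S\<^esub> sF c \<ominus>\<^bsub>S\<^esub> sF c \<otimes>\<^bsub>S\<^esub> sE a) \<ominus>\<^bsub>S\<^esub> \<zero>\<^bsub>S\<^esub> = \<zero>\<^bsub>S\<^esub>"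
      using sch_rel[OF qrels.EF[OF a c]] a c
      by (simp only: sbracket_def if_not_P[OF b] if_not_P[OF that] sch_simps(1,3,5) qfree_closed keys_zero empty_subsetI)
    then show ?thesis using ca cc S.diff_zero_iff by (simp add: S.minus_eq[of _ "\<zero>\<^bsub>S\<^esub>"])
  qed
  show "sE a \<otimes>\<^bsub>S\<^esub> sE c = sE c \<otimes>\<^bsub>S\<^esub> sE a" if "\<bar>int a - int c\<bar> > 1"
  proof -
    have "sE a \<otimes>\<^bsub>S\<^esub> sE c \<ominus>\<^bsub>S\<^esub> sE c \<otimes>\<^bsub>S\<^esub> sE a = \<zero>\<^bsub>S\<^esub>"
      using sch_rel[OF qrels.EE[OF a c that]] a c by (simp only: sch_simps(1,3) qfree_closed)
    then show ?thesis using ca cc S.diff_zero_iff by simp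
  qed
  show "sF a \<otimes>\<^bsub>S\<^esub> sF c = sF c \<otimes>\<^bsub>S\<^esub> sF a" if "\<bar>int a - int c\<bar> > 1"
  proof -
    have "sF a \<otimes>\<^bsub>S\<^esub> sF c \<ominus>\<^bsub>S\<^esub> sF c \<otimes>\<^bsub>S\<^esub> sF a = \<zero>\<^bsub>S\<^esub>"
      using sch_rel[OF qrels.FF[OF a c that]] a c by (simp only: sch_simps(1,3) qfree_closed)
    then show ?thesis using ca cc S.diff_zero_iff by simp
  qed
  show "sE a \<otimes>\<^bsub>S\<^esub> sE a \<otimes>\<^bsub>S\<^esub> sE c \<oplus>\<^bsub>S\<^esub> sE c \<otimes>\<^bsub>S\<^esub> sE a \<otimes>\<^bsub>S\<^esub> sE a
      = (vsub m a + inverse (vsub m a)) \<odot>\<^bsub>S\<^esub> (sE a \<otimes>\<^bsub>S\<^esub> sE c \<otimes>\<^bsub>S\<^esub> sE a)"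
    if "a \<noteq> m" "\<bar>int a - int c\<bar> = 1"
  proof -
    let ?x = "sE a \<otimes>\<^bsub>S\<^esub> sE a \<otimes>\<^bsub>S\<^esub> sE c" and ?z = "sE c \<otimes>\<^bsub>S\<^esub> sE a \<otimes>\<^bsub>S\<^esub> sE a"
      and ?y = "(vsub m a + inverse (vsub m a)) \<odot>\<^bsub>S\<^esub> (sE a \<otimes>\<^bsub>S\<^esub> sE c \<otimes>\<^bsub>S\<^esub> sE a)"
    have "?x \<ominus>\<^bsub>S\<^esub> ?y \<oplus>\<^bsub>S\<^esub> ?z = \<zero>\<^bsub>S\<^esub>"
      using sch_rel[OF qrels.SerreE[OF a c that]] a c ca cc
      by (simp only: sch_simps qfree_closed S.smult_mult_l S.m_closed S.one_closed S.l_one S.smult_closed)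
    moreover have "?x \<in> carrier S" "?y \<in> carrier S" "?z \<in> carrier S" using ca cc by auto
    moreover have "?x \<ominus>\<^bsub>S\<^esub> ?y \<oplus>\<^bsub>S\<^esub> ?z = (?x \<oplus>\<^bsub>S\<^esub> ?z) \<ominus>\<^bsub>S\<^esub> ?y"
      if "?x \<in> carrier S" "?y \<in> carrier S" "?z \<in> carrier S"
      using that by algebra
    ultimately show ?thesis using S.diff_zero_iff by (metis S.a_closed)
  qed
next
  fix b c assume b: "b \<in> {1..m+n}"
  show "sK b \<in> carrier S" "sKi b \<in> carrier S" by (rule s_closed(3,4)[OF b])+
  note cb = s_closed(3,4)[OF b]
  show "sKi b \<otimes>\<^bsub>S\<^esub> sK b = \<one>\<^bsub>S\<^esub>"
  proof -
    have "sKi b \<otimes>\<^bsub>S\<^esub> sK b \<ominus>\<^bsub>S\<^esub> \<one>\<^bsub>S\<^esub> = \<zero>\<^bsub>S\<^esub>"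
      using sch_rel[OF qrels.KinvK[OF b]] b by (simp only: sch_simps qfree_closed S.smult_one S.one_closed)
    then show ?thesis using cb S.diff_zero_iff by simp
  qed
  show "lprod S (map (\<lambda>s. sK b \<ominus>\<^bsub>S\<^esub> vsub m b ^ s \<odot>\<^bsub>S\<^esub> \<one>\<^bsub>S\<^esub>) [0..<r+1]) = \<zero>\<^bsub>S\<^esub>"
  proof -
    let ?xs = "map (\<lambda>s. uK m n b \<ominus>\<^bsub>U\<^esub> (vsub m b ^ s) \<odot>\<^bsub>U\<^esub> \<one>\<^bsub>U\<^esub>) [0..<r+1]"
    have xs: "set ?xs \<subseteq> carrier U" using u_closed(3)[OF b] by auto
    have "\<zero>\<^bsub>S\<^esub> = lprod S (map (eta m n r) ?xs)"
      using eta_rel[OF Srels.each[OF b]] unfolding eta.hom_lprod[OF xs] by (rule sym)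
    also have "map (eta m n r) ?xs = map (\<lambda>s. sK b \<ominus>\<^bsub>S\<^esub> vsub m b ^ s \<odot>\<^bsub>S\<^esub> \<one>\<^bsub>S\<^esub>) [0..<r+1]"
      using u_closed(3)[OF b] by (simp add: eta.hom_minus eta.hom_simps(4,5) sch_def comp_def del: upt_Suc)
    finally show ?thesis by (rule sym)
  qed
  show "sK b \<otimes>\<^bsub>S\<^esub> sK c = sK c \<otimes>\<^bsub>S\<^esub> sK b" if c: "c \<in> {1..m+n}"
  proof -
    have "sK b \<otimes>\<^bsub>S\<^esub> sK c \<ominus>\<^bsub>S\<^esub> sK c \<otimes>\<^bsub>S\<^esub> sK b = \<zero>\<^bsub>S\<^esub>"
      using sch_rel[OF qrels.KK[OF b c]] b c by (simp only: sch_simps(1,3) qfree_closed)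
    then show ?thesis using cb s_closed(3)[OF c] S.diff_zero_iff by simp
  qed
  fix a assume a: "a \<in> {1..<m+n}"
  note ca = s_closed(1,2)[OF a]
  show "sK b \<otimes>\<^bsub>S\<^esub> sE a = (vv powi eps_alpha m b a) \<odot>\<^bsub>S\<^esub> (sE a \<otimes>\<^bsub>S\<^esub> sK b)"
  proof -
    have "sK b \<otimes>\<^bsub>S\<^esub> sE a \<ominus>\<^bsub>S\<^esub> (vv powi eps_alpha m b a) \<odot>\<^bsub>S\<^esub> (sE a \<otimes>\<^bsub>S\<^esub> sK b) = \<zero>\<^bsub>S\<^esub>"
      using sch_rel[OF qrels.KE[OF b a]] a b ca cb
      by (simp only: sch_simps qfree_closed S.smult_mult_l S.m_closed S.one_closed S.l_one S.smult_closed)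
    then show ?thesis using ca cb S.diff_zero_iff by simp
  qed
  show "sK b \<otimes>\<^bsub>S\<^esub> sF a = (vv powi (- eps_alpha m b a)) \<odot>\<^bsub>S\<^esub> (sF a \<otimes>\<^bsub>S\<^esub> sK b)"
  proof -
    have "sK b \<otimes>\<^bsub>S\<^esub> sF a \<ominus>\<^bsub>S\<^esub> (vv powi (- eps_alpha m b a)) \<odot>\<^bsub>S\<^esub> (sF a \<otimes>\<^bsub>S\<^esub> sK b) = \<zero>\<^bsub>S\<^esub>"
      using sch_rel[OF qrels.KF[OF b a]] a b ca cb
      by (simp only: sch_simps qfree_closed S.smult_mult_l S.m_closed S.one_closed S.l_one S.smult_closed)
    then show ?thesis using ca cb S.diff_zero_iff by simp
  qed
next
  show "sE m \<otimes>\<^bsub>S\<^esub> sF m \<oplus>\<^bsub>S\<^esub> sF m \<otimes>\<^bsub>S\<^esub> sE m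
    = (1 / (vsub m m - inverse (vsub m m))) \<odot>\<^bsub>S\<^esub> (sK m \<otimes>\<^bsub>S\<^esub> sKi (m+1) \<ominus>\<^bsub>S\<^esub> sKi m \<otimes>\<^bsub>S\<^esub> sK (m+1))"
    if "m \<in> {1..<m+n}" using sEF_odd[OF that] unfolding EF_rhs_def .
next
  let ?xs = "map (uK m n) [1..<m+1] @ map (uKinv m n) [m+1..<m+n+1]"
  have xs: "set ?xs \<subseteq> carrier U" using u_closed by auto
  have "eta m n r (lprod U ?xs) \<ominus>\<^bsub>S\<^esub> vv ^ r \<odot>\<^bsub>S\<^esub> \<one>\<^bsub>S\<^esub> = \<zero>\<^bsub>S\<^esub>"
    using eta_rel[OF Srels.total] U.lprod_closed[OF xs]
    by (simp only: eta.hom_minus eta.hom_simps(4,5) U.smult_closed U.one_closed)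
  then have "eta m n r (lprod U ?xs) = vv ^ r \<odot>\<^bsub>S\<^esub> \<one>\<^bsub>S\<^esub>"
    using eta.hom_simps(1)[OF U.lprod_closed[OF xs]] S.diff_zero_iff by simp
  then show "lprod S (map sK [1..<m+1] @ map sKi [m+1..<m+n+1]) = vv ^ r \<odot>\<^bsub>S\<^esub> \<one>\<^bsub>S\<^esub>"
    unfolding eta.hom_lprod[OF xs] by (simp add: sch_def comp_def del: upt_Suc)
qed

interpretation Q: qschur_system S m n r sE sF sK sKi
  by (rule qschur)

section \<open>The integral form and its specialisation\<close>

lemma Kbinom_factor_closed:
  assumes b: "b \<in> {1..m+n}"
  shows "c \<odot>\<^bsub>U\<^esub> (d \<odot>\<^bsub>U\<^esub> uK m n b \<ominus>\<^bsub>U\<^esub> d' \<odot>\<^bsub>U\<^esub> uKinv m n b) \<in> carrier U"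
  using u_closed(3,4)[OF b] by simp

lemma Kbinom_closed: "b \<in> {1..m+n} \<Longrightarrow> Kbinom m n b t \<in> carrier U"
  unfolding Kbinom_def Let_def by (rule U.lprod_closed) (use Kbinom_factor_closed in auto)

lemma eta_Kbinom:
  assumes b: "b \<in> {1..m+n}"
  shows "eta m n r (Kbinom m n b t) = Q.kbinom b t"
proof -
  let ?g = "\<lambda>s. (1 / (vsub m b ^ s - inverse (vsub m b) ^ s)) \<odot>\<^bsub>U\<^esub>
         ((vsub m b powi (1 - int s)) \<odot>\<^bsub>U\<^esub> uK m n b
           \<ominus>\<^bsub>U\<^esub> (vsub m b powi (int s - 1)) \<odot>\<^bsub>U\<^esub> uKinv m n b)"
  have "eta m n r (lprod U (map ?g [1..<t+1])) = lprod S (map (eta m n r) (map ?g [1..<t+1]))"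
    by (rule eta.hom_lprod) (use Kbinom_factor_closed[OF b] in auto)
  also have "map (eta m n r) (map ?g [1..<t+1]) = map (\<lambda>s. eta m n r (?g s)) [1..<t+1]" by simp
  also have "(\<lambda>s. eta m n r (?g s)) = (\<lambda>s. (1 / (vsub m b ^ s - inverse (vsub m b) ^ s)) \<odot>\<^bsub>S\<^esub>
         ((vsub m b powi (1 - int s)) \<odot>\<^bsub>S\<^esub> sK b
           \<ominus>\<^bsub>S\<^esub> (vsub m b powi (int s - 1)) \<odot>\<^bsub>S\<^esub> sKi b))"
    using u_closed(3,4)[OF b]
    by (intro ext) (simp only: eta.hom_simps(5) eta.hom_minus U.smult_closed U.minus_closed sch_def)
  finally show ?thesis unfolding Kbinom_def Let_def Q.kbinom_def .
qed

lemma eta_proj: "eta m n r (lprod U (map (\<lambda>a. Kbinom m n a (l a)) [1..<m+n+1])) = Q.proj l"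
proof -
  have c: "set (map (\<lambda>a. Kbinom m n a (l a)) [1..<m+n+1]) \<subseteq> carrier U"
    using Kbinom_closed by auto
  have mp: "map (eta m n r) (map (\<lambda>a. Kbinom m n a (l a)) [1..<m+n+1]) = map (\<lambda>a. Q.kbinom a (l a)) [1..<m+n+1]"
    using eta_Kbinom by auto
  show ?thesis unfolding eta.hom_lprod[OF c] mp Q.proj_def ..
qed

abbreviation "UZgens \<equiv> {divpow U (uE m n i) M | i M. i \<in> {1..<m+n}}
      \<union> {divpow U (uF m n i) M | i M. i \<in> {1..<m+n}}
      \<union> uK m n ` {1..m+n} \<union> uKinv m n ` {1..m+n}
      \<union> {Kbinom m n j t | j t. j \<in> {1..m+n}}"

lemma UZ_closed: "x \<in> UZ m n \<Longrightarrow> x \<in> carrier U"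
  unfolding UZ_def
proof (rule zsubalg_closed[OF U_assoc_alg])
  have d: "divpow U x M \<in> carrier U" if "x \<in> carrier U" for x M
    unfolding divpow_def using that by (intro U.smult_closed U.nat_pow_closed)
  show "UZgens \<subseteq> carrier U"
  proof (rule subsetI, elim UnE CollectE imageE exE conjE)
    fix x i M assume "x = divpow U (uE m n i) M" "i \<in> {1..<m+n}"
    then show "x \<in> carrier U" by (simp only: d[OF u_closed(1)])
  next
    fix x i M assume "x = divpow U (uF m n i) M" "i \<in> {1..<m+n}"
    then show "x \<in> carrier U" by (simp only: d[OF u_closed(2)])
  qed (simp_all only: u_closed Kbinom_closed)
qed

text \<open>Since $[1]! = 1$, the generators $E_a$ and $F_a$ are among the divided powers.\<close>

lemma divpow_1: "x \<in> carrier U \<Longrightarrow> divpow U x 1 = x"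
proof -
  assume "x \<in> carrier U"
  moreover have "qfact 1 = 1"
    using vsub_diff_nonzero[of 1 1] by (simp add: qfact_def vsub_def sg_def)
  ultimately show ?thesis by (simp add: divpow_def)
qed

lemma UZ_mem:
  "a \<in> {1..<m+n} \<Longrightarrow> uE m n a \<in> UZ m n"
  "a \<in> {1..<m+n} \<Longrightarrow> uF m n a \<in> UZ m n"
  "b \<in> {1..m+n} \<Longrightarrow> Kbinom m n b t \<in> UZ m n"
proof -
  show "uE m n a \<in> UZ m n" if a: "a \<in> {1..<m+n}"
  proof -
    have "divpow U (uE m n a) 1 \<in> UZ m n"
      unfolding UZ_def by (rule zsubalg.gen) (use a in blast)
    then show ?thesis unfolding divpow_1[OF u_closed(1)[OF a]] .
  qed
  show "uF m n a \<in> UZ m n" if a: "a \<in> {1..<m+n}"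
  proof -
    have "divpow U (uF m n a) 1 \<in> UZ m n"
      unfolding UZ_def by (rule zsubalg.gen) (use a in blast)
    then show ?thesis unfolding divpow_1[OF u_closed(2)[OF a]] .
  qed
  show "Kbinom m n b t \<in> UZ m n" if "b \<in> {1..m+n}"
    unfolding UZ_def by (rule zsubalg.gen) (use that in blast)
qed

lemma SZ_simps:
  "mult SZr = mult S" "add SZr = add S"
  "one SZr = one S" "smult SZr = smult S"
  by (simp_all add: SZ_def)

lemma SZ_carrier: "carrier SZr = eta m n r ` UZ m n"
  by (simp add: SZ_def)

lemma SZ_sub: "carrier SZr \<subseteq> carrier S"
  unfolding SZ_carrier using eta.hom_simps(1) UZ_closed by blast

lemma SZ_add:
  assumes "x \<in> carrier SZr" "y \<in> carrier SZr"
  shows "x \<oplus>\<^bsub>S\<^esub> y \<in> carrier SZr"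
proof -
  obtain u w where u: "u \<in> UZ m n" "x = eta m n r u" and w: "w \<in> UZ m n" "y = eta m n r w"
    using assms unfolding SZ_carrier by blast
  have "u \<oplus>\<^bsub>U\<^esub> w \<in> UZ m n" using u w unfolding UZ_def by (intro zsubalg.add)
  then show ?thesis
    unfolding u(2) w(2) SZ_carrier eta.hom_simps(3)[OF UZ_closed[OF u(1)] UZ_closed[OF w(1)], symmetric]
    by (rule imageI)
qed

lemma SZ_mult:
  assumes "x \<in> carrier SZr" "y \<in> carrier SZr"
  shows "x \<otimes>\<^bsub>S\<^esub> y \<in> carrier SZr"
proof -
  obtain u w where u: "u \<in> UZ m n" "x = eta m n r u" and w: "w \<in> UZ m n" "y = eta m n r w"
    using assms unfolding SZ_carrier by blast
  have "u \<otimes>\<^bsub>U\<^esub> w \<in> UZ m n" using u w unfolding UZ_def by (intro zsubalg.mult)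
  then show ?thesis
    unfolding u(2) w(2) SZ_carrier eta.hom_simps(2)[OF UZ_closed[OF u(1)] UZ_closed[OF w(1)], symmetric]
    by (rule imageI)
qed

lemma SZ_one: "\<one>\<^bsub>S\<^esub> \<in> carrier SZr"
proof -
  have "\<one>\<^bsub>U\<^esub> \<in> UZ m n" unfolding UZ_def by (rule zsubalg.one)
  then show ?thesis unfolding SZ_carrier eta.hom_simps(4)[symmetric] by (rule imageI)
qed

lemma SZ_laurent:
  assumes "x \<in> carrier SZr"
  shows "laurent vv p k \<odot>\<^bsub>S\<^esub> x \<in> carrier SZr"
proof -
  obtain u where u: "u \<in> UZ m n" "x = eta m n r u" using assms unfolding SZ_carrier by blast
  have "laurent vv p k \<odot>\<^bsub>U\<^esub> u \<in> UZ m n" using u unfolding UZ_def by (intro zsubalg.scal)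
  then show ?thesis
    unfolding u(2) SZ_carrier eta.hom_simps(5)[OF UZ_closed[OF u(1)], symmetric] by (rule imageI)
qed

lemma SZ_inv: "x \<in> carrier SZr \<Longrightarrow> \<ominus>\<^bsub>S\<^esub> x \<in> carrier SZr"
  using SZ_laurent[of x "[:-1:]" 0] SZ_sub S.smult_minus_left[of x 1]
  unfolding laurent_const by auto

lemma SZ_lprod:
  "set xs \<subseteq> carrier SZr \<Longrightarrow> lprod S xs \<in> carrier SZr"
  by (induction xs) (simp_all add: SZ_one SZ_mult)

lemma SZ_gens:
  "a \<in> {1..<m+n} \<Longrightarrow> sE a \<in> carrier SZr"
  "a \<in> {1..<m+n} \<Longrightarrow> sF a \<in> carrier SZr"
  "Q.proj \<mu> \<in> carrier SZr"
proof -
  show "sE a \<in> carrier SZr" "sF a \<in> carrier SZr" if "a \<in> {1..<m+n}"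
    using UZ_mem(1,2)[OF that] unfolding SZ_carrier sch_def by blast+
  show "Q.proj \<mu> \<in> carrier SZr"
    unfolding Q.proj_def
  proof (rule SZ_lprod)
    have "Q.kbinom b t \<in> carrier SZr" if "b \<in> {1..m+n}" for b t
      using UZ_mem(3)[OF that, of t] unfolding SZ_carrier eta_Kbinom[OF that, symmetric] by (rule imageI)
    then show "set (map (\<lambda>b. Q.kbinom b (\<mu> b)) [1..<m+n+1]) \<subseteq> carrier SZr" by auto
  qed
qed

lemma SZ_gen: "j \<in> {1..<m+n} \<Longrightarrow> Q.gen \<mu> j \<in> carrier SZr"
  unfolding Q.gen_def by (intro SZ_mult SZ_gens)

lemma SZ_forward: "r \<le> m \<Longrightarrow> Q.forward \<in> carrier SZr"
proof -
  assume "r \<le> m"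
  have "s + r \<le> m + n \<Longrightarrow> Q.shiftF s \<in> carrier SZr" for s
  proof (induction s)
    case (Suc s)
    have "Q.fchain (s+1) (s+r+1) \<in> carrier SZr"
      unfolding Q.fchain_def by (rule SZ_lprod) (use Suc.prems SZ_gens(2) in auto)
    then show ?case using Suc unfolding Q.shiftF.simps by (intro SZ_mult) auto
  qed (simp add: SZ_one)
  then show ?thesis unfolding Q.forward_def using \<open>r \<le> m\<close> by (intro SZ_mult SZ_gens(3)) simp
qed

lemma SZ_backward: "r \<le> m \<Longrightarrow> Q.backward \<in> carrier SZr"
proof -
  assume "r \<le> m"
  have "s + r \<le> m + n \<Longrightarrow> Q.shiftE s \<in> carrier SZr" for s
  proof (induction s)
    case (Suc s)
    have "Q.echain (s+1) (s+r+1) \<in> carrier SZr"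
      unfolding Q.echain_def by (rule SZ_lprod) (use Suc.prems SZ_gens(1) in auto)
    then show ?case using Suc unfolding Q.shiftE.simps by (intro SZ_mult) auto
  qed (simp add: SZ_one)
  then show ?thesis unfolding Q.backward_def using \<open>r \<le> m\<close> by (intro SZ_mult SZ_gens(3)) simp
qed

lemma SZ_ring: "ring SZr"
proof -
  have "SZr = S\<lparr>carrier := carrier SZr\<rparr>" by (simp add: SZ_def)
  then show ?thesis
    using S.subalgebra_ring(1)[OF SZ_sub SZ_one SZ_add SZ_mult SZ_inv] by simp
qed

lemma SZ_minus:
  assumes "x \<in> carrier SZr" "y \<in> carrier SZr"
  shows "a_minus SZr x y = x \<ominus>\<^bsub>S\<^esub> y"
proof -
  have "SZr = S\<lparr>carrier := carrier SZr\<rparr>" by (simp add: SZ_def)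
  then show ?thesis
    using S.subalgebra_ring(2)[OF SZ_sub SZ_one SZ_add SZ_mult SZ_inv assms] by simp
qed

lemma SZ_specialisation: "specialisation SZr"
  by (intro specialisation.intro SZ_ring) (simp add: SZ_simps SZ_laurent)

context
  fixes q :: "'f::field"
  assumes q0: "q \<noteq> 0"
begin

abbreviation (input) "SFr \<equiv> SF q m n r"
abbreviation (input) "idm \<equiv> idem q m n r"

interpretation Z: specialisation q SZr by (rule SZ_specialisation)

text \<open>The map $b \mapsto b \otimes 1$ from the integral form to the specialised algebra.\<close>

abbreviation sp :: "sel \<Rightarrow> 'f sfel" where "sp b \<equiv> tens q SZr b 1"

lemma SF_assoc_alg: "assoc_alg SFr"
  unfolding SF_def by (rule Z.base_change_assoc_alg)

interpretation SF: assoc_alg "SFr" by (rule SF_assoc_alg)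

lemma sp_closed: "x \<in> carrier SZr \<Longrightarrow> sp x \<in> carrier SFr"
  unfolding SF_def by (rule Z.tens_closed)

lemma sp_mult:
  "x \<in> carrier SZr \<Longrightarrow> y \<in> carrier SZr \<Longrightarrow> sp (x \<otimes>\<^bsub>S\<^esub> y) = sp x \<otimes>\<^bsub>SFr\<^esub> sp y"
  using Z.tens_mult[of x y 1 1] unfolding SF_def SZ_simps by simp

lemma sp_minus:
  "x \<in> carrier SZr \<Longrightarrow> y \<in> carrier SZr \<Longrightarrow> sp (x \<ominus>\<^bsub>S\<^esub> y) = sp x \<ominus>\<^bsub>SFr\<^esub> sp y"
  using Z.spec_minus[of x y] unfolding SF_def by (simp add: SZ_minus)

lemma sp_two:
  assumes "x \<in> carrier SZr"
  shows "sp (two_q \<odot>\<^bsub>S\<^esub> x) = (q + inverse q) \<odot>\<^bsub>SFr\<^esub> sp x"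
    and "two_q \<odot>\<^bsub>S\<^esub> x \<in> carrier SZr"
  using Z.spec_laurent[OF assms, of "[:1,0,1:]" 1] SZ_laurent[OF assms, of "[:1,0,1:]" 1]
  unfolding laurent_two[OF q0] laurent_two[OF vv_nonzero] SZ_simps SF_def by auto

lemma idem_eq: "idm l = sp (Q.proj l)"
  unfolding idem_def etaF_def eta_proj ..

context
  fixes \<mu> :: "nat \<Rightarrow> nat"
  assumes sum_\<mu>: "(\<Sum>b\<in>{1..m+n}. \<mu> b) = r"
begin

lemma idem_props:
  "idm \<mu> \<in> carrier SFr"
  "idm \<mu> \<otimes>\<^bsub>SFr\<^esub> idm \<mu> = idm \<mu>"
  unfolding idem_eq sp_mult[OF SZ_gens(3) SZ_gens(3), symmetric] Q.proj_idem[OF sum_\<mu>]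
  by (rule sp_closed[OF SZ_gens(3)] refl)+

lemma telt_eq:
  assumes j: "j \<in> {1..<m+n}"
  shows "telt q m n r \<mu> j = q \<odot>\<^bsub>SFr\<^esub> sp (Q.gen \<mu> j) \<ominus>\<^bsub>SFr\<^esub> idm \<mu>"
proof -
  have "idm \<mu> \<otimes>\<^bsub>SFr\<^esub> etaF q m n r (uE m n j) \<otimes>\<^bsub>SFr\<^esub> etaF q m n r (uF m n j)
      \<otimes>\<^bsub>SFr\<^esub> idm \<mu> = sp (Q.gen \<mu> j)"
    unfolding Q.gen_eq[OF sum_\<mu> j, symmetric] idem_eq etaF_def sch_def[symmetric]
    using j by (simp only: sp_mult SZ_mult SZ_gens)
  then show ?thesis unfolding telt_def Let_def by simp
qed

lemma sp_gen_corner: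
  assumes j: "j \<in> {1..<m+n}"
  shows "sp (Q.gen \<mu> j) \<in> carrier (corner SFr (idm \<mu>))"
proof -
  have "sp (Q.gen \<mu> j) \<in> carrier SFr" by (rule sp_closed[OF SZ_gen[OF j]])
  moreover have "idm \<mu> \<otimes>\<^bsub>SFr\<^esub> sp (Q.gen \<mu> j) = sp (Q.gen \<mu> j)"
    "sp (Q.gen \<mu> j) \<otimes>\<^bsub>SFr\<^esub> idm \<mu> = sp (Q.gen \<mu> j)"
    unfolding idem_eq sp_mult[OF SZ_gens(3) SZ_gen[OF j], symmetric]
      sp_mult[OF SZ_gen[OF j] SZ_gens(3), symmetric] Q.gen_proj[OF sum_\<mu> j] by (rule refl)+
  ultimately show ?thesis unfolding SF.corner_carrier[OF idem_props] by simp
qed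

text \<open>The Hecke relations in the corner at a weight with ones at $s+1,\dots,s+r$ that lie on one side
  of the odd root.\<close>

lemma corner_hecke_system:
  assumes s: "s + r \<le> m + n" and sm: "\<And>i. i \<in> {1..<r} \<Longrightarrow> s + i \<noteq> m"
    and \<mu>: "\<And>i. i \<in> {1..r} \<Longrightarrow> \<mu> (s + i) = 1"
  shows "hecke_system (corner SFr (idm \<mu>)) (q\<^sup>2) r (\<lambda>i. telt q m n r \<mu> (s + i))"
proof -
  let ?C = "corner SFr (idm \<mu>)" and ?e = "idm \<mu>"
  have C: "assoc_alg ?C" by (rule SF.corner_assoc_alg[OF idem_props])
  interpret C: assoc_alg ?C by (rule C)
  have j: "s + i \<in> {1..<m+n}" if "i \<in> {1..<r}" for i using that s by auto
  note c = SZ_gen[OF j]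
  have step: "sp (Q.gen \<mu> (s + i)) \<otimes>\<^bsub>SFr\<^esub> sp (Q.gen \<mu> (s + i + 1)) \<otimes>\<^bsub>SFr\<^esub> sp (Q.gen \<mu> (s + i))
        \<ominus>\<^bsub>SFr\<^esub> sp (Q.gen \<mu> (s + i))
      = sp (Q.gen \<mu> (s + i + 1)) \<otimes>\<^bsub>SFr\<^esub> sp (Q.gen \<mu> (s + i)) \<otimes>\<^bsub>SFr\<^esub> sp (Q.gen \<mu> (s + i + 1))
        \<ominus>\<^bsub>SFr\<^esub> sp (Q.gen \<mu> (s + i + 1))"
    if i: "i \<in> {1..<r}" "i + 1 \<in> {1..<r}" for i
  proof -
    have j1: "s + i + 1 \<in> {1..<m+n}" using j[OF i(2)] by (simp only: add.assoc)
    have m1: "s + i + 1 \<noteq> m" using sm[OF i(2)] unfolding add.assoc .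
    have \<mu>1: "\<mu> (s + i) = 1" "\<mu> (s + i + 1) = 1" "\<mu> (s + i + 2) = 1"
      using \<mu>[of i] \<mu>[of "i+1"] \<mu>[of "i+2"] i by (auto simp: add.assoc)
    note cc = SZ_gen[OF j[OF i(1)]] SZ_gen[OF j1]
    show ?thesis
      using arg_cong[OF Q.gen_cubic[OF sum_\<mu> j[OF i(1)] j1 sm[OF i(1)] m1 \<mu>1], of sp] cc
      by (simp only: sp_minus sp_mult SZ_mult)
  qed
  have "hecke_system ?C (q\<^sup>2) r (\<lambda>i. q \<odot>\<^bsub>?C\<^esub> sp (Q.gen \<mu> (s + i)) \<ominus>\<^bsub>?C\<^esub> \<one>\<^bsub>?C\<^esub>)"
  proof (rule C.hecke_system_shift[where q' = "inverse q"])
    show "q * inverse q = 1" using q0 by simp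
  next
    fix i assume i: "i \<in> {1..<r}"
    have \<mu>i: "\<mu> (s + i) = 1" "\<mu> (s + i + 1) = 1" using \<mu>[of i] \<mu>[of "i+1"] i by (auto simp: add.assoc)
    show "sp (Q.gen \<mu> (s + i)) \<in> carrier ?C" by (rule sp_gen_corner[OF j[OF i]])
    show "sp (Q.gen \<mu> (s + i)) \<otimes>\<^bsub>?C\<^esub> sp (Q.gen \<mu> (s + i)) = (q + inverse q) \<odot>\<^bsub>?C\<^esub> sp (Q.gen \<mu> (s + i))"
      unfolding corner_simps sp_mult[OF c[OF i] c[OF i], symmetric] Q.gen_quad[OF sum_\<mu> j[OF i] sm[OF i] \<mu>i]
      by (rule sp_two(1)[OF c[OF i]])
    fix k assume k: "k \<in> {1..<r}"
    show "sp (Q.gen \<mu> (s + i)) \<otimes>\<^bsub>?C\<^esub> sp (Q.gen \<mu> (s + k)) = sp (Q.gen \<mu> (s + k)) \<otimes>\<^bsub>?C\<^esub> sp (Q.gen \<mu> (s + i))"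
      if "\<bar>int i - int k\<bar> > 1"
    proof -
      have d: "\<bar>int (s + i) - int (s + k)\<bar> > 1" using that by simp
      show ?thesis
        unfolding corner_simps sp_mult[OF c[OF i] c[OF k], symmetric] sp_mult[OF c[OF k] c[OF i], symmetric]
          Q.gen_comm[OF sum_\<mu> j[OF i] j[OF k] d] ..
    qed
    show "sp (Q.gen \<mu> (s + i)) \<otimes>\<^bsub>?C\<^esub> sp (Q.gen \<mu> (s + k)) \<otimes>\<^bsub>?C\<^esub> sp (Q.gen \<mu> (s + i)) \<ominus>\<^bsub>?C\<^esub> sp (Q.gen \<mu> (s + i))
      = sp (Q.gen \<mu> (s + k)) \<otimes>\<^bsub>?C\<^esub> sp (Q.gen \<mu> (s + i)) \<otimes>\<^bsub>?C\<^esub> sp (Q.gen \<mu> (s + k)) \<ominus>\<^bsub>?C\<^esub> sp (Q.gen \<mu> (s + k))"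
      if "\<bar>int i - int k\<bar> = 1"
    proof -
      have mi: "a_minus ?C (x \<otimes>\<^bsub>?C\<^esub> y \<otimes>\<^bsub>?C\<^esub> x) x = x \<otimes>\<^bsub>SFr\<^esub> y \<otimes>\<^bsub>SFr\<^esub> x \<ominus>\<^bsub>SFr\<^esub> x"
        if "x \<in> carrier ?C" "y \<in> carrier ?C" for x y
        using SF.corner_minus[OF idem_props, of "x \<otimes>\<^bsub>?C\<^esub> y \<otimes>\<^bsub>?C\<^esub> x" x] that C.m_closed
        unfolding corner_simps by blast
      note gi = sp_gen_corner[OF j[OF i]] and gk = sp_gen_corner[OF j[OF k]]
      from that consider "k = i + 1" | "i = k + 1" by linarith
      then show ?thesis
      proof cases
        case 1
        then show ?thesis using step[of i] i k unfolding mi[OF gi gk] mi[OF gk gi] by (simp add: add.assoc)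
      next
        case 2
        then show ?thesis using step[of k, symmetric] i k unfolding mi[OF gi gk] mi[OF gk gi] by (simp add: add.assoc)
      qed
    qed
  qed
  moreover have "q \<odot>\<^bsub>?C\<^esub> sp (Q.gen \<mu> (s + i)) \<ominus>\<^bsub>?C\<^esub> \<one>\<^bsub>?C\<^esub> = telt q m n r \<mu> (s + i)" if i: "i \<in> {1..<r}" for i
    using SF.corner_minus[OF idem_props C.smult_closed[OF sp_gen_corner[OF j[OF i]]] C.one_closed, of q]
    unfolding corner_simps telt_eq[OF j[OF i]] .
  ultimately show ?thesis
    unfolding hecke_system_def by (simp add: Pi_iff del: One_nat_def)
qed

end

context
  assumes rm: "r \<le> m" and rn: "r \<le> n"
begin

text \<open>The specialised monomials identify the corners at $\omega$ and $\omega'$ and intertwine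
  $T_i^\sharp$ with $\tau(T_i)$.\<close>

lemma transport_props:
  "sp Q.forward \<in> carrier SFr"
  "idm (omega' m n r) \<otimes>\<^bsub>SFr\<^esub> sp Q.forward = sp Q.forward"
  "sp Q.forward \<otimes>\<^bsub>SFr\<^esub> idm (omega r) = sp Q.forward"
  "sp Q.backward \<in> carrier SFr"
  "idm (omega r) \<otimes>\<^bsub>SFr\<^esub> sp Q.backward = sp Q.backward"
  "sp Q.backward \<otimes>\<^bsub>SFr\<^esub> sp Q.forward = idm (omega r)"
  "sp Q.forward \<otimes>\<^bsub>SFr\<^esub> sp Q.backward = idm (omega' m n r)"
proof -
  note f = SZ_forward[OF rm] and b = SZ_backward[OF rm]
  show "sp Q.forward \<in> carrier SFr" "sp Q.backward \<in> carrier SFr"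
    by (rule sp_closed[OF f] sp_closed[OF b])+
  show "idm (omega' m n r) \<otimes>\<^bsub>SFr\<^esub> sp Q.forward = sp Q.forward"
    "sp Q.forward \<otimes>\<^bsub>SFr\<^esub> idm (omega r) = sp Q.forward"
    "idm (omega r) \<otimes>\<^bsub>SFr\<^esub> sp Q.backward = sp Q.backward"
    "sp Q.backward \<otimes>\<^bsub>SFr\<^esub> sp Q.forward = idm (omega r)"
    "sp Q.forward \<otimes>\<^bsub>SFr\<^esub> sp Q.backward = idm (omega' m n r)"
    unfolding idem_eq sp_mult[OF SZ_gens(3) f, symmetric] sp_mult[OF f SZ_gens(3), symmetric]
      sp_mult[OF SZ_gens(3) b, symmetric] sp_mult[OF b f, symmetric] sp_mult[OF f b, symmetric]
      Q.forward_proj[OF rm rn] Q.backward_proj[OF rm rn] Q.backward_forward[OF rm rn]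
      Q.forward_backward[OF rm rn]
    by (rule refl)+
qed

lemma transport_intertwines:
  assumes i: "i \<in> {1..<r}"
  shows "sp Q.forward \<otimes>\<^bsub>SFr\<^esub> ((q\<^sup>2 - 1) \<odot>\<^bsub>SFr\<^esub> idm (omega r) \<ominus>\<^bsub>SFr\<^esub> telt q m n r (omega r) i)
    = telt q m n r (omega' m n r) (m + n - r + i) \<otimes>\<^bsub>SFr\<^esub> sp Q.forward"
proof -
  let ?N = "m + n - r"
  let ?e = "idm (omega r)" and ?e' = "idm (omega' m n r)" and ?p = "sp Q.forward"
  let ?a = "sp (Q.gen (omega r) i)" and ?b = "sp (Q.gen (omega' m n r) (?N + i))"
  have ii: "i \<in> {1..<m+n}" "?N + i \<in> {1..<m+n}" using i rm rn by auto
  note sums = Q.sum_omega[OF rm] Q.sum_omega'[OF rn]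
  note g = SZ_gen[OF ii(1), of "omega r"] SZ_gen[OF ii(2), of "omega' m n r"] SZ_forward[OF rm]
  note c = sp_closed[OF g(1)] sp_closed[OF g(2)] transport_props(1) idem_props(1)[OF sums(1)] idem_props(1)[OF sums(2)]
  have bp: "?b \<otimes>\<^bsub>SFr\<^esub> ?p = (q + inverse q) \<odot>\<^bsub>SFr\<^esub> ?p \<ominus>\<^bsub>SFr\<^esub> ?p \<otimes>\<^bsub>SFr\<^esub> ?a"
    using arg_cong[OF Q.forward_intertwines[OF rm rn i], of sp] g
    by (simp only: sp_mult sp_minus sp_two SZ_mult)
  let ?pa = "?p \<otimes>\<^bsub>SFr\<^esub> ?a"
  have pa: "?pa \<in> carrier SFr" using c by simp
  have q2: "q * (q + inverse q) = q\<^sup>2 + 1" using q0 by (simp add: distrib_left power2_eq_square)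
  have "telt q m n r (omega' m n r) (?N + i) \<otimes>\<^bsub>SFr\<^esub> ?p = q \<odot>\<^bsub>SFr\<^esub> (?b \<otimes>\<^bsub>SFr\<^esub> ?p) \<ominus>\<^bsub>SFr\<^esub> ?p"
    unfolding telt_eq[OF sums(2) ii(2)] using c transport_props(2)
    by (simp add: SF.minus_eq SF.l_distr SF.l_minus SF.smult_mult_l)
  also have "\<dots> = (q\<^sup>2 + 1) \<odot>\<^bsub>SFr\<^esub> ?p \<ominus>\<^bsub>SFr\<^esub> q \<odot>\<^bsub>SFr\<^esub> ?pa \<ominus>\<^bsub>SFr\<^esub> ?p"
    unfolding bp using c pa by (simp add: SF.smult_r_diff q2 flip: SF.smult_assoc)
  finally have 1: "telt q m n r (omega' m n r) (?N + i) \<otimes>\<^bsub>SFr\<^esub> ?p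
    = (q\<^sup>2 + 1) \<odot>\<^bsub>SFr\<^esub> ?p \<ominus>\<^bsub>SFr\<^esub> q \<odot>\<^bsub>SFr\<^esub> ?pa \<ominus>\<^bsub>SFr\<^esub> ?p" .
  have sq: "(q\<^sup>2 + 1) \<odot>\<^bsub>SFr\<^esub> ?p = q\<^sup>2 \<odot>\<^bsub>SFr\<^esub> ?p \<oplus>\<^bsub>SFr\<^esub> ?p"
    "(q\<^sup>2 - 1) \<odot>\<^bsub>SFr\<^esub> ?p = q\<^sup>2 \<odot>\<^bsub>SFr\<^esub> ?p \<ominus>\<^bsub>SFr\<^esub> ?p"
    using c by (simp_all add: SF.smult_l_distr SF.smult_l_diff)
  have "?p \<otimes>\<^bsub>SFr\<^esub> ((q\<^sup>2 - 1) \<odot>\<^bsub>SFr\<^esub> ?e \<ominus>\<^bsub>SFr\<^esub> telt q m n r (omega r) i)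
     = ?p \<otimes>\<^bsub>SFr\<^esub> ((q\<^sup>2 - 1) \<odot>\<^bsub>SFr\<^esub> ?e) \<ominus>\<^bsub>SFr\<^esub>
      (?p \<otimes>\<^bsub>SFr\<^esub> (q \<odot>\<^bsub>SFr\<^esub> ?a) \<ominus>\<^bsub>SFr\<^esub> ?p \<otimes>\<^bsub>SFr\<^esub> ?e)"
    unfolding telt_eq[OF sums(1) ii(1)] using c
    by (simp add: SF.minus_eq SF.r_distr SF.r_minus)
  also have "\<dots> = (q\<^sup>2 - 1) \<odot>\<^bsub>SFr\<^esub> ?p \<ominus>\<^bsub>SFr\<^esub> (q \<odot>\<^bsub>SFr\<^esub> ?pa \<ominus>\<^bsub>SFr\<^esub> ?p)"
    using c transport_props(3) by (simp add: SF.smult_mult_r)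
  also have "\<dots> = (q\<^sup>2 + 1) \<odot>\<^bsub>SFr\<^esub> ?p \<ominus>\<^bsub>SFr\<^esub> q \<odot>\<^bsub>SFr\<^esub> ?pa \<ominus>\<^bsub>SFr\<^esub> ?p"
    unfolding sq by (rule SF.add_sub_cancel[OF SF.smult_closed[OF c(3)] c(3) SF.smult_closed[OF pa]])
  finally show ?thesis unfolding 1 .
qed

end

end

end

section \<open>The isomorphism\<close>

theorem proposition9p3:
  fixes q :: "'f::field" and m n r :: nat
    and V :: "('f, 'f sfel, 'v::ab_group_add) smod"
  assumes "1 \<le> r" and "r \<le> m" and "r \<le> n"
    and "CHAR('f) \<noteq> 2" and "q \<noteq> 0"
    and "(\<exists>l\<ge>3. q ^ l = 1 \<and> (\<forall>k. 0 < k \<and> k < l \<longrightarrow> q ^ k \<noteq> 1)) \<or> (\<forall>k>0. q ^ k \<noteq> 1)"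
    and "supermodule (SF q m n r) (SFpart q m n r) V"
  shows "lmod_isomorphic (hecke (q^2) r)
           (twist (sharp (q^2) r) (schur_omega q m n r V))
           (twist (tau q m n r) (schur_functor (idem q m n r (omega' m n r)) V))"
proof -
  note q0 = \<open>q \<noteq> 0\<close> and rm = \<open>r \<le> m\<close> and rn = \<open>r \<le> n\<close>
  interpret Q: qschur_system "Salg m n r" m n r "sE m n r" "sF m n r" "sK m n r" "sKi m n r"
    by (rule qschur)
  have V: "left_module (SF q m n r) V" using assms(7) unfolding supermodule_def by blast
  note sums = Q.sum_omega[OF rm] Q.sum_omega'[OF rn]
  have t: "hecke_system (corner (SF q m n r) (idem q m n r (omega r))) (q\<^sup>2) r (\<lambda>i. telt q m n r (omega r) i)"
  proof -
    have "omega r (0 + i) = 1" if "i \<in> {1..r}" for i using that by (simp add: omega_def)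
    moreover have "0 + i \<noteq> m" if "i \<in> {1..<r}" for i using that rm by auto
    ultimately show ?thesis using corner_hecke_system[OF q0 sums(1), of 0] rm by simp
  qed
  have t': "hecke_system (corner (SF q m n r) (idem q m n r (omega' m n r))) (q\<^sup>2) r
      (\<lambda>i. telt q m n r (omega' m n r) (m + n - r + i))"
    by (rule corner_hecke_system[OF q0 sums(2)]) (use rm rn in \<open>auto simp: omega'_def\<close>)
  note tp = transport_props[OF q0 rm rn]
  show ?thesis
    unfolding schur_omega_def hecke_omega_def tau_def
    by (rule corner_modules_isomorphic[OF SF_assoc_alg[OF q0] V idem_props[OF q0 sums(1)] idem_props[OF q0 sums(2)]
          tp t t' transport_intertwines[OF q0 rm rn]])
qed

end
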